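(* There is an absolute constant $A>0$ such that the following holds. Let $n\ge 1$ be an integer, let $p_1,p_2,p_3$ be three distinct points in the plane $\mathbb{R}^2$, and, for $i=1,2,3$, let $\mathcal{C}_i$ be a family of $n$ unit circles in $\mathbb{R}^2$ that pass through $p_i$. Then the number of points of $\mathbb{R}^2$ that are incident to a circle of each of the families $\mathcal{C}_1,\mathcal{C}_2,\mathcal{C}_3$ is at most $A\,n^{11/6}$; that is, this number is $O(n^{11/6})$.
   Context: A unit circle is a circle of radius $1$ in $\mathbb{R}^2$. A point is incident to a circle if it lies on it.
   Formalization: It is additionally assumed that no circle belongs to all three families; otherwise (e.g. p1, p2, p3 on one unit circle S, n = 1, each family equal to {S}) every point of that circle is incident to all three families, so the number is infinite and the bound fails. *)

theory Defs
  imports "HOL-Analysis.Analysis"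
begin

definition unit_circle :: "(real ^ 2) set \<Rightarrow> bool" where
  "unit_circle \<gamma> \<longleftrightarrow> (\<exists>c. \<gamma> = sphere c 1)"

text \<open>
  For \<open>n \<ge> 1\<close> the condition \<open>card \<C> = n\<close> includes finiteness of \<open>\<C>\<close>.
\<close>

definition unit_circles_through :: "real ^ 2 \<Rightarrow> nat \<Rightarrow> (real ^ 2) set set \<Rightarrow> bool" where
  "unit_circles_through p n \<C> \<longleftrightarrow> card \<C> = n \<and> (\<forall>\<gamma>\<in>\<C>. unit_circle \<gamma> \<and> p \<in> \<gamma>)"

definition triple_points ::
  "(real ^ 2) set set \<Rightarrow> (real ^ 2) set set \<Rightarrow> (real ^ 2) set set \<Rightarrow> (real ^ 2) set" where
  "triple_points \<C>1 \<C>2 \<C>3 =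
     {q. (\<exists>\<gamma>\<in>\<C>1. q \<in> \<gamma>) \<and> (\<exists>\<gamma>\<in>\<C>2. q \<in> \<gamma>) \<and> (\<exists>\<gamma>\<in>\<C>3. q \<in> \<gamma>)}"

text \<open>
  If the three base points lie on one unit circle and that circle belongs to all three
  families, then every point of it is a triple point, so there are infinitely many of them.
  A bound on their number therefore presupposes \<open>\<C>1 \<inter> \<C>2 \<inter> \<C>3 = {}\<close>.
  A circle shared by only two of the families is harmless. Because \<open>card\<close> is \<open>0\<close> on infinite
  sets, such a bound also has to assert finiteness separately.
\<close>

end

theory Submission
  imports Defs "HOL-Library.Landau_Symbols"
begin

text \<open>
  Identify the plane with the complex numbers.  A unit circle through \<open>p1\<close> has its centre at
  \<open>p1 + x\<close> for a unit number \<open>x\<close>; likewise the circles of the other families are given by unit numbers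
  \<open>v\<close> (through \<open>p2\<close>) and \<open>w\<close> (through \<open>p3\<close>).  A point \<open>q\<close> of the first circle is \<open>q = p1 + x + s\<close> with
  \<open>s\<close> a unit number, so the whole problem depends only on \<open>p = p1 - p2\<close> and \<open>d = p1 - p3\<close>.
  Circles that contain two of the base points are set aside first: there are at most six of them, and
  each carries \<open>O(n)\<close> triple points, because it is missing from one of the families.

  Choose for every triple point one circle of each family.  By Cauchy-Schwarz over the third family,
  the square of the number of triple points is at most \<open>n\<close> times the number of pairs of triple points on a
  common third circle, and such a pair is determined up to four choices by the parameters \<open>x, y\<close> of its
  two first circles and \<open>v, v'\<close> of its two second circles.  Hence it suffices to bound by \<open>O(n^(8/3))\<close>
  the incidences between the \<open>n * n\<close> points \<open>(x, y)\<close> and the \<open>n * n\<close> curves indexed by \<open>(v, v')\<close>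
  (\<open>incidence_bound\<close>); the exponent \<open>11/6\<close> is half of \<open>1 + 8/3\<close>.

  The points form a grid, so no general incidence theorem for curves is needed.
  Cut the range of the real part of \<open>x\<close>, and that of \<open>y\<close>, into about \<open>n^(2/3)\<close> blocks of about \<open>n^(1/3)\<close>
  values.  A curve crosses each dividing line boundedly often and so visits only \<open>O(n^(2/3))\<close> of the
  product cells (\<open>few_cells_of_curve\<close>).  If two points of a cell lie on boundedly many common curves,
  counting pairs of points within the cells gives the bound (\<open>incidences_in_cells\<close>).

  What remains is the real content: apart from pairs that are few enough not to matter, two points
  \<open>(x1, y1)\<close> and \<open>(x2, y2)\<close> lie on boundedly many common curves (\<open>few_common_curves\<close>).
  A common curve closes a cycle of eight biquadratic relations among eight unknowns.  All unknowns but one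
  are eliminated by successive resultants, so that, if there are too many common curves, the remaining
  unknown \<open>s\<close>, a point of the circle \<open>x1\<close>, may be chosen freely in the complex domain.  Let \<open>s\<close> tend to a
  value where the point lies on the circle of radius two about \<open>p3\<close>, the envelope of the unit circles
  through \<open>p3\<close>.  There \<open>w\<close> depends on \<open>s\<close> like a square root, whereas the other seven relations of the
  cycle express \<open>w\<close> as a Lipschitz function of \<open>s\<close>.  This contradiction (\<open>no_cycle_near_fold\<close>) is where the
  geometry enters: for lines in place of unit circles there is no envelope, and the statement fails.
\<close>

section \<open>Eliminating variables from a tower of quadratic equations\<close>

text \<open>
  Multivariate polynomials are represented by the functions they induce: \<open>polyfn k d F\<close> says that \<open>F\<close> is a
  polynomial of degree at most \<open>d\<close> in each of the variables \<open>e 0, \<dots>, e (k - 1)\<close>.  Only the existence of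
  degree bounds matters below, never their size.
\<close>

primrec polyfn :: "nat \<Rightarrow> nat \<Rightarrow> ((nat \<Rightarrow> complex) \<Rightarrow> complex) \<Rightarrow> bool" where
  "polyfn 0 d F \<longleftrightarrow> (\<exists>c. F = (\<lambda>_. c))"
| "polyfn (Suc k) d F \<longleftrightarrow>
     (\<exists>g. (\<forall>j. polyfn k d (g j)) \<and> F = (\<lambda>e. \<Sum>j\<le>d. g j e * e k ^ j))"

lemma polyfn_SucI:
  "F = (\<lambda>e. \<Sum>j\<le>d. g j e * e k ^ j) \<Longrightarrow> \<forall>j. polyfn k d (g j) \<Longrightarrow> polyfn (Suc k) d F"
  by auto

lemma polyfn_const: "polyfn k d (\<lambda>_. c)"
proof (induction k arbitrary: c)
  case (Suc k)
  have "(\<lambda>e::nat\<Rightarrow>complex. c) = (\<lambda>e. \<Sum>j\<le>d. (if j = 0 then c else 0) * e k ^ j)"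
    by (auto simp: fun_eq_iff if_distrib[of "\<lambda>x. x * _"] sum.delta cong: if_cong)
  moreover have "\<forall>j. polyfn k d (\<lambda>_. if j = 0 then c else 0)" using Suc by simp
  ultimately show ?case by (rule polyfn_SucI)
qed auto

lemma polyfn_mono: "polyfn k d F \<Longrightarrow> d \<le> d' \<Longrightarrow> polyfn k d' F"
proof (induction k arbitrary: F)
  case (Suc k)
  then obtain g where g: "\<And>j. polyfn k d (g j)" "F = (\<lambda>e. \<Sum>j\<le>d. g j e * e k ^ j)" by auto
  let ?g = "\<lambda>j. if j \<le> d then g j else (\<lambda>_. 0)"
  have "F = (\<lambda>e. \<Sum>j\<le>d'. ?g j e * e k ^ j)"
    unfolding g(2) using Suc.prems(2)
    by (intro ext sum.mono_neutral_cong_left) auto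
  moreover have "\<forall>j. polyfn k d' (?g j)" using Suc.IH g(1) Suc.prems(2) polyfn_const by auto
  ultimately show ?case by (rule polyfn_SucI)
qed auto

lemma polyfn_add: "polyfn k d F \<Longrightarrow> polyfn k d H \<Longrightarrow> polyfn k d (\<lambda>e. F e + H e)"
proof (induction k arbitrary: F H)
  case (Suc k)
  then obtain g h where g: "\<And>j. polyfn k d (g j)" "F = (\<lambda>e. \<Sum>j\<le>d. g j e * e k ^ j)"
    and h: "\<And>j. polyfn k d (h j)" "H = (\<lambda>e. \<Sum>j\<le>d. h j e * e k ^ j)" by auto
  have "(\<lambda>e. F e + H e) = (\<lambda>e. \<Sum>j\<le>d. (g j e + h j e) * e k ^ j)"
    unfolding g h by (simp add: sum.distrib ring_distribs)
  moreover have "\<forall>j. polyfn k d (\<lambda>e. g j e + h j e)" using Suc.IH g h by auto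
  ultimately show ?case by (rule polyfn_SucI)
qed auto

lemma polyfn_sum: "finite S \<Longrightarrow> (\<And>i. i \<in> S \<Longrightarrow> polyfn k d (F i)) \<Longrightarrow> polyfn k d (\<lambda>e. \<Sum>i\<in>S. F i e)"
  by (induction S rule: finite_induct) (auto intro: polyfn_const polyfn_add)

lemma polyfn_mult: "polyfn k d F \<Longrightarrow> polyfn k d' H \<Longrightarrow> polyfn k (d + d') (\<lambda>e. F e * H e)"
proof (induction k arbitrary: F H)
  case (Suc k)
  then obtain g h where g: "\<And>j. polyfn k d (g j)" "F = (\<lambda>e. \<Sum>j\<le>d. g j e * e k ^ j)"
    and h: "\<And>j. polyfn k d' (h j)" "H = (\<lambda>e. \<Sum>j\<le>d'. h j e * e k ^ j)" by auto
  define c where "c m = (\<lambda>e. \<Sum>i\<le>m. (if i \<le> d then g i e else 0) * (if m - i \<le> d' then h (m - i) e else 0))" for m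
  have "F e * H e = (\<Sum>m\<le>d+d'. c m e * e k ^ m)" for e
  proof -
    have "F e * H e = (\<Sum>i\<le>d. (if i \<le> d then g i e else 0) * e k ^ i) * (\<Sum>j\<le>d'. (if j \<le> d' then h j e else 0) * e k ^ j)"
      unfolding g h by simp
    also have "\<dots> = (\<Sum>m\<le>d+d'. c m e * e k ^ m)"
      unfolding c_def by (subst polynomial_product) auto
    finally show ?thesis .
  qed
  hence "(\<lambda>e. F e * H e) = (\<lambda>e. \<Sum>m\<le>d+d'. c m e * e k ^ m)" by auto
  moreover have "\<forall>m. polyfn k (d + d') (c m)"
    unfolding c_def
  proof (intro allI polyfn_sum Suc.IH)
    fix m i
    show "polyfn k d (\<lambda>e. if i \<le> d then g i e else 0)"
      using g(1)[of i] polyfn_const by (cases "i \<le> d") auto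
    show "polyfn k d' (\<lambda>e. if m - i \<le> d' then h (m - i) e else 0)"
      using h(1)[of "m - i"] polyfn_const by (cases "m - i \<le> d'") auto
  qed auto
  ultimately show ?case by (rule polyfn_SucI)
qed auto

lemma polyfn_Suc: assumes "polyfn k d F" shows "polyfn (Suc k) d F"
proof -
  let ?g = "\<lambda>j. if j = 0 then F else (\<lambda>_. 0)"
  have "F = (\<lambda>e. \<Sum>j\<le>d. ?g j e * e k ^ j)"
    by (auto simp: fun_eq_iff if_distrib[of "\<lambda>x. x _ * _"] sum.delta cong: if_cong)
  moreover have "\<forall>j. polyfn k d (?g j)" using assms polyfn_const by auto
  ultimately show ?thesis by (rule polyfn_SucI)
qed

lemma polyfn_var: "i < k \<Longrightarrow> polyfn k 1 (\<lambda>e. e i)"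
proof (induction k)
  case (Suc k)
  show ?case
  proof (cases "i = k")
    case True
    let ?g = "\<lambda>j. (\<lambda>_::nat\<Rightarrow>complex. if j = 1 then 1 else 0 :: complex)"
    have "(\<lambda>e. e i) = (\<lambda>e. \<Sum>j\<le>(1::nat). ?g j e * e k ^ j)" using True by auto
    moreover have "\<forall>j. polyfn k 1 (?g j)" using polyfn_const by auto
    ultimately show ?thesis by (rule polyfn_SucI)
  next
    case False
    thus ?thesis using Suc by (intro polyfn_Suc) auto
  qed
qed auto

lemma polyfn_cong: "polyfn k d F \<Longrightarrow> (\<And>i. i < k \<Longrightarrow> e i = e' i) \<Longrightarrow> F e = F e'"
proof (induction k arbitrary: F)
  case (Suc k)
  then obtain g where g: "\<And>j. polyfn k d (g j)" "F = (\<lambda>e. \<Sum>j\<le>d. g j e * e k ^ j)" by auto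
  have "g j e = g j e'" for j using Suc g by auto
  thus ?case unfolding g using Suc.prems by auto
qed auto

lemma polyfn_tendsto:
  "polyfn k d F \<Longrightarrow> (\<And>i. i < k \<Longrightarrow> (\<lambda>n. E n i) \<longlonglongrightarrow> e i) \<Longrightarrow> (\<lambda>n. F (E n)) \<longlonglongrightarrow> F e"
proof (induction k arbitrary: F)
  case (Suc k)
  then obtain g where g: "\<And>j. polyfn k d (g j)" "F = (\<lambda>e. \<Sum>j\<le>d. g j e * e k ^ j)" by auto
  have "(\<lambda>n. g j (E n)) \<longlonglongrightarrow> g j e" for j using Suc g by auto
  thus ?case unfolding g using Suc.prems by (auto intro!: tendsto_intros)
qed auto

lemma polyfn_1_roots:
  assumes "polyfn 1 d F"
  shows "(\<forall>e. F e = 0) \<or> (finite {s. \<exists>e. e 0 = s \<and> F e = 0} \<and> card {s. \<exists>e. e 0 = s \<and> F e = 0} \<le> d)"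
proof -
  obtain g where g: "\<And>j. polyfn 0 d (g j)" "F = (\<lambda>e. \<Sum>j\<le>d. g j e * e 0 ^ j)" using assms by auto
  obtain c where c: "\<And>j. g j = (\<lambda>_. c j)" using g(1) unfolding polyfn.simps by metis
  have F: "F e = (\<Sum>j\<le>d. c j * e 0 ^ j)" for e unfolding g c ..
  have eq: "{s. \<exists>e. e 0 = s \<and> F e = 0} = {s. (\<Sum>j\<le>d. c j * s ^ j) = 0}"
    unfolding F by (auto intro: exI[of _ "\<lambda>_. _"])
  show ?thesis
  proof (cases "\<forall>j\<le>d. c j = 0")
    case True thus ?thesis unfolding F by auto
  next
    case False
    then obtain j where "c j \<noteq> 0" "j \<le> d" by auto
    thus ?thesis unfolding eq using polyfun_rootbound by blast
  qed
qed

declare polyfn.simps [simp del]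


text \<open>
  Pseudo-reduction modulo \<open>a * y^2 + b * y + c\<close>: the pair computed for \<open>j\<close> is the linear polynomial in \<open>y\<close>
  to which \<open>a^j * y^j\<close> reduces.
\<close>

fun reduce_power :: "(('e \<Rightarrow> complex) \<Rightarrow> ('e \<Rightarrow> complex) \<Rightarrow> ('e \<Rightarrow> complex) \<Rightarrow> nat \<Rightarrow> 'e \<Rightarrow> complex \<times> complex)" where
  "reduce_power a b c 0 e = (0, 1)"
| "reduce_power a b c (Suc j) e = (let (\<alpha>, \<beta>) = reduce_power a b c j e in (a e * \<beta> - b e * \<alpha>, - c e * \<alpha>))"

lemma reduce_power_eq:
  assumes "a e * y^2 + b e * y + c e = 0"
  shows "a e ^ j * y ^ j = fst (reduce_power a b c j e) * y + snd (reduce_power a b c j e)"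
proof (induction j)
  case (Suc j)
  obtain \<alpha> \<beta> where ab: "reduce_power a b c j e = (\<alpha>, \<beta>)" by fastforce
  have "a e ^ Suc j * y ^ Suc j = a e * y * (\<alpha> * y + \<beta>)" using Suc ab by (simp add: algebra_simps)
  also have "\<dots> = \<alpha> * (a e * y^2) + a e * \<beta> * y" by (simp add: algebra_simps power2_eq_square)
  also have "a e * y^2 = - b e * y - c e" using assms by (simp add: eq_neg_iff_add_eq_0 eq_diff_eq add_ac)
  finally show ?case using ab by (simp add: algebra_simps)
qed simp

lemma polyfn_uminus: "polyfn k d F \<Longrightarrow> polyfn k d (\<lambda>e. - F e)"
  using polyfn_mult[OF polyfn_const[of k 0 "-1"], of d F] by simp

lemma polyfn_reduce_power:
  assumes "polyfn k m a" "polyfn k m b" "polyfn k m c"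
  shows "polyfn k (j * m) (\<lambda>e. fst (reduce_power a b c j e)) \<and> polyfn k (j * m) (\<lambda>e. snd (reduce_power a b c j e))"
proof (induction j)
  case (Suc j)
  let ?f = "\<lambda>e. fst (reduce_power a b c j e)" and ?s = "\<lambda>e. snd (reduce_power a b c j e)"
  have "polyfn k (m + j * m) (\<lambda>e. a e * ?s e + - (b e * ?f e))"
    by (intro polyfn_add polyfn_uminus polyfn_mult[OF assms(1)] polyfn_mult[OF assms(2)]
        Suc.IH[THEN conjunct1] Suc.IH[THEN conjunct2])
  moreover have "polyfn k (m + j * m) (\<lambda>e. - (c e * ?f e))"
    by (intro polyfn_uminus polyfn_mult[OF assms(3)] Suc.IH[THEN conjunct1])
  ultimately show ?case by (simp add: case_prod_unfold Let_def)
qed (simp add: polyfn_const)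

lemma polyfn_pow: "polyfn k m a \<Longrightarrow> polyfn k (j * m) (\<lambda>e. a e ^ j)"
  by (induction j) (simp_all add: polyfn_const polyfn_mult)

text \<open>
  Modulo the quadratic, a power of the leading coefficient \<open>a\<close> times \<open>F\<close> becomes a linear polynomial
  \<open>\<alpha> * y + \<beta>\<close>, and \<open>N\<close> is the resultant \<open>a * \<beta>^2 - b * \<alpha> * \<beta> + c * \<alpha>^2\<close> of the two.  It vanishes at
  every common zero, even where the quadratic degenerates; conversely a zero of \<open>N\<close> lifts to a common zero
  as long as \<open>a\<close> does not vanish.
\<close>

lemma eliminate_quadratic:
  assumes F: "polyfn (Suc k) d F" and abc: "polyfn k m a" "polyfn k m b" "polyfn k m c"
  shows "\<exists>N. polyfn k (m + 2 * (d + d * m + d * m)) N \<and>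
     (\<forall>e. a e * e k^2 + b e * e k + c e = 0 \<longrightarrow> F e = 0 \<longrightarrow> N e = 0) \<and>
     (\<forall>e. N e = 0 \<longrightarrow> a e \<noteq> 0 \<longrightarrow> (\<exists>y. a e * y^2 + b e * y + c e = 0 \<and> F (e(k := y)) = 0))"
proof -
  obtain g where g: "\<And>j. polyfn k d (g j)" "F = (\<lambda>e. \<Sum>j\<le>d. g j e * e k ^ j)" using F unfolding polyfn.simps by auto
  define \<alpha> where "\<alpha> e = (\<Sum>j\<le>d. g j e * a e ^ (d - j) * fst (reduce_power a b c j e))" for e
  define \<beta> where "\<beta> e = (\<Sum>j\<le>d. g j e * a e ^ (d - j) * snd (reduce_power a b c j e))" for e
  have red: "a e ^ d * F (e(k := y)) = \<alpha> e * y + \<beta> e" if "a e * y^2 + b e * y + c e = 0" for e y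
  proof -
    have "g j (e(k := y)) = g j e" for j by (rule polyfn_cong[OF g(1)]) auto
    hence "a e ^ d * F (e(k := y)) = (\<Sum>j\<le>d. g j e * a e ^ (d - j) * (a e ^ j * y ^ j))"
      unfolding g by (auto simp: sum_distrib_left intro!: sum.cong simp flip: power_add)
    also have "\<dots> = (\<Sum>j\<le>d. g j e * a e ^ (d - j) * (fst (reduce_power a b c j e) * y + snd (reduce_power a b c j e)))"
      using reduce_power_eq[of a e y b c] that by simp
    finally show ?thesis unfolding \<alpha>_def \<beta>_def
      by (simp add: sum.distrib sum_distrib_right sum_distrib_left algebra_simps)
  qed
  let ?D = "d + d * m + d * m"
  have summand: "polyfn k ?D (\<lambda>e. g j e * a e ^ (d - j) * H e)"
    if "j \<le> d" "polyfn k (j * m) H" for j H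
  proof -
    have "polyfn k (d * m) (\<lambda>e. a e ^ (d - j))" "polyfn k (d * m) H"
      using polyfn_mono[OF polyfn_pow[OF abc(1), of "d - j"], of "d * m"] polyfn_mono[OF that(2), of "d * m"]
        that(1) by simp_all
    thus ?thesis by (intro polyfn_mult g(1))
  qed
  have p\<alpha>: "polyfn k ?D \<alpha>" and p\<beta>: "polyfn k ?D \<beta>"
    unfolding \<alpha>_def[abs_def] \<beta>_def[abs_def]
    using polyfn_reduce_power[OF abc] by (intro polyfn_sum summand; simp)+
  define N where "N e = a e * (\<beta> e * \<beta> e) + (- (b e * (\<alpha> e * \<beta> e)) + c e * (\<alpha> e * \<alpha> e))" for e
  have sq: "polyfn k (m + 2 * ?D) (\<lambda>e. u e * (v e * w e))" if "polyfn k m u" "polyfn k ?D v" "polyfn k ?D w" for u v w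
    using polyfn_mult[OF that(1) polyfn_mult[OF that(2,3)]] by (simp only: mult_2)
  have "polyfn k (m + 2 * ?D) N" unfolding N_def[abs_def]
    by (rule polyfn_add[OF sq[OF abc(1) p\<beta> p\<beta>]
          polyfn_add[OF polyfn_uminus[OF sq[OF abc(2) p\<alpha> p\<beta>]] sq[OF abc(3) p\<alpha> p\<alpha>]]])
  moreover have "N e = 0" if "a e * e k^2 + b e * e k + c e = 0" "F e = 0" for e
  proof -
    have "\<alpha> e * e k + \<beta> e = 0" using red[OF that(1)] that(2) by simp
    hence b: "\<beta> e = - \<alpha> e * e k" by (simp add: add_eq_0_iff2)
    have "N e = (\<alpha> e)^2 * (a e * e k^2 + b e * e k + c e)"
      unfolding N_def b by (simp add: algebra_simps power2_eq_square)
    thus ?thesis using that by simp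
  qed
  moreover have "\<exists>y. a e * y^2 + b e * y + c e = 0 \<and> F (e(k := y)) = 0" if N0: "N e = 0" and a0: "a e \<noteq> 0" for e
  proof (cases "\<alpha> e = 0")
    case True
    hence "\<beta> e = 0" using N0 a0 unfolding N_def by simp
    obtain y where y: "a e * y^2 + b e * y + c e = 0"
    proof -
      define r where "r = csqrt (b e^2 - 4 * a e * c e)"
      have "r^2 = b e^2 - 4 * a e * c e" unfolding r_def by simp
      hence "a e * ((r - b e) / (2 * a e))^2 + b e * ((r - b e) / (2 * a e)) + c e = 0"
        using a0 by (simp add: field_simps power2_eq_square) algebra
      thus ?thesis using that by blast
    qed
    thus ?thesis using red[OF y] True \<open>\<beta> e = 0\<close> a0 by auto
  next
    case False
    define y where "y = - \<beta> e / \<alpha> e"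
    have "\<beta> e = - \<alpha> e * y" using False unfolding y_def by simp
    hence "N e = (\<alpha> e)^2 * (a e * y^2 + b e * y + c e)"
      unfolding N_def by (simp add: algebra_simps power2_eq_square)
    hence y: "a e * y^2 + b e * y + c e = 0" using N0 False by simp
    thus ?thesis using red[OF y] a0 False \<open>\<beta> e = - \<alpha> e * y\<close> by auto
  qed
  ultimately show ?thesis by blast
qed

text \<open>
  In a tower the \<open>k\<close>-th equation is quadratic in \<open>e k\<close> with coefficients in the earlier variables.  The point
  of the definition is that \<open>D\<close> depends only on the height of the tower and on the degree of \<open>F\<close>, not on
  the coefficients: this is what makes the final constant absolute.  \<open>N k\<close> is what remains of \<open>F\<close> after
  the variables from \<open>k\<close> on have been eliminated.
\<close>

definition eliminates :: "nat \<Rightarrow> nat \<Rightarrow> nat \<Rightarrow> bool" where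
  "eliminates m d D \<longleftrightarrow> (\<forall>a b c F. (\<forall>k\<in>{1..m}. polyfn k 2 (a k) \<and> polyfn k 2 (b k) \<and> polyfn k 2 (c k)) \<longrightarrow>
     polyfn (Suc m) d F \<longrightarrow>
     (\<exists>N. polyfn 1 D (N 1) \<and> N (Suc m) = F \<and>
       (\<forall>e. (\<forall>k\<in>{1..m}. a k e * e k^2 + b k e * e k + c k e = 0) \<longrightarrow> F e = 0 \<longrightarrow> N 1 e = 0) \<and>
       (\<forall>k\<in>{1..m}. \<forall>e. N k e = 0 \<longrightarrow> a k e \<noteq> 0 \<longrightarrow>
           (\<exists>y. a k e * y^2 + b k e * y + c k e = 0 \<and> N (Suc k) (e(k := y)) = 0))))"

lemma eliminate_tower: "\<exists>D. eliminates m d D"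
proof (induction m arbitrary: d)
  case 0
  show ?case unfolding eliminates_def
  proof (intro exI[of _ d] allI impI)
    fix a b c :: "nat \<Rightarrow> (nat \<Rightarrow> complex) \<Rightarrow> complex" and F
    assume "polyfn (Suc 0) d F"
    thus "\<exists>N. polyfn 1 d (N 1) \<and> N (Suc 0) = F \<and>
       (\<forall>e. (\<forall>k\<in>{1..0}. a k e * e k^2 + b k e * e k + c k e = 0) \<longrightarrow> F e = 0 \<longrightarrow> N 1 e = 0) \<and>
       (\<forall>k\<in>{1..0}. \<forall>e. N k e = 0 \<longrightarrow> a k e \<noteq> 0 \<longrightarrow>
           (\<exists>y. a k e * y^2 + b k e * y + c k e = 0 \<and> N (Suc k) (e(k := y)) = 0))"
      by (intro exI[of _ "\<lambda>_. F"]) (simp del: polyfn.simps)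
  qed
next
  case (Suc m)
  from Suc.IH[of "2 + 2 * (d + d * 2 + d * 2)"] obtain D where
    D: "eliminates m (2 + 2 * (d + d * 2 + d * 2)) D" ..
  show ?case unfolding eliminates_def
  proof (intro exI[of _ D] allI impI)
    fix a b c F
    assume abc: "\<forall>k\<in>{1..Suc m}. polyfn k 2 (a k) \<and> polyfn k 2 (b k) \<and> polyfn k 2 (c k)"
      and F: "polyfn (Suc (Suc m)) d F"
    obtain N1 where N1: "polyfn (Suc m) (2 + 2 * (d + d * 2 + d * 2)) N1"
      "\<And>e. a (Suc m) e * e (Suc m)^2 + b (Suc m) e * e (Suc m) + c (Suc m) e = 0 \<Longrightarrow> F e = 0 \<Longrightarrow> N1 e = 0"
      "\<And>e. N1 e = 0 \<Longrightarrow> a (Suc m) e \<noteq> 0 \<Longrightarrow>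
         (\<exists>y. a (Suc m) e * y^2 + b (Suc m) e * y + c (Suc m) e = 0 \<and> F (e(Suc m := y)) = 0)"
      using eliminate_quadratic[OF F, of 2 "a (Suc m)" "b (Suc m)" "c (Suc m)"] abc by auto
    have "\<forall>k\<in>{1..m}. polyfn k 2 (a k) \<and> polyfn k 2 (b k) \<and> polyfn k 2 (c k)" using abc by auto
    from D[unfolded eliminates_def, THEN spec, THEN spec, THEN spec, THEN spec, THEN mp, THEN mp, OF this N1(1)] obtain N where N: "polyfn 1 D (N 1)" "N (Suc m) = N1"
      "\<And>e. (\<forall>k\<in>{1..m}. a k e * e k^2 + b k e * e k + c k e = 0) \<Longrightarrow> N1 e = 0 \<Longrightarrow> N 1 e = 0"
      "\<And>k e. k\<in>{1..m} \<Longrightarrow> N k e = 0 \<Longrightarrow> a k e \<noteq> 0 \<Longrightarrow>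
           (\<exists>y. a k e * y^2 + b k e * y + c k e = 0 \<and> N (Suc k) (e(k := y)) = 0)" by (elim exE conjE) blast
    let ?N = "N(Suc (Suc m) := F)"
    show "\<exists>N. polyfn 1 D (N 1) \<and> N (Suc (Suc m)) = F \<and>
       (\<forall>e. (\<forall>k\<in>{1..Suc m}. a k e * e k^2 + b k e * e k + c k e = 0) \<longrightarrow> F e = 0 \<longrightarrow> N 1 e = 0) \<and>
       (\<forall>k\<in>{1..Suc m}. \<forall>e. N k e = 0 \<longrightarrow> a k e \<noteq> 0 \<longrightarrow>
           (\<exists>y. a k e * y^2 + b k e * y + c k e = 0 \<and> N (Suc k) (e(k := y)) = 0))"
    proof (rule exI[of _ ?N], intro conjI allI impI ballI)
      show "polyfn 1 D (?N 1)" using N(1) by simp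
      show "?N (Suc (Suc m)) = F" by simp
    next
      fix e assume *: "\<forall>k\<in>{1..Suc m}. a k e * e k^2 + b k e * e k + c k e = 0" "F e = 0"
      have "N1 e = 0" by (rule N1(2)) (use * in auto)
      hence "N 1 e = 0" by (rule N(3)[rotated]) (use * in auto)
      thus "?N 1 e = 0" by simp
    next
      fix k e assume k: "k \<in> {1..Suc m}" "?N k e = 0" "a k e \<noteq> 0"
      show "\<exists>y. a k e * y^2 + b k e * y + c k e = 0 \<and> ?N (Suc k) (e(k := y)) = 0"
      proof (cases "k = Suc m")
        case True
        hence "N1 e = 0" using k(2) N(2) by simp
        from N1(3)[OF this] show ?thesis using k(3) True by simp
      next
        case False
        hence "k \<in> {1..m}" "N k e = 0" using k(1,2) by auto
        from N(4)[OF this k(3)] show ?thesis using False by simp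
      qed
    qed
  qed
qed

section \<open>Limits of solutions of a tower\<close>

lemma quadratic_roots_bounded:
  fixes \<alpha> \<beta> \<gamma> :: "nat \<Rightarrow> complex"
  assumes "\<alpha> \<longlonglongrightarrow> \<alpha>0" "\<beta> \<longlonglongrightarrow> \<beta>0" "\<gamma> \<longlonglongrightarrow> \<gamma>0" "\<alpha>0 \<noteq> 0"
    and root: "\<And>n. \<alpha> n * y n^2 + \<beta> n * y n + \<gamma> n = 0" and nz: "\<And>n. \<alpha> n \<noteq> 0"
  shows "bounded (range y)"
proof -
  have "Bseq (\<lambda>n. \<beta> n / \<alpha> n)" "Bseq (\<lambda>n. \<gamma> n / \<alpha> n)"
    using assms by (auto intro!: convergent_imp_Bseq convergentI tendsto_divide)
  then obtain K L where K: "\<And>n. norm (\<beta> n / \<alpha> n) \<le> K" and L: "\<And>n. norm (\<gamma> n / \<alpha> n) \<le> L"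
    unfolding Bseq_def by blast
  have "norm (y n) \<le> max 1 (K + L)" for n
  proof (cases "norm (y n) \<le> 1")
    case False
    have "y n^2 = - (\<beta> n / \<alpha> n * y n + \<gamma> n / \<alpha> n)"
      using root[of n] nz[of n] by (simp add: field_simps add_eq_0_iff)
    hence "norm (y n)^2 \<le> norm (\<beta> n / \<alpha> n) * norm (y n) + norm (\<gamma> n / \<alpha> n)"
      by (metis norm_minus_cancel norm_mult norm_power norm_triangle_ineq)
    also have "\<dots> \<le> K * norm (y n) + L * norm (y n)"
    proof -
      have "L \<ge> 0" using L[of n] norm_ge_zero order_trans by blast
      hence "L \<le> L * norm (y n)" using False by (simp add: mult_le_cancel_left1)
      thus ?thesis using K[of n] L[of n] by (intro add_mono mult_right_mono) auto
    qed
    finally have "norm (y n) * norm (y n) \<le> (K + L) * norm (y n)" by (simp add: power2_eq_square algebra_simps)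
    hence "norm (y n) \<le> K + L" by (rule mult_right_le_imp_le) (use False in linarith)
    thus ?thesis by simp
  qed auto
  thus ?thesis unfolding bounded_iff by auto
qed

lemma tower_limit_step:
  assumes abc: "polyfn k 2 a" "polyfn k 2 b" "polyfn k 2 c"
    and lim: "\<And>i. i < k \<Longrightarrow> (\<lambda>n. E n i) \<longlonglongrightarrow> e i" and lead: "a e \<noteq> 0"
    and step: "\<And>n. a (E n) \<noteq> 0 \<Longrightarrow> \<exists>y. a (E n) * y^2 + b (E n) * y + c (E n) = 0 \<and> Q n y"
  shows "\<exists>r y y0. strict_mono (r :: nat \<Rightarrow> nat) \<and> y \<longlonglongrightarrow> y0 \<and> a e * y0^2 + b e * y0 + c e = 0 \<and>
     (\<forall>n. a (E (r n)) * y n^2 + b (E (r n)) * y n + c (E (r n)) = 0 \<and> Q (r n) (y n))"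
proof -
  have la: "(\<lambda>n. a (E n)) \<longlonglongrightarrow> a e" "(\<lambda>n. b (E n)) \<longlonglongrightarrow> b e" "(\<lambda>n. c (E n)) \<longlonglongrightarrow> c e"
    using polyfn_tendsto abc lim by blast+
  have "eventually (\<lambda>n. a (E n) \<noteq> 0) sequentially"
    using la(1) lead tendsto_imp_eventually_ne by blast
  then obtain n0 where n0: "\<And>n. a (E (n + n0)) \<noteq> 0" unfolding eventually_sequentially by (metis le_add2)
  have "\<forall>n. \<exists>y. a (E (n + n0)) * y^2 + b (E (n + n0)) * y + c (E (n + n0)) = 0 \<and> Q (n + n0) y"
    using step n0 by blast
  from choice[OF this] obtain y where y: "\<And>n. a (E (n + n0)) * y n^2 + b (E (n + n0)) * y n + c (E (n + n0)) = 0 \<and> Q (n + n0) (y n)"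
    by blast
  have la': "(\<lambda>n. a (E (n + n0))) \<longlonglongrightarrow> a e" "(\<lambda>n. b (E (n + n0))) \<longlonglongrightarrow> b e" "(\<lambda>n. c (E (n + n0))) \<longlonglongrightarrow> c e"
    using la LIMSEQ_ignore_initial_segment by blast+
  have "bounded (range y)" by (rule quadratic_roots_bounded[OF la' lead]) (use y n0 in auto)
  then obtain y0 r where r: "strict_mono (r :: nat \<Rightarrow> nat)" "(y \<circ> r) \<longlonglongrightarrow> y0"
    using bounded_imp_convergent_subsequence by metis
  have l: "(\<lambda>n. y (r n)) \<longlonglongrightarrow> y0" using r(2) by (simp add: o_def)
  have lr: "(\<lambda>n. a (E (r n + n0))) \<longlonglongrightarrow> a e" "(\<lambda>n. b (E (r n + n0))) \<longlonglongrightarrow> b e" "(\<lambda>n. c (E (r n + n0))) \<longlonglongrightarrow> c e"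
    using la'[THEN LIMSEQ_subseq_LIMSEQ, OF r(1)] by (simp_all add: o_def)
  have "(\<lambda>n. a (E (r n + n0)) * y (r n)^2 + b (E (r n + n0)) * y (r n) + c (E (r n + n0))) \<longlonglongrightarrow> a e * y0^2 + b e * y0 + c e"
    by (intro tendsto_intros lr l)
  hence "a e * y0^2 + b e * y0 + c e = 0" using y LIMSEQ_unique[OF _ tendsto_const] by simp
  moreover have "strict_mono (\<lambda>n. r n + n0)" using r(1) by (simp add: strict_mono_def)
  moreover have "\<forall>n. a (E (r n + n0)) * y (r n)^2 + b (E (r n + n0)) * y (r n) + c (E (r n + n0)) = 0 \<and>
      Q (r n + n0) (y (r n))" using y by simp
  ultimately show ?thesis using l
    apply -
    apply (rule exI[of _ "\<lambda>n. r n + n0"])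
    apply (rule exI[of _ "\<lambda>n. y (r n)"])
    apply (rule exI[of _ y0])
    apply (intro conjI)
    apply assumption+
    done
qed

text \<open>
  If elimination leaves the zero polynomial, the first variable is free and can be sent to a prescribed
  value \<open>\<sigma>\<close>.  The roots found on the way stay bounded because the leading coefficients do not vanish at any
  of the finitely many possible limits, so that a subsequence of solutions converges to a solution over \<open>\<sigma>\<close>.
\<close>

lemma tower_limit:
  assumes abc: "\<And>k. k \<in> {1..m} \<Longrightarrow> polyfn k 2 (a k) \<and> polyfn k 2 (b k) \<and> polyfn k 2 (c k)"
    and N1: "\<And>e. N 1 e = 0"
    and Nstep: "\<And>k e. k\<in>{1..m} \<Longrightarrow> N k e = 0 \<Longrightarrow> a k e \<noteq> 0 \<Longrightarrow>
           (\<exists>y. a k e * y^2 + b k e * y + c k e = 0 \<and> N (Suc k) (e(k := y)) = 0)"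
    and lead: "\<And>k e. k \<in> {1..m} \<Longrightarrow> e 0 = \<sigma> \<Longrightarrow> (\<And>i. i \<in> {1..<k} \<Longrightarrow> a i e * e i^2 + b i e * e i + c i e = 0) \<Longrightarrow> a k e \<noteq> 0"
  shows "\<exists>E e. e 0 = \<sigma> \<and> (\<forall>n. E n 0 \<noteq> \<sigma>) \<and> (\<forall>i\<le>m. (\<lambda>n. E n i) \<longlonglongrightarrow> e i) \<and>
     (\<forall>i\<in>{1..m}. a i e * e i^2 + b i e * e i + c i e = 0) \<and>
     (\<forall>n. \<forall>i\<in>{1..m}. a i (E n) * E n i^2 + b i (E n) * E n i + c i (E n) = 0) \<and> (\<forall>n. N (Suc m) (E n) = 0)"
proof -
  define path where "path k f \<longleftrightarrow> (\<forall>i\<in>{1..k}. a i f * f i^2 + b i f * f i + c i f = 0)" for k f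
  have "\<exists>E e. e 0 = \<sigma> \<and> (\<forall>n. E n 0 \<noteq> \<sigma>) \<and> (\<forall>i\<le>k. (\<lambda>n. E n i) \<longlonglongrightarrow> e i) \<and>
     path k e \<and> (\<forall>n. path k (E n) \<and> N (Suc k) (E n) = 0)"
    if "k \<le> m" for k using that
  proof (induction k)
    case 0
    let ?s = "\<lambda>n. \<sigma> + complex_of_real (1 / real (Suc n))"
    have l: "?s \<longlonglongrightarrow> \<sigma> + of_real 0"
      by (intro tendsto_add tendsto_const tendsto_of_real LIMSEQ_Suc lim_1_over_n)
    have ne: "?s n \<noteq> \<sigma>" for n using of_nat_Suc[of n] by (simp del: of_nat_Suc of_real_divide)
    show ?case
      apply (rule exI[of _ "\<lambda>n _. ?s n"], rule exI[of _ "\<lambda>_. \<sigma>"])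
      using l ne N1 unfolding path_def by (simp del: of_real_divide)
  next
    case (Suc k)
    then obtain E e where E: "e 0 = \<sigma>" "\<And>n. E n 0 \<noteq> \<sigma>" "\<And>i. i \<le> k \<Longrightarrow> (\<lambda>n. E n i) \<longlonglongrightarrow> e i"
      and pe: "path k e" and pE: "\<And>n. path k (E n)" and NE: "\<And>n. N (Suc k) (E n) = 0" 
      by (meson Suc_leD)
    let ?k = "Suc k"
    have k: "?k \<in> {1..m}" using Suc by auto
    have le: "a ?k e \<noteq> 0" by (rule lead[of ?k e, OF k E(1)]) (use pe in \<open>simp add: path_def\<close>)
    have lim: "(\<lambda>n. E n i) \<longlonglongrightarrow> e i" if "i < ?k" for i using E(3)[of i] that by simp
    obtain r y y0 where ry: "strict_mono (r :: nat \<Rightarrow> nat)" "y \<longlonglongrightarrow> y0" "a ?k e * y0^2 + b ?k e * y0 + c ?k e = 0"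
     and step: "\<forall>n. a ?k (E (r n)) * y n^2 + b ?k (E (r n)) * y n + c ?k (E (r n)) = 0 \<and> N (Suc ?k) ((E (r n))(?k := y n)) = 0"
      using tower_limit_step[of ?k "a ?k" "b ?k" "c ?k", OF conjunct1[OF abc[OF k]] conjunct1[OF conjunct2[OF abc[OF k]]] conjunct2[OF conjunct2[OF abc[OF k]]], 
          of E e "\<lambda>n y. N (Suc ?k) ((E n)(?k := y)) = 0", OF lim le Nstep[OF k NE]] by blast
    let ?E = "\<lambda>n. (E (r n))(?k := y n)" and ?e = "e(?k := y0)"
    have same: "a i (f(?k := z)) = a i f" "b i (f(?k := z)) = b i f" "c i (f(?k := z)) = c i f" if "i \<in> {1..?k}" for i f z
    proof -
      have "i \<in> {1..m}" and lt: "\<And>j. j < i \<Longrightarrow> (f(?k := z)) j = f j" using that k by auto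
      from abc[OF this(1)] show "a i (f(?k := z)) = a i f" "b i (f(?k := z)) = b i f" "c i (f(?k := z)) = c i f"
        using polyfn_cong lt by blast+
    qed
    have path_upd: "path ?k (f(?k := z))" if "path k f" "a ?k f * z^2 + b ?k f * z + c ?k f = 0" for f z
      unfolding path_def
    proof
      fix i assume i: "i \<in> {1..?k}"
      show "a i (f(?k := z)) * (f(?k := z)) i ^ 2 + b i (f(?k := z)) * (f(?k := z)) i + c i (f(?k := z)) = 0"
        unfolding same[OF i] using that i by (cases "i = ?k") (simp_all add: path_def)
    qed
    have l: "(\<lambda>n. ?E n i) \<longlonglongrightarrow> ?e i" if "i \<le> ?k" for i
    proof (cases "i = ?k")
      case False
      hence "((\<lambda>n. E n i) \<circ> r) \<longlonglongrightarrow> e i" using that E(3) ry(1) by (intro LIMSEQ_subseq_LIMSEQ) simp_all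
      thus ?thesis using False by (simp add: o_def)
    qed (use ry(2) in simp)
    have "?e 0 = \<sigma>" "\<forall>n. ?E n 0 \<noteq> \<sigma>" "\<forall>i\<le>?k. (\<lambda>n. ?E n i) \<longlonglongrightarrow> ?e i"
      using E(1,2) l by simp_all
    moreover have "path ?k ?e" "\<forall>n. path ?k (?E n) \<and> N (Suc ?k) (?E n) = 0"
      using path_upd[OF pe ry(3)] path_upd[OF pE] step by blast+
    ultimately show ?case
      by - (rule exI[of _ ?E], rule exI[of _ ?e], intro conjI)
  qed
  from this[of m] show ?thesis unfolding path_def by blast
qed

section \<open>The incidence relation between circles and points\<close>

text \<open>
  Let \<open>a\<close> be the centre of a circle relative to the base point of another family, and \<open>b\<close> its conjugate.
  For unit numbers \<open>s\<close> and \<open>v\<close> the point \<open>a + s\<close> lies on the unit circle with centre \<open>v\<close> exactly when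
  \<open>G a b s v = 0\<close>.  Replacing conjugates by independent variables makes \<open>G\<close> a polynomial, quadratic in each
  of \<open>s\<close> and \<open>v\<close>, so that complex solutions are available.
\<close>

definition G :: "complex \<Rightarrow> complex \<Rightarrow> complex \<Rightarrow> complex \<Rightarrow> complex" where
  "G a b s v = (a - v) * v + (a - v) * (b * v - 1) * s + (b * v - 1) * s^2"

text \<open>
  The partial derivatives of \<open>G\<close> in \<open>v\<close> and in \<open>s\<close>.  At a real zero of \<open>G\<close>, the equation \<open>Gv = 0\<close> puts the
  point on the envelope of the family of \<open>v\<close>, and \<open>Gs = 0\<close> makes the two circles tangent.
\<close>

definition Gv :: "complex \<Rightarrow> complex \<Rightarrow> complex \<Rightarrow> complex \<Rightarrow> complex" where
  "Gv a b s v = (1 + b * s) * (a + s - 2 * v)"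

definition Gs :: "complex \<Rightarrow> complex \<Rightarrow> complex \<Rightarrow> complex \<Rightarrow> complex" where
  "Gs a b s v = (b * v - 1) * (a - v + 2 * s)"

lemma G_as_quadratic_v: "G a b s v = - ((1 + b * s) * v^2 + (- ((a + s) * (1 + b * s))) * v + s * (a + s))"
  unfolding G_def by (simp add: algebra_simps power2_eq_square)

lemma G_as_quadratic_s: "G a b s v = (b * v - 1) * s^2 + ((a - v) * (b * v - 1)) * s + (a - v) * v"
  unfolding G_def by (simp add: algebra_simps power2_eq_square)

lemma G_diff: "G a b s v - G a b s0 v0 =
   (v - v0) * ((1 + b * s) * (a + s - (v + v0))) + (s - s0) * ((b * v0 - 1) * (a - v0 + (s + s0)))"
  unfolding G_def by (simp add: algebra_simps power2_eq_square)

lemma G_diff': "G a b s v - G a b s0 v0 =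
   (v - v0) * ((1 + b * s0) * (a + s0 - (v + v0))) + (s - s0) * ((b * v - 1) * (a - v + (s + s0)))"
  unfolding G_def by (simp add: algebra_simps power2_eq_square)

lemma bigo_of_product_eq:
  fixes f g h k :: "nat \<Rightarrow> complex"
  assumes "\<And>n. f n * h n = g n * k n" "h \<longlonglongrightarrow> h0" "h0 \<noteq> 0" "k \<longlonglongrightarrow> k0"
  shows "f \<in> O(g)"
proof -
  have "eventually (\<lambda>n. h n \<noteq> 0) sequentially"
    using assms(2,3) tendsto_imp_eventually_ne by blast
  hence ev: "eventually (\<lambda>n. f n = g n * (k n / h n)) sequentially"
    by eventually_elim (metis assms(1) eq_divide_eq times_divide_eq_right)
  have "(\<lambda>n. k n / h n) \<longlonglongrightarrow> k0 / h0" using assms by (intro tendsto_divide)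
  hence "(\<lambda>n. k n / h n) \<in> O(\<lambda>_. 1)" by (intro bigoI_tendsto[where c = "k0 / h0"]) simp_all
  hence "(\<lambda>n. g n * (k n / h n)) \<in> O(\<lambda>n. g n * 1)" by (intro landau_o.big.mult) auto
  thus ?thesis using landau_o.big.in_cong[OF ev] by simp
qed

text \<open>
  The implicit function theorem in the weak form that is needed: at a simple root the root depends in a
  Lipschitz way on the other variable.
\<close>

lemma v_lipschitz:
  assumes "\<And>n. G a b (s n) (v n) = 0" "G a b s0 v0 = 0" "s \<longlonglongrightarrow> s0" "v \<longlonglongrightarrow> v0" "Gv a b s0 v0 \<noteq> 0"
  shows "(\<lambda>n. v n - v0) \<in> O(\<lambda>n. s n - s0)"
proof (rule bigo_of_product_eq)
  show "(v n - v0) * ((1 + b * s n) * (a + s n - (v n + v0))) = (s n - s0) * (- ((b * v0 - 1) * (a - v0 + (s n + s0))))" for n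
    using G_diff[of a b "s n" "v n" s0 v0] assms(1)[of n] assms(2) by (simp add: eq_neg_iff_add_eq_0 add_ac)
  show "(\<lambda>n. (1 + b * s n) * (a + s n - (v n + v0))) \<longlonglongrightarrow> (1 + b * s0) * (a + s0 - (v0 + v0))"
    "(\<lambda>n. - ((b * v0 - 1) * (a - v0 + (s n + s0)))) \<longlonglongrightarrow> - ((b * v0 - 1) * (a - v0 + (s0 + s0)))"
    by (intro tendsto_intros assms)+
  show "(1 + b * s0) * (a + s0 - (v0 + v0)) \<noteq> 0" using assms(5) by (simp add: Gv_def)
qed

lemma s_lipschitz:
  assumes "\<And>n. G a b (s n) (v n) = 0" "G a b s0 v0 = 0" "s \<longlonglongrightarrow> s0" "v \<longlonglongrightarrow> v0" "Gs a b s0 v0 \<noteq> 0"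
  shows "(\<lambda>n. s n - s0) \<in> O(\<lambda>n. v n - v0)"
proof (rule bigo_of_product_eq)
  show "(s n - s0) * ((b * v n - 1) * (a - v n + (s n + s0))) = (v n - v0) * (- ((1 + b * s0) * (a + s0 - (v n + v0))))" for n
    using G_diff'[of a b "s n" "v n" s0 v0] assms(1)[of n] assms(2) by (simp add: eq_neg_iff_add_eq_0 add_ac)
  show "(\<lambda>n. (b * v n - 1) * (a - v n + (s n + s0))) \<longlonglongrightarrow> (b * v0 - 1) * (a - v0 + (s0 + s0))"
    "(\<lambda>n. - ((1 + b * s0) * (a + s0 - (v n + v0)))) \<longlonglongrightarrow> - ((1 + b * s0) * (a + s0 - (v0 + v0)))"
    by (intro tendsto_intros assms)+
  show "(b * v0 - 1) * (a - v0 + (s0 + s0)) \<noteq> 0" using assms(5) by (simp add: Gs_def)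
qed

text \<open>
  At a double root in \<open>w\<close> the relation reads \<open>(s - s0) * h = (w - w0)^2 * const\<close> with \<open>h\<close> bounded away from zero.
\<close>

lemma s_quadratic_at_fold:
  assumes "\<And>n. G a b (s n) (w n) = 0" "G a b s0 w0 = 0" "s \<longlonglongrightarrow> s0" "w \<longlonglongrightarrow> w0"
    "Gs a b s0 w0 \<noteq> 0" "a + s0 = 2 * w0"
  shows "(\<lambda>n. s n - s0) \<in> O(\<lambda>n. (w n - w0)^2)"
proof (rule bigo_of_product_eq)
  have a: "a = 2 * w0 - s0" using assms(6) by (simp add: algebra_simps)
  show "(s n - s0) * ((b * w n - 1) * (a - w n + (s n + s0))) = (w n - w0)^2 * (1 + b * s0)" for n
    using G_diff'[of a b "s n" "w n" s0 w0] assms(1)[of n] assms(2) unfolding a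
    by (simp add: algebra_simps power2_eq_square)
  show "(\<lambda>n. (b * w n - 1) * (a - w n + (s n + s0))) \<longlonglongrightarrow> (b * w0 - 1) * (a - w0 + (s0 + s0))"
    by (intro tendsto_intros assms)
  show "(\<lambda>_. 1 + b * s0) \<longlonglongrightarrow> 1 + b * s0" by (rule tendsto_const)
  show "(b * w0 - 1) * (a - w0 + (s0 + s0)) \<noteq> 0" using assms(5) by (simp add: Gs_def)
qed

lemma not_bigo_square:
  fixes f :: "nat \<Rightarrow> complex"
  assumes "f \<longlonglongrightarrow> 0" "f \<in> O(\<lambda>n. (f n)^2)" 
  shows "eventually (\<lambda>n. f n = 0) sequentially"
proof -
  obtain C where C: "C > 0" "eventually (\<lambda>n. norm (f n) \<le> C * norm ((f n)^2)) sequentially"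
    using landau_o.bigE[OF assms(2)] by blast
  have "eventually (\<lambda>n. norm (f n) < 1 / C) sequentially"
    using tendsto_norm_zero[OF assms(1)] C(1) by (intro order_tendstoD) auto
  thus ?thesis using C(2)
  proof eventually_elim
    case (elim n)
    show ?case
    proof (rule ccontr)
      assume "f n \<noteq> 0"
      hence "1 \<le> C * norm (f n)" using elim(2) by (simp add: norm_mult power2_eq_square)
      thus False using elim(1) C(1) by (simp add: field_simps)
    qed
  qed
qed

text \<open>
  Going round the cycle from \<open>s1\<close> through \<open>v\<close>, \<open>s2\<close>, \<open>w2\<close>, \<open>t2\<close>, \<open>v'\<close>, \<open>t1\<close> to \<open>w1\<close>, seven Lipschitz estimates
  give \<open>w1 - W1 = O(s1 - S1)\<close>.  The eighth relation, at the fold, gives \<open>s1 - S1 = O((w1 - W1)^2)\<close>.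
\<close>

lemma no_cycle_near_fold:
  fixes s1 w1 t1 v' v s2 w2 t2 :: "nat \<Rightarrow> complex"
  assumes eqs: "\<And>n. G a1' b1' (s1 n) (w1 n) = 0" "\<And>n. G c1' d1' (t1 n) (w1 n) = 0"
      "\<And>n. G c1 d1 (t1 n) (v' n) = 0" "\<And>n. G a1 b1 (s1 n) (v n) = 0" "\<And>n. G a2 b2 (s2 n) (v n) = 0"
      "\<And>n. G a2' b2' (s2 n) (w2 n) = 0" "\<And>n. G c2 d2 (t2 n) (v' n) = 0" "\<And>n. G c2' d2' (t2 n) (w2 n) = 0"
    and lims: "s1 \<longlonglongrightarrow> S1" "w1 \<longlonglongrightarrow> W1" "t1 \<longlonglongrightarrow> T1" "v' \<longlonglongrightarrow> V'" "v \<longlonglongrightarrow> V" "s2 \<longlonglongrightarrow> S2" "w2 \<longlonglongrightarrow> W2" "t2 \<longlonglongrightarrow> T2"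
    and eqs0: "G a1' b1' S1 W1 = 0" "G c1' d1' T1 W1 = 0" "G c1 d1 T1 V' = 0" "G a1 b1 S1 V = 0" "G a2 b2 S2 V = 0"
      "G a2' b2' S2 W2 = 0" "G c2 d2 T2 V' = 0" "G c2' d2' T2 W2 = 0"
    and fold: "a1' + S1 = 2 * W1" "Gs a1' b1' S1 W1 \<noteq> 0"
    and reg: "Gv a1 b1 S1 V \<noteq> 0" "Gs a2 b2 S2 V \<noteq> 0" "Gv a2' b2' S2 W2 \<noteq> 0" "Gs c2' d2' T2 W2 \<noteq> 0"
      "Gv c2 d2 T2 V' \<noteq> 0" "Gs c1 d1 T1 V' \<noteq> 0" "Gv c1' d1' T1 W1 \<noteq> 0"
    and ne: "\<And>n. s1 n \<noteq> S1"
  shows False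
proof -
  note tr [trans] = landau_o.big_trans
  have "(\<lambda>n. w1 n - W1) \<in> O(\<lambda>n. t1 n - T1)" by (rule v_lipschitz[OF eqs(2) eqs0(2) lims(3,2) reg(7)])
  also have "(\<lambda>n. t1 n - T1) \<in> O(\<lambda>n. v' n - V')" by (rule s_lipschitz[OF eqs(3) eqs0(3) lims(3,4) reg(6)])
  also have "(\<lambda>n. v' n - V') \<in> O(\<lambda>n. t2 n - T2)" by (rule v_lipschitz[OF eqs(7) eqs0(7) lims(8,4) reg(5)])
  also have "(\<lambda>n. t2 n - T2) \<in> O(\<lambda>n. w2 n - W2)" by (rule s_lipschitz[OF eqs(8) eqs0(8) lims(8,7) reg(4)])
  also have "(\<lambda>n. w2 n - W2) \<in> O(\<lambda>n. s2 n - S2)" by (rule v_lipschitz[OF eqs(6) eqs0(6) lims(6,7) reg(3)])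
  also have "(\<lambda>n. s2 n - S2) \<in> O(\<lambda>n. v n - V)" by (rule s_lipschitz[OF eqs(5) eqs0(5) lims(6,5) reg(2)])
  also have "(\<lambda>n. v n - V) \<in> O(\<lambda>n. s1 n - S1)" by (rule v_lipschitz[OF eqs(4) eqs0(4) lims(1,5) reg(1)])
  also have sq: "(\<lambda>n. s1 n - S1) \<in> O(\<lambda>n. (w1 n - W1)^2)"
    by (rule s_quadratic_at_fold[OF eqs(1) eqs0(1) lims(1,2) fold(2,1)])
  finally have "(\<lambda>n. w1 n - W1) \<in> O(\<lambda>n. (w1 n - W1)^2)" .
  moreover have "(\<lambda>n. w1 n - W1) \<longlonglongrightarrow> 0" using lims(2) LIM_zero by blast
  ultimately have "eventually (\<lambda>n. w1 n - W1 = 0) sequentially" by (intro not_bigo_square)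
  moreover obtain C where "eventually (\<lambda>n. norm (s1 n - S1) \<le> C * norm ((w1 n - W1)^2)) sequentially"
    using landau_o.bigE[OF sq] by blast
  ultimately have "eventually (\<lambda>n. s1 n - S1 = 0) sequentially" by eventually_elim simp
  thus False using ne by (simp add: eventually_sequentially) 
qed

section \<open>Counting solutions\<close>

definition few :: "nat \<Rightarrow> 'a set \<Rightarrow> bool" where
  "few k S \<longleftrightarrow> finite S \<and> card S \<le> k"

lemma few_mono: "few k S \<Longrightarrow> T \<subseteq> S \<Longrightarrow> k \<le> l \<Longrightarrow> few l T"
  unfolding few_def by (meson card_mono finite_subset le_trans)

lemma few_Un: "few k S \<Longrightarrow> few l T \<Longrightarrow> few (k + l) (S \<union> T)"
  unfolding few_def by (meson add_mono card_Un_le finite_UnI le_trans)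

lemma few_UN:
  assumes "few k I" "\<And>i. i \<in> I \<Longrightarrow> few l (S i)"
  shows "few (k * l) (\<Union>i\<in>I. S i)"
proof -
  have "card (\<Union>i\<in>I. S i) \<le> (\<Sum>i\<in>I. card (S i))" using assms by (intro card_UN_le) (simp add: few_def)
  also have "\<dots> \<le> of_nat (card I) * l" using assms(2) by (intro sum_bounded_above) (simp add: few_def)
  also have "\<dots> \<le> k * l" using assms(1) by (simp add: few_def)
  finally show ?thesis using assms by (auto simp: few_def)
qed

lemma few_UN_subset:
  assumes "few k I" "\<And>i. i \<in> I \<Longrightarrow> few l (S i)" "T \<subseteq> (\<Union>i\<in>I. S i)"
  shows "few (k * l) T"
  using few_mono[OF few_UN[OF assms(1,2)] assms(3)] by simp

lemma few_image: "few k S \<Longrightarrow> few k (f ` S)"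
  unfolding few_def by (meson card_image_le finite_imageI le_trans)

lemma few_empty: "few k {}" and few_singleton: "few 1 {x}"
  by (simp_all add: few_def)

lemma few_quadratic:
  fixes \<alpha> \<beta> \<gamma> :: complex
  assumes "\<alpha> \<noteq> 0 \<or> \<beta> \<noteq> 0 \<or> \<gamma> \<noteq> 0"
  shows "few 2 {x. \<alpha> * x^2 + \<beta> * x + \<gamma> = 0}"
proof -
  let ?c = "\<lambda>i::nat. if i = 0 then \<gamma> else if i = 1 then \<beta> else \<alpha>"
  have eq: "{x. \<alpha> * x^2 + \<beta> * x + \<gamma> = 0} = {x. (\<Sum>i\<le>2. ?c i * x ^ i) = 0}"
    by (simp add: numeral_2_eq_2 algebra_simps)
  obtain k where "k \<le> 2" "?c k \<noteq> 0"
  proof -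
    have "?c 0 = \<gamma>" "?c 1 = \<beta>" "?c 2 = \<alpha>" by simp_all
    thus ?thesis using assms that[of 0] that[of 1] that[of 2] by auto
  qed
  thus ?thesis unfolding few_def eq using polyfun_rootbound[of 2 ?c] by force
qed

lemma few_quadratic_subset:
  fixes \<alpha> \<beta> \<gamma> :: complex
  assumes "\<alpha> \<noteq> 0 \<or> \<beta> \<noteq> 0 \<or> \<gamma> \<noteq> 0" "\<And>x. x \<in> S \<Longrightarrow> \<alpha> * x^2 + \<beta> * x + \<gamma> = 0"
  shows "few 2 S"
  using few_mono[OF few_quadratic[OF assms(1)], of S 2] assms(2) by blast

lemma G_eq_circle:
  assumes "v \<noteq> 0"
  shows "G a b s v = v * ((s + a - v) * (1 + (b - 1 / v) * s) - s)"
  unfolding G_def using assms by (simp add: field_simps power2_eq_square)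

lemma G_degenerate_v:
  assumes "a * b \<noteq> 1" "1 + b * s = 0" shows "G a b s v \<noteq> 0"
proof
  assume "G a b s v = 0"
  hence "s * (a + s) = 0" unfolding G_as_quadratic_v using assms(2) by simp
  moreover have "s \<noteq> 0" using assms(2) by auto
  ultimately have "s = - a" by (simp add: add_eq_0_iff)
  thus False using assms by (simp add: algebra_simps)
qed

lemma G_degenerate_s:
  assumes "a * b \<noteq> 1" "b * v = 1" shows "G a b s v \<noteq> 0"
proof
  assume "G a b s v = 0"
  hence "(a - v) * v = 0" unfolding G_as_quadratic_s using assms(2) by simp
  moreover have "v \<noteq> 0" using assms(2) by auto
  ultimately have "a = v" by simp
  thus False using assms by (simp add: algebra_simps)
qed

lemma few_v: assumes "a * b \<noteq> 1" shows "few 2 {v. G a b s v = 0}"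
proof (cases "1 + b * s = 0")
  case True thus ?thesis using G_degenerate_v[OF assms True] by (simp add: few_empty)
next
  case False thus ?thesis unfolding G_as_quadratic_v neg_equal_0_iff_equal by (intro few_quadratic) simp
qed

lemma few_s: assumes "a * b \<noteq> 1" shows "few 2 {s. G a b s v = 0}"
proof (cases "b * v = 1")
  case True thus ?thesis using G_degenerate_s[OF assms True] by (simp add: few_empty)
next
  case False thus ?thesis unfolding G_as_quadratic_s by (intro few_quadratic) simp
qed

text \<open>
  A double root in \<open>v\<close> forces the point onto the circle of radius two about the base point of the family of
  \<open>v\<close>, or onto an isotropic line through that base point; such a line has no other real points.
\<close>

lemma double_v:
  assumes "a * b \<noteq> 1" "G a b s v = 0" "Gv a b s v = 0"
  shows "a + s = 2 * v" "a + s = 0 \<or> (a + s) * (1 + b * s) = 4 * s" "1 + b * s \<noteq> 0"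
proof -
  show Y: "1 + b * s \<noteq> 0" using G_degenerate_v assms by blast
  thus v: "a + s = 2 * v" using assms(3) by (simp add: Gv_def)
  have "4 * G a b s v = (a + s) * ((a + s) * (1 + b * s) - 4 * s)"
    unfolding G_as_quadratic_v using v by algebra
  thus "a + s = 0 \<or> (a + s) * (1 + b * s) = 4 * s" using assms(2) by simp
qed

lemma double_s:
  assumes "a * b \<noteq> 1" "G a b s v = 0" "Gs a b s v = 0"
  shows "v = a + 2 * s" "s = 0 \<or> (b * v - 1) * s = - 2 * v" "s = 0 \<or> 2 * b * s^2 + (a * b + 3) * s + 2 * a = 0"
proof -
  have f: "b * v - 1 \<noteq> 0" using G_degenerate_s assms by (metis eq_iff_diff_eq_0)
  hence *: "a - v + 2 * s = 0" using assms(3) by (simp add: Gs_def)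
  thus v: "v = a + 2 * s" by algebra
  have "G a b s v = - s * ((b * v - 1) * s + 2 * v)"
    unfolding G_as_quadratic_s using * by algebra
  thus sv: "s = 0 \<or> (b * v - 1) * s = - 2 * v" using assms(2) by (auto simp: add_eq_0_iff2)
  thus "s = 0 \<or> 2 * b * s^2 + (a * b + 3) * s + 2 * a = 0"
    using v by algebra
qed

lemma few_double_v:
  assumes "a * b \<noteq> 1"
  shows "few 3 {v. \<exists>s. G a b s v = 0 \<and> Gv a b s v = 0}"
proof -
  have "few 2 {s. b * s^2 + (a * b - 3) * s + a = 0}" by (rule few_quadratic) auto
  hence "few (1 + 2) ({- a} \<union> {s. b * s^2 + (a * b - 3) * s + a = 0})" by (intro few_Un few_singleton)
  from few_image[OF this, of "\<lambda>s. (a + s) / 2"] show ?thesis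
  proof (rule few_mono)
    show "{v. \<exists>s. G a b s v = 0 \<and> Gv a b s v = 0} \<subseteq> (\<lambda>s. (a + s) / 2) ` ({- a} \<union> {s. b * s^2 + (a * b - 3) * s + a = 0})"
    proof safe
      fix v s assume "G a b s v = 0" "Gv a b s v = 0"
      note d = double_v[OF assms this]
      have "s \<in> {- a} \<union> {s. b * s^2 + (a * b - 3) * s + a = 0}"
        using d(2) by (auto simp: add_eq_0_iff algebra_simps power2_eq_square)
      moreover have "v = (a + s) / 2" using d(1) by simp
      ultimately show "v \<in> (\<lambda>s. (a + s) / 2) ` ({- a} \<union> {s. b * s^2 + (a * b - 3) * s + a = 0})" by blast
    qed
  qed simp
qed

lemma few_double_s:
  assumes "a * b \<noteq> 1"
  shows "few 3 {s. \<exists>v. G a b s v = 0 \<and> Gs a b s v = 0}"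
proof -
  have "few 2 {s. (2 * b) * s^2 + (a * b + 3) * s + 2 * a = 0}" by (rule few_quadratic) auto
  hence "few (1 + 2) ({0} \<union> {s. (2 * b) * s^2 + (a * b + 3) * s + 2 * a = 0})" by (intro few_Un few_singleton)
  thus ?thesis by (rule few_mono) (use double_s(3)[OF assms] in auto)
qed

text \<open>
  Circles with centre \<open>(-\<alpha>, -\<beta>)\<close> and squared radius \<open>\<gamma>\<close> in isotropic coordinates.  Subtracting the two equations leaves a linear
  one, as for the radical axis of two real circles.
\<close>

lemma few_conic_pairs:
  fixes \<alpha> \<beta> \<gamma> \<alpha>' \<beta>' \<gamma>' :: complex
  assumes "(\<alpha>, \<beta>, \<gamma>) \<noteq> (\<alpha>', \<beta>', \<gamma>')" "\<gamma> \<noteq> 0" "\<gamma>' \<noteq> 0"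
  shows "few 2 {(\<xi>, \<eta>). (\<xi> + \<alpha>) * (\<eta> + \<beta>) = \<gamma> \<and> (\<xi> + \<alpha>') * (\<eta> + \<beta>') = \<gamma>'}" (is "few 2 ?S")
proof -
  define \<kappa> where "\<kappa> = \<alpha> * \<beta> - \<alpha>' * \<beta>' - \<gamma> + \<gamma>'"
  have lin: "(\<beta> - \<beta>') * \<xi> + (\<alpha> - \<alpha>') * \<eta> + \<kappa> = 0" if "(\<xi>, \<eta>) \<in> ?S" for \<xi> \<eta>
    using that by (auto simp: algebra_simps \<kappa>_def)
  consider "\<alpha> \<noteq> \<alpha>'" | "\<alpha> = \<alpha>'" "\<beta> \<noteq> \<beta>'" | "\<alpha> = \<alpha>'" "\<beta> = \<beta>'" by blast
  thus ?thesis
  proof cases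
    case 1
    define m h where "m = (\<beta> - \<beta>') / (\<alpha> - \<alpha>')" and "h = \<kappa> / (\<alpha> - \<alpha>')"
    define l where lm: "l \<xi> = - m * \<xi> - h" for \<xi>
    have mh: "\<beta> - \<beta>' = m * (\<alpha> - \<alpha>')" "\<kappa> = h * (\<alpha> - \<alpha>')" unfolding m_def h_def using 1 by simp_all
    have l: "\<eta> = l \<xi>" if "(\<xi>, \<eta>) \<in> ?S" for \<xi> \<eta>
    proof -
      have "(\<alpha> - \<alpha>') * (\<eta> - l \<xi>) = 0" using lin[OF that] unfolding mh lm by algebra
      thus ?thesis using 1 by simp
    qed
    have "few 2 {\<xi>. (- m) * \<xi>^2 + (\<beta> - h - m * \<alpha>) * \<xi> + (\<alpha> * (\<beta> - h) - \<gamma>) = 0}"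
      by (rule few_quadratic) (use assms(2) in auto)
    from few_image[OF this, of "\<lambda>\<xi>. (\<xi>, l \<xi>)"] show ?thesis
    proof (rule few_mono)
      show "?S \<subseteq> (\<lambda>\<xi>. (\<xi>, l \<xi>)) ` {\<xi>. (- m) * \<xi>^2 + (\<beta> - h - m * \<alpha>) * \<xi> + (\<alpha> * (\<beta> - h) - \<gamma>) = 0}"
      proof
        fix z assume z: "z \<in> ?S"
        then obtain \<xi> \<eta> where z': "z = (\<xi>, \<eta>)" and eq: "(\<xi> + \<alpha>) * (\<eta> + \<beta>) = \<gamma>" by blast
        have e: "\<eta> = l \<xi>" using l z unfolding z' by blast
        have "(- m) * \<xi>^2 + (\<beta> - h - m * \<alpha>) * \<xi> + (\<alpha> * (\<beta> - h) - \<gamma>) = 0"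
          unfolding eq[symmetric] e lm by (simp add: algebra_simps power2_eq_square)
        thus "z \<in> (\<lambda>\<xi>. (\<xi>, l \<xi>)) ` {\<xi>. (- m) * \<xi>^2 + (\<beta> - h - m * \<alpha>) * \<xi> + (\<alpha> * (\<beta> - h) - \<gamma>) = 0}"
          unfolding z' e by blast
      qed
    qed simp
  next
    case 2
    define h where "h = - \<kappa> / (\<beta> - \<beta>')"
    have xi: "\<xi> = h" if "(\<xi>, \<eta>) \<in> ?S" for \<xi> \<eta>
      using lin[OF that] 2 unfolding h_def by (simp add: field_simps)
    have "?S \<subseteq> {(h, \<gamma> / (h + \<alpha>) - \<beta>)}"
    proof
      fix z assume z: "z \<in> ?S"
      then obtain \<xi> \<eta> where z': "z = (\<xi>, \<eta>)" and eq: "(\<xi> + \<alpha>) * (\<eta> + \<beta>) = \<gamma>" by blast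
      have x: "\<xi> = h" using xi z unfolding z' by blast
      have "\<xi> + \<alpha> \<noteq> 0" using eq assms(2) by auto
      hence "\<eta> = \<gamma> / (h + \<alpha>) - \<beta>" unfolding eq[symmetric] x by simp
      thus "z \<in> {(h, \<gamma> / (h + \<alpha>) - \<beta>)}" unfolding z' x by simp
    qed
    from few_mono[OF few_singleton this, of 2] show ?thesis by simp
  next
    case 3
    hence "?S = {}" using assms(1) by auto
    thus ?thesis by (simp only: few_empty)
  qed
qed

lemma few_x_of_point:
  fixes \<xi> \<eta> :: complex
  assumes "\<xi> \<noteq> 0"
  shows "few 2 {x. \<exists>s. x + s = \<xi> \<and> \<eta> * (x * s) = \<xi>}"
proof -
  have "few 2 {x. (- \<eta>) * x^2 + (\<eta> * \<xi>) * x + (- \<xi>) = 0}" using assms by (intro few_quadratic) auto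
  thus ?thesis
  proof (rule few_mono, safe)
    fix x s assume "\<xi> = x + s" "\<eta> * (x * s) = x + s"
    thus "- \<eta> * x\<^sup>2 + \<eta> * (x + s) * x + - (x + s) = 0" by (simp add: algebra_simps power2_eq_square)
  qed
qed

text \<open>
  A point on two given circles has at most two positions \<open>(\<xi>, \<eta>)\<close>, where \<open>\<xi> = x + s\<close> and \<open>\<eta> = 1/x + 1/s\<close>,
  and \<open>x\<close> is then a root of \<open>\<eta> * x^2 - \<xi> * \<eta> * x + \<xi>\<close>.  The case \<open>x + s = 0\<close> has to be excluded: the point is
  then the base point \<open>p1\<close>, through which every circle of the first family passes.
\<close>

lemma few_x_two_circles:
  fixes \<alpha> \<beta> \<gamma> \<alpha>' \<beta>' \<gamma>' :: complex
  assumes "(\<alpha>, \<beta>, \<gamma>) \<noteq> (\<alpha>', \<beta>', \<gamma>')" "\<gamma> \<noteq> 0" "\<gamma>' \<noteq> 0"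
  shows "few 4 {x. x \<noteq> 0 \<and> (\<exists>s. s \<noteq> 0 \<and> x + s \<noteq> 0 \<and> (x + s + \<alpha>) * (1 + (\<beta> + 1 / x) * s) = \<gamma> * s \<and>
       (x + s + \<alpha>') * (1 + (\<beta>' + 1 / x) * s) = \<gamma>' * s)}" (is "few 4 ?T")
proof -
  let ?S = "{(\<xi> :: complex, \<eta> :: complex). (\<xi> + \<alpha>) * (\<eta> + \<beta>) = \<gamma> \<and> (\<xi> + \<alpha>') * (\<eta> + \<beta>') = \<gamma>'}"
  let ?X = "\<lambda>(\<xi> :: complex, \<eta> :: complex). {x. \<xi> \<noteq> 0 \<and> (\<exists>s. x + s = \<xi> \<and> \<eta> * (x * s) = \<xi>)}"
  have "few (2 * 2) ?T"
  proof (rule few_UN_subset[OF few_conic_pairs[OF assms]])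
    show "few 2 (?X i)" for i
      using few_x_of_point[of "fst i" "snd i"] by (cases "fst i = 0") (auto simp: case_prod_unfold few_empty)
    show "?T \<subseteq> (\<Union>i\<in>?S. ?X i)"
    proof safe
      fix x s assume x: "x \<noteq> 0" "s \<noteq> 0" "x + s \<noteq> 0" and
        e: "(x + s + \<alpha>) * (1 + (\<beta> + 1 / x) * s) = \<gamma> * s" "(x + s + \<alpha>') * (1 + (\<beta>' + 1 / x) * s) = \<gamma>' * s"
      define \<eta> where "\<eta> = (x + s) / (x * s)"
      have r: "1 + (\<beta> + 1 / x) * s = s * (\<eta> + \<beta>)" for \<beta> unfolding \<eta>_def using x by (simp add: field_simps)
      have "s * ((x + s + \<alpha>) * (\<eta> + \<beta>)) = s * \<gamma>" "s * ((x + s + \<alpha>') * (\<eta> + \<beta>')) = s * \<gamma>'"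
        using e unfolding r by (simp_all only: mult_ac)
      hence "(x + s + \<alpha>) * (\<eta> + \<beta>) = \<gamma>" "(x + s + \<alpha>') * (\<eta> + \<beta>') = \<gamma>'"
        using x(2) by simp_all
      moreover have "\<eta> * (x * s) = x + s" unfolding \<eta>_def using x by simp
      ultimately show "x \<in> (\<Union>i\<in>?S. ?X i)" using x(3) by (intro UN_I[of "(x + s, \<eta>)"]) auto
    qed
  qed
  thus ?thesis by simp
qed

section \<open>Exceptional parameters\<close>

text \<open>
  Here \<open>p = p1 - p2\<close> and \<open>d = p1 - p3\<close>, while \<open>p'\<close> and \<open>d'\<close> stand for their conjugates and are kept
  independent, as are \<open>x\<close> and \<open>1 / x\<close>.  \<open>G12 x s v\<close> says that the point with parameter \<open>s\<close> on the circle \<open>x\<close> of the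
  first family lies on the circle \<open>v\<close> of the second; \<open>G13\<close> does the same for the third family.

  The lemmas of this section count the parameters that have to be avoided in order to make every relation of
  the cycle but the first one regular at the limit.
  Each condition is a polynomial one, and the work consists in seeing that the polynomial does not vanish
  identically; usually one extreme coefficient is visibly nonzero because the base points are distinct.
\<close>

locale three_points =
  fixes p p' d d' :: complex
  assumes nz: "p \<noteq> 0" "p' \<noteq> 0" "d \<noteq> 0" "d' \<noteq> 0" "p \<noteq> d" "p' \<noteq> d'"
begin

abbreviation "G12 x s v \<equiv> G (p + x) (p' + 1 / x) s v"
abbreviation "G13 x s w \<equiv> G (d + x) (d' + 1 / x) s w"
abbreviation "Gs12 x s v \<equiv> Gs (p + x) (p' + 1 / x) s v"
abbreviation "Gs13 x s w \<equiv> Gs (d + x) (d' + 1 / x) s w"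
abbreviation "Gv12 x s v \<equiv> Gv (p + x) (p' + 1 / x) s v"
abbreviation "Gv13 x s w \<equiv> Gv (d + x) (d' + 1 / x) s w"

text \<open>
  If \<open>x\<close> is a unit number, and \<open>p'\<close> and \<open>d'\<close> are the conjugates of \<open>p\<close> and \<open>d\<close>, this says that the circle \<open>x\<close>
  contains neither of the other two base points.
\<close>

definition generic :: "complex \<Rightarrow> bool" where
  "generic x \<longleftrightarrow> x \<noteq> 0 \<and> (p + x) * (p' + 1 / x) \<noteq> 1 \<and> (d + x) * (d' + 1 / x) \<noteq> 1"

text \<open>
  The last equation puts the point \<open>p1 + x + s\<close> on the circle of radius two about \<open>p3\<close>, the envelope of the third
  family.  There are two such points on the circle \<open>x\<close>; the condition \<open>x + s \<noteq> 0\<close> rejects \<open>p1\<close>, which may lie on the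
  envelope and would then be a fold for every \<open>x\<close> at once.
\<close>

definition fold_at :: "complex \<Rightarrow> complex \<Rightarrow> bool" where
  "fold_at x s \<longleftrightarrow> s \<noteq> 0 \<and> x + s \<noteq> 0 \<and> (d + x + s) * (1 + (d' + 1 / x) * s) = 4 * s"

lemma fold_exists:
  assumes "(d + x) * (d' + 1 / x) \<noteq> 1" "(d + x) * (d' + 1 / x) \<noteq> 9" "d + x \<noteq> 0" "d' + 1 / x \<noteq> 0"
  shows "\<exists>s. fold_at x s"
proof -
  define A B where "A = d + x" and "B = d' + 1 / x"
  define r where "r = csqrt ((A * B - 1) * (A * B - 9))"
  have r: "r^2 = (A * B - 1) * (A * B - 9)" "r \<noteq> 0" using assms unfolding r_def A_def B_def by auto
  have nzAB: "A \<noteq> 0" "B \<noteq> 0" using assms unfolding A_def B_def by auto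
  define s1 s2 where "s1 = (3 - A * B + r) / (2 * B)" and "s2 = (3 - A * B - r) / (2 * B)"
  have "s1 \<noteq> s2" unfolding s1_def s2_def using r nzAB by (simp add: field_simps)
  then obtain s where s: "s = s1 \<or> s = s2" "x + s \<noteq> 0" by (metis add_left_cancel)
  have "B * s^2 + (A * B - 3) * s + A = 0"
  proof -
    have "4 * B * (B * s^2 + (A * B - 3) * s + A) = (2 * B * s + (A * B - 3))^2 - (A * B - 1) * (A * B - 9)"
      by algebra
    moreover have "2 * B * s + (A * B - 3) = r \<or> 2 * B * s + (A * B - 3) = - r"
      using s(1) nzAB unfolding s1_def s2_def by auto
    hence "(2 * B * s + (A * B - 3))^2 = r^2" by auto
    ultimately show ?thesis using r nzAB by simp
  qed
  hence "s \<noteq> 0" "(A + s) * (1 + B * s) = 4 * s" using nzAB by (auto simp: algebra_simps power2_eq_square)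
  thus ?thesis using s(2) unfolding fold_at_def A_def B_def by blast
qed

text \<open>
  The values \<open>1\<close> and \<open>9\<close> are the squares of the distances of the centre of \<open>x\<close> from \<open>p3\<close> at which this circle is tangent
  to the envelope.
\<close>

lemma fold_regular:
  assumes "fold_at x s" "(d + x) * (d' + 1 / x) \<noteq> 1" "(d + x) * (d' + 1 / x) \<noteq> 9"
  shows "1 + (d' + 1 / x) * s \<noteq> 0" "d + x + s \<noteq> 0" "G13 x s ((d + x + s) / 2) = 0" "Gs13 x s ((d + x + s) / 2) \<noteq> 0"
proof -
  define A B where "A = d + x" and "B = d' + 1 / x"
  have f: "(A + s) * (1 + B * s) = 4 * s" "s \<noteq> 0" and ne: "A * B \<noteq> 1" "A * B \<noteq> 9" 
    using assms unfolding fold_at_def A_def B_def by auto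
  show "1 + (d' + 1 / x) * s \<noteq> 0" "d + x + s \<noteq> 0" using f unfolding A_def B_def by auto
  have "- 4 * G A B s ((A + s) / 2) = (A + s) * (4 * s - (A + s) * (1 + B * s))"
    unfolding G_as_quadratic_v by (simp add: power_divide) algebra
  thus "G13 x s ((d + x + s) / 2) = 0" using f unfolding A_def B_def by simp
  have "4 * Gs A B s ((A + s) / 2) = (B * (A + s) - 2) * (A + 3 * s)"
    unfolding Gs_def by (simp add: field_simps)
  moreover have "A + 3 * s \<noteq> 0"
  proof
    assume "A + 3 * s = 0"
    hence A: "A = - 3 * s" by algebra
    have "s * (3 + B * s) = 0" using f(1) unfolding A by algebra
    hence "3 + B * s = 0" using f(2) by simp
    hence "A * B = 9" unfolding A by algebra
    thus False using ne by simp
  qed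
  moreover have "B * (A + s) - 2 \<noteq> 0"
  proof
    assume a: "B * (A + s) - 2 = 0"
    hence "(A + s) * (B * (1 + B * s)) = 4 * B * s" using f(1) by algebra
    hence "2 * (1 + B * s) = 4 * (B * s)" using a by algebra
    hence "B * s = 1" by algebra
    thus False using a ne by algebra
  qed
  ultimately have "Gs A B s ((A + s) / 2) \<noteq> 0" by auto
  thus "Gs13 x s ((d + x + s) / 2) \<noteq> 0" unfolding A_def B_def by simp
qed

text \<open>
  At a fold the circle \<open>w\<close> is centred midway between \<open>p3\<close> and the point, so \<open>w\<close> determines the point and the
  point determines \<open>x\<close> up to two choices.
\<close>

lemma few_x_of_w: "few 2 {x. x \<noteq> 0 \<and> (\<exists>s. fold_at x s \<and> d + x + s = 2 * w)}"
proof (cases "w = 0 \<or> 2 * w = d")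
  case True
  hence "{x. x \<noteq> 0 \<and> (\<exists>s. fold_at x s \<and> d + x + s = 2 * w)} = {}"
    unfolding fold_at_def by (auto simp: add.assoc)
  thus ?thesis by (simp only: few_empty)
next
  case False
  show ?thesis
  proof (rule few_quadratic_subset[where \<alpha> = "4 - 2 * w * d'" and \<beta> = "(2 * w - d) * (2 * w * d' - 4)" and \<gamma> = "2 * w * (2 * w - d)"])
    show "4 - 2 * w * d' \<noteq> 0 \<or> (2 * w - d) * (2 * w * d' - 4) \<noteq> 0 \<or> 2 * w * (2 * w - d) \<noteq> 0" using False by auto
    fix x assume "x \<in> {x. x \<noteq> 0 \<and> (\<exists>s. fold_at x s \<and> d + x + s = 2 * w)}"
    then obtain s where x: "x \<noteq> 0" and f: "fold_at x s" "d + x + s = 2 * w" by blast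
    have s: "2 * w * (1 + (d' + 1 / x) * s) = 4 * s" using f(1) unfolding fold_at_def f(2) by blast
    have s2: "s = 2 * w - d - x" using f(2) by algebra
    have "2 * w * (x + (d' * x + 1) * s) = 4 * s * x" using s x by (simp add: field_simps)
    thus "(4 - 2 * w * d') * x\<^sup>2 + (2 * w - d) * (2 * w * d' - 4) * x + 2 * w * (2 * w - d) = 0"
      unfolding s2 by algebra
  qed
qed

text \<open>
  The parameters of circles of the second family through \<open>p1\<close>.
\<close>

definition through_first :: "complex set" where "through_first = {v. p' * v^2 + (- (p * p')) * v + p = 0}"

lemma few_through_first: "few 2 through_first" unfolding through_first_def by (rule few_quadratic) (use nz in auto)

lemma through_first_nz: "v \<in> through_first \<Longrightarrow> v \<noteq> 0" unfolding through_first_def using nz by auto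

lemma in_through_first: assumes "x \<noteq> 0" "G12 x (- x) v = 0" shows "v \<in> through_first"
proof -
  have "(p' + 1 / x) * x = p' * x + 1" using assms(1) by (simp add: field_simps)
  hence "G12 x (- x) v = x * (p' * v^2 + (- (p * p')) * v + p)"
    unfolding G_as_quadratic_v by algebra
  thus ?thesis using assms unfolding through_first_def by auto
qed

lemma few_fold_isotropic:
  "few 4 {x. x \<noteq> 0 \<and> (\<exists>s. fold_at x s \<and> (p + x + s = 0 \<or> 1 + (p' + 1 / x) * s = 0))}"
proof -
  have 1: "few 2 {x. x \<noteq> 0 \<and> (\<exists>s. fold_at x s \<and> p + x + s = 0)}"
  proof (rule few_quadratic_subset[where \<alpha> = "4 - (d - p) * d'" and \<beta> = "4 * p - (d - p) * (d' * p)" and \<gamma> = "- ((d - p) * p)"])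
    show "4 - (d - p) * d' \<noteq> 0 \<or> 4 * p - (d - p) * (d' * p) \<noteq> 0 \<or> - ((d - p) * p) \<noteq> 0" using nz by auto
    fix x assume "x \<in> {x. x \<noteq> 0 \<and> (\<exists>s. fold_at x s \<and> p + x + s = 0)}"
    then obtain s where x: "x \<noteq> 0" and s: "(d + x + s) * (1 + (d' + 1 / x) * s) = 4 * s" "p + x + s = 0"
      unfolding fold_at_def by auto
    have "(d + x + s) * (x + (d' * x + 1) * s) = 4 * s * x" using s(1) x by (simp add: field_simps)
    moreover have "s = - p - x" using s(2) by algebra
    ultimately show "(4 - (d - p) * d') * x\<^sup>2 + (4 * p - (d - p) * (d' * p)) * x + - ((d - p) * p) = 0" by algebra
  qed
  have 2: "few 2 {x. x \<noteq> 0 \<and> (\<exists>s. fold_at x s \<and> 1 + (p' + 1 / x) * s = 0)}"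
  proof (rule few_quadratic_subset[where \<alpha> = "p' * (p' - d')" and \<beta> = "d * p' * (p' - d') + 4 * p'" and \<gamma> = "d * (p' - d') + 4"])
    show "p' * (p' - d') \<noteq> 0 \<or> d * p' * (p' - d') + 4 * p' \<noteq> 0 \<or> d * (p' - d') + 4 \<noteq> 0" using nz by auto
    fix x assume "x \<in> {x. x \<noteq> 0 \<and> (\<exists>s. fold_at x s \<and> 1 + (p' + 1 / x) * s = 0)}"
    then obtain s where x: "x \<noteq> 0" and s: "(d + x + s) * (1 + (d' + 1 / x) * s) = 4 * s" "1 + (p' + 1 / x) * s = 0"
      unfolding fold_at_def by auto
    \<comment> \<open>Here \<open>s = - x / k\<close>; multiplying by \<open>k^2\<close> clears the denominators.\<close>
    define k where "k = p' * x + 1"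
    have e1: "(d + x + s) * (x + (d' * x + 1) * s) = 4 * s * x" using s(1) x by (simp add: field_simps)
    have "x * (1 + (p' + 1 / x) * s) = x + k * s" using x unfolding k_def by (simp add: field_simps)
    hence e2: "s * k = - x" using s(2) by algebra
    note e = e1 e2
    have "((d + x) * k + s * k) * (x * k + (d' * x + 1) * (s * k)) = 4 * (s * k) * x * k"
      using arg_cong[OF e1, of "\<lambda>z. z * k^2"] by (simp only: power2_eq_square algebra_simps)
    moreover have "x * k + (d' * x + 1) * (- x) = x^2 * (p' - d')"
      unfolding k_def by (simp add: algebra_simps power2_eq_square)
    ultimately have "((d + x) * k + (- x)) * (x^2 * (p' - d')) = 4 * (- x) * x * k" unfolding e(2)
      by metis
    hence "x^2 * (((d + x) * k - x) * (p' - d') + 4 * k) = 0" by algebra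
    hence "((d + x) * k - x) * (p' - d') + 4 * k = 0" using x by simp
    thus "p' * (p' - d') * x\<^sup>2 + (d * p' * (p' - d') + 4 * p') * x + (d * (p' - d') + 4) = 0" unfolding k_def by algebra
  qed
  from few_Un[OF 1 2] show ?thesis by (rule few_mono) auto
qed

lemma few_fold_tangent:
  "few 4 {x. x \<noteq> 0 \<and> (\<exists>s. fold_at x s \<and> (p + x + s) * (1 + (p' + 1 / x) * s) = 4 * s)}"
proof (rule few_mono[OF few_x_two_circles[of d d' 4 p p' 4]])
  have c: "d + x + s = x + s + d" "p + x + s = x + s + p" for x s by (simp_all add: add_ac)
  show "{x. x \<noteq> 0 \<and> (\<exists>s. fold_at x s \<and> (p + x + s) * (1 + (p' + 1 / x) * s) = 4 * s)} \<subseteq> {x. x \<noteq> 0 \<and> (\<exists>s. s \<noteq> 0 \<and> x + s \<noteq> 0 \<and>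
     (x + s + d) * (1 + (d' + 1 / x) * s) = 4 * s \<and> (x + s + p) * (1 + (p' + 1 / x) * s) = 4 * s)}"
    unfolding fold_at_def c by blast
qed (use nz in auto)

lemma few_fold_v:
  assumes "v \<noteq> 0" shows "few 4 {x. x \<noteq> 0 \<and> (\<exists>s. fold_at x s \<and> G12 x s v = 0)}"
proof (rule few_mono[OF few_x_two_circles[of d d' 4 "p - v" "p' - 1 / v" 1]])
  have G: "G12 x s v = v * ((x + s + (p - v)) * (1 + ((p' - 1 / v) + 1 / x) * s) - 1 * s)" for x s
    unfolding G_eq_circle[OF assms] by (simp add: algebra_simps)
  have c: "d + x + s = x + s + d" for x s by (simp add: add_ac)
  show "{x. x \<noteq> 0 \<and> (\<exists>s. fold_at x s \<and> G12 x s v = 0)} \<subseteq> {x. x \<noteq> 0 \<and> (\<exists>s. s \<noteq> 0 \<and> x + s \<noteq> 0 \<and>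
     (x + s + d) * (1 + (d' + 1 / x) * s) = 4 * s \<and> (x + s + (p - v)) * (1 + (p' - 1 / v + 1 / x) * s) = 1 * s)}"
  proof
    fix x assume "x \<in> {x. x \<noteq> 0 \<and> (\<exists>s. fold_at x s \<and> G12 x s v = 0)}"
    then obtain s where x: "x \<noteq> 0" and f: "fold_at x s" and g: "G12 x s v = 0" by blast
    have "(x + s + (p - v)) * (1 + ((p' - 1 / v) + 1 / x) * s) = 1 * s"
      using g assms unfolding G by (metis eq_iff_diff_eq_0 mult_eq_0_iff)
    thus "x \<in> {x. x \<noteq> 0 \<and> (\<exists>s. s \<noteq> 0 \<and> x + s \<noteq> 0 \<and>
     (x + s + d) * (1 + (d' + 1 / x) * s) = 4 * s \<and> (x + s + (p - v)) * (1 + (p' - 1 / v + 1 / x) * s) = 1 * s)}"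
      using x f unfolding fold_at_def c by blast
  qed
qed auto

text \<open>
  On a generic circle \<open>x\<close> outside this set there is a fold; the relation between \<open>s\<close> and \<open>v\<close> is regular there,
  and no circle \<open>v\<close> through the fold point contains \<open>p1\<close>.
\<close>

definition bad_start :: "complex set" where
  "bad_start = {x. x \<noteq> 0 \<and> (d + x = 0 \<or> d' + 1 / x = 0 \<or> (d + x) * (d' + 1 / x) = 9)} \<union>
     {x. x \<noteq> 0 \<and> (\<exists>s. fold_at x s \<and> (p + x + s = 0 \<or> 1 + (p' + 1 / x) * s = 0))} \<union>
     {x. x \<noteq> 0 \<and> (\<exists>s. fold_at x s \<and> (p + x + s) * (1 + (p' + 1 / x) * s) = 4 * s)} \<union>
     (\<Union>v\<in>through_first. {x. x \<noteq> 0 \<and> (\<exists>s. fold_at x s \<and> G12 x s v = 0)})"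

lemma few_bad_start: "few 22 bad_start"
proof -
  have 1: "few 2 {x. x \<noteq> 0 \<and> d + x = 0}"
    by (rule few_quadratic_subset[where \<alpha> = 0 and \<beta> = 1 and \<gamma> = d]) (auto simp: add.commute)
  have 2: "few 2 {x. x \<noteq> 0 \<and> d' + 1 / x = 0}"
    by (rule few_quadratic_subset[where \<alpha> = 0 and \<beta> = d' and \<gamma> = 1]) (auto simp: field_simps)
  have 3: "few 2 {x. x \<noteq> 0 \<and> (d + x) * (d' + 1 / x) = 9}"
    by (rule few_quadratic_subset[where \<alpha> = d' and \<beta> = "d * d' - 8" and \<gamma> = d])
       (use nz in \<open>auto simp: field_simps power2_eq_square\<close>)
  have 4: "few (2 * 4) (\<Union>v\<in>through_first. {x. x \<noteq> 0 \<and> (\<exists>s. fold_at x s \<and> G12 x s v = 0)})"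
    by (rule few_UN[OF few_through_first few_fold_v[OF through_first_nz]])
  show ?thesis
    by (rule few_mono[OF few_Un[OF few_Un[OF few_Un[OF few_Un[OF few_Un[OF 1 2] 3] few_fold_isotropic] few_fold_tangent] 4]])
       (unfold bad_start_def, intro Un_mono subset_refl, blast, simp)
qed


definition fold_s :: "complex \<Rightarrow> complex" where "fold_s x = (SOME s. fold_at x s)"
definition fold_w :: "complex \<Rightarrow> complex" where "fold_w x = (d + x + fold_s x) / 2"

lemma fold_s:
  assumes "generic x" "x \<notin> bad_start"
  shows "fold_at x (fold_s x)"
    "1 + (d' + 1 / x) * fold_s x \<noteq> 0" "G13 x (fold_s x) (fold_w x) = 0" "Gs13 x (fold_s x) (fold_w x) \<noteq> 0"
    "d + x + fold_s x = 2 * fold_w x" "1 + (p' + 1 / x) * fold_s x \<noteq> 0"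
    "\<And>v. G12 x (fold_s x) v = 0 \<Longrightarrow> Gv12 x (fold_s x) v \<noteq> 0 \<and> v \<noteq> 0 \<and> v \<notin> through_first"
proof -
  have x: "x \<noteq> 0" "(d + x) * (d' + 1 / x) \<noteq> 1" "(p + x) * (p' + 1 / x) \<noteq> 1" "(d + x) * (d' + 1 / x) \<noteq> 9" "d + x \<noteq> 0" "d' + 1 / x \<noteq> 0"
    using assms unfolding generic_def bad_start_def by auto
  show f: "fold_at x (fold_s x)" unfolding fold_s_def using fold_exists[OF x(2,4-6)] by (rule someI_ex)
  note r = fold_regular[OF f x(2,4)]
  show "1 + (d' + 1 / x) * fold_s x \<noteq> 0" "G13 x (fold_s x) (fold_w x) = 0" "Gs13 x (fold_s x) (fold_w x) \<noteq> 0"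
    "d + x + fold_s x = 2 * fold_w x" using r unfolding fold_w_def by auto
  have n: "p + x + fold_s x \<noteq> 0" "1 + (p' + 1 / x) * fold_s x \<noteq> 0" "(p + x + fold_s x) * (1 + (p' + 1 / x) * fold_s x) \<noteq> 4 * fold_s x"
    "\<And>v. G12 x (fold_s x) v = 0 \<Longrightarrow> v \<notin> through_first"
    using assms(2) f x(1) unfolding bad_start_def by auto
  show "1 + (p' + 1 / x) * fold_s x \<noteq> 0" by fact
  fix v assume v: "G12 x (fold_s x) v = 0"
  have "Gv12 x (fold_s x) v \<noteq> 0" using double_v(2)[OF x(3) v] n by blast
  moreover have "v \<noteq> 0"
  proof
    assume "v = 0"
    hence "fold_s x * (p + x + fold_s x) = 0" using v unfolding G_as_quadratic_v by simp
    thus False using n f unfolding fold_at_def by simp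
  qed
  ultimately show "Gv12 x (fold_s x) v \<noteq> 0 \<and> v \<noteq> 0 \<and> v \<notin> through_first" using n(4) v by blast
qed

text \<open>
  These sets describe the failures on the side of \<open>y\<close>: the relations between \<open>w\<close>, \<open>t\<close> and \<open>v\<close> over the
  limit value of \<open>w\<close> must be regular.  The set \<open>bad_v\<close> is a parameter; it collects the values of \<open>v\<close> for which the
  conditions on the second point might hold identically.
\<close>

definition bad_w :: "complex set \<Rightarrow> complex \<Rightarrow> complex set" where
  "bad_w bad_v y = {w. (d' + 1 / y) * w = 1} \<union> {w. \<exists>t. G13 y t w = 0 \<and> Gv13 y t w = 0} \<union>
     {w. \<exists>t. G13 y t w = 0 \<and> (t = 0 \<or> p + y + t = 0 \<or> 1 + (p' + 1 / y) * t = 0)} \<union>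
     {w. \<exists>t v. G13 y t w = 0 \<and> G12 y t v = 0 \<and> (Gs12 y t v = 0 \<or> v \<in> bad_v)}"

lemma few_bad_w:
  assumes "generic y" "few 5 bad_v"
  shows "few 100 (bad_w bad_v y)"
proof -
  have y: "(d + y) * (d' + 1 / y) \<noteq> 1" "(p + y) * (p' + 1 / y) \<noteq> 1" using assms(1) unfolding generic_def by auto
  have 1: "few 2 {w. (d' + 1 / y) * w = 1}"
    by (rule few_quadratic_subset[where \<alpha> = 0 and \<beta> = "d' + 1 / y" and \<gamma> = "- 1"]) auto
  note 2 = few_double_v[OF y(1)]
  have "few 2 {t. 1 + (p' + 1 / y) * t = 0}"
    by (rule few_quadratic_subset[where \<alpha> = 0 and \<beta> = "p' + 1 / y" and \<gamma> = "1"]) (auto simp: add_ac)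
  from few_Un[OF few_Un[OF few_singleton[of 0] few_singleton[of "- (p + y)"]] this]
  have tt: "few 4 ({0} \<union> {- (p + y)} \<union> {t. 1 + (p' + 1 / y) * t = 0})" by (rule few_mono) simp_all
  have 3: "few (4 * 2) {w. \<exists>t. G13 y t w = 0 \<and> (t = 0 \<or> p + y + t = 0 \<or> 1 + (p' + 1 / y) * t = 0)}"
    by (rule few_UN_subset[where S = "\<lambda>t. {w. G13 y t w = 0}", OF tt few_v[OF y(1)]]) (auto simp: add_eq_0_iff)
  have "few (5 * 2) (\<Union>v\<in>bad_v. {t. G12 y t v = 0})" by (rule few_UN[OF assms(2) few_s[OF y(2)]])
  from few_Un[OF few_double_s[OF y(2)] this]
  have tv: "few 13 ({t. \<exists>v. G12 y t v = 0 \<and> Gs12 y t v = 0} \<union> (\<Union>v\<in>bad_v. {t. G12 y t v = 0}))" by (rule few_mono) simp_all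
  have 4: "few (13 * 2) {w. \<exists>t v. G13 y t w = 0 \<and> G12 y t v = 0 \<and> (Gs12 y t v = 0 \<or> v \<in> bad_v)}"
    by (rule few_UN_subset[where S = "\<lambda>t. {w. G13 y t w = 0}", OF tv few_v[OF y(1)]]) auto
  show ?thesis unfolding bad_w_def by (rule few_mono[OF few_Un[OF few_Un[OF few_Un[OF 1 2] 3] 4]]) auto
qed

text \<open>
  The roles of the two coordinates matter: \<open>y\<close> is fixed and \<open>x\<close> varies, because then the failing values of
  \<open>w\<close> form a bounded set that is determined by \<open>y\<close> alone.
\<close>

lemma few_bad_pairs:
  assumes "generic y" "few 5 bad_v"
  shows "few 200 {x. generic x \<and> x \<notin> bad_start \<and> fold_w x \<in> bad_w bad_v y}"
proof -
  have "few (100 * 2) {x. generic x \<and> x \<notin> bad_start \<and> fold_w x \<in> bad_w bad_v y}"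
  proof (rule few_UN_subset[OF few_bad_w[OF assms] few_x_of_w])
    show "{x. generic x \<and> x \<notin> bad_start \<and> fold_w x \<in> bad_w bad_v y} \<subseteq> (\<Union>w\<in>bad_w bad_v y. {x. x \<noteq> 0 \<and> (\<exists>s. fold_at x s \<and> d + x + s = 2 * w)})"
    proof safe
      fix x assume "generic x" "x \<notin> bad_start" "fold_w x \<in> bad_w bad_v y"
      thus "x \<in> (\<Union>w\<in>bad_w bad_v y. {x. x \<noteq> 0 \<and> (\<exists>s. fold_at x s \<and> d + x + s = 2 * w)})"
        using fold_s(1,5)[of x] by (intro UN_I[of "fold_w x"]) (auto simp: generic_def)
    qed
  qed
  thus ?thesis by simp
qed

lemma few_x_lead: assumes "v \<noteq> 0" shows "few 2 {x. x \<noteq> 0 \<and> (p' + 1 / x) * v = 1}"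
  by (rule few_quadratic_subset[where \<alpha> = 0 and \<beta> = "p' * v - 1" and \<gamma> = v])
     (use assms in \<open>auto simp: field_simps\<close>)

lemma few_x_double_s:
  assumes "v \<noteq> 0"
  shows "few 3 {x. generic x \<and> (\<exists>s. G12 x s v = 0 \<and> Gs12 x s v = 0)}"
proof -
  let ?q = "\<lambda>x. (1 - p' * v) * x^2 + ((p' * v - 1) * (v - p) + 3 * v) * x + v * (v - p)"
  have "few 2 {x. ?q x = 0}" by (rule few_quadratic) (use assms in auto)
  from few_Un[OF few_singleton this, of "v - p"] have "few 3 ({v - p} \<union> {x. ?q x = 0})" by (rule few_mono) simp_all
  thus ?thesis
  proof (rule few_mono)
    show "{x. generic x \<and> (\<exists>s. G12 x s v = 0 \<and> Gs12 x s v = 0)} \<subseteq> {v - p} \<union> {x. ?q x = 0}"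
    proof
      fix x assume "x \<in> {x. generic x \<and> (\<exists>s. G12 x s v = 0 \<and> Gs12 x s v = 0)}"
      then obtain s where x: "generic x" and G: "G12 x s v = 0" "Gs12 x s v = 0" by blast
      have "(p + x) * (p' + 1 / x) \<noteq> 1" and x0: "x \<noteq> 0" using x unfolding generic_def by auto
      from double_s[OF this(1) G]
      have v: "v = p + x + 2 * s" and c: "s = 0 \<or> ((p' + 1 / x) * v - 1) * s = - 2 * v" by auto
      show "x \<in> {v - p} \<union> {x. ?q x = 0}"
      proof (cases "s = 0")
        case True thus ?thesis using v by simp
      next
        case False
        hence "((p' + 1 / x) * v - 1) * s = - 2 * v" using c by simp
        hence "((p' * v - 1) * x + v) * s = - 2 * v * x" using x0 by (simp add: field_simps)
        moreover have "2 * s = v - p - x" using v by algebra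
        ultimately have "?q x = 0" by algebra
        thus ?thesis by simp
      qed
    qed
  qed simp
qed

lemma few_x_isotropic:
  assumes "v \<noteq> 0"
  shows "few 4 {x. x \<noteq> 0 \<and> (\<exists>s. G12 x s v = 0 \<and> (d + x + s = 0 \<or> 1 + (d' + 1 / x) * s = 0))}"
proof -
  have G: "(x + (p' * x + 1) * s) * v^2 - (p + x + s) * (x + (p' * x + 1) * s) * v + x * s * (p + x + s) = 0"
    if "x \<noteq> 0" "G12 x s v = 0" for x s
  proof -
    have "- x * G12 x s v = (x + (p' * x + 1) * s) * v^2 - (p + x + s) * (x + (p' * x + 1) * s) * v + x * s * (p + x + s)"
      unfolding G_as_quadratic_v using that(1) by (simp add: field_simps power2_eq_square)
    thus ?thesis using that by simp
  qed
  define h where "h = v^2 - (p - d) * v"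
  have 1: "few 2 {x. x \<noteq> 0 \<and> (\<exists>s. G12 x s v = 0 \<and> d + x + s = 0)}"
  proof (rule few_quadratic_subset[where \<alpha> = "- p' * h - (p - d)" and \<beta> = "- p' * d * h - d * (p - d)" and \<gamma> = "- d * h"])
    show "- p' * h - (p - d) \<noteq> 0 \<or> - p' * d * h - d * (p - d) \<noteq> 0 \<or> - d * h \<noteq> 0" using nz by auto
    fix x assume "x \<in> {x. x \<noteq> 0 \<and> (\<exists>s. G12 x s v = 0 \<and> d + x + s = 0)}"
    then obtain s where x: "x \<noteq> 0" and s: "G12 x s v = 0" "d + x + s = 0" by blast
    from s(2) have "s = - d - x" by algebra
    thus "(- p' * h - (p - d)) * x\<^sup>2 + (- p' * d * h - d * (p - d)) * x + - d * h = 0"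
      using G[OF x s(1)] unfolding h_def by algebra
  qed
  define e where "e = d' - p'"
  have 2: "few 2 {x. x \<noteq> 0 \<and> (\<exists>s. G12 x s v = 0 \<and> 1 + (d' + 1 / x) * s = 0)}"
  proof (rule few_quadratic_subset[where \<alpha> = "- d' * (e * v + 1)" and \<beta> = "e * v^2 * d' - d' * p * (e * v + 1)" and \<gamma> = "e * v^2 - p * (e * v + 1)"])
    show "- d' * (e * v + 1) \<noteq> 0 \<or> e * v^2 * d' - d' * p * (e * v + 1) \<noteq> 0 \<or> e * v^2 - p * (e * v + 1) \<noteq> 0"
      using nz assms unfolding e_def by auto
    fix x assume "x \<in> {x. x \<noteq> 0 \<and> (\<exists>s. G12 x s v = 0 \<and> 1 + (d' + 1 / x) * s = 0)}"
    then obtain s where x: "x \<noteq> 0" and s: "G12 x s v = 0" "1 + (d' + 1 / x) * s = 0" by blast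
    \<comment> \<open>Here \<open>s = - x / k\<close>; multiplying by \<open>k^2\<close> clears the denominators.\<close>
    define k where "k = d' * x + 1"
    have "x * (1 + (d' + 1 / x) * s) = x + k * s" using x unfolding k_def by (simp add: field_simps)
    hence sk: "s * k = - x" using s(2) by algebra
    have k0: "k \<noteq> 0" using sk x by auto
    have "(x * k + (p' * x + 1) * (s * k)) * k * v^2 - ((p + x) * k + s * k) * (x * k + (p' * x + 1) * (s * k)) * v + x * (s * k) * ((p + x) * k + s * k) = 0"
      using arg_cong[OF G[OF x s(1)], of "\<lambda>z. z * k^2"] by (simp add: power2_eq_square algebra_simps)
    moreover have "x * k + (p' * x + 1) * (- x) = x^2 * e"
      unfolding k_def e_def by (simp add: algebra_simps power2_eq_square)
    ultimately have "x^2 * e * k * v^2 - ((p + x) * k + (- x)) * (x^2 * e) * v + x * (- x) * ((p + x) * k + (- x)) = 0"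
      unfolding sk by metis
    hence "x^2 * (e * v^2 * k - ((p + x) * k - x) * (e * v + 1)) = 0" by algebra
    hence "e * v^2 * k - ((p + x) * k - x) * (e * v + 1) = 0" using x by simp
    thus "- d' * (e * v + 1) * x\<^sup>2 + (e * v\<^sup>2 * d' - d' * p * (e * v + 1)) * x + (e * v\<^sup>2 - p * (e * v + 1)) = 0"
      unfolding k_def by algebra
  qed
  from few_Un[OF 1 2] show ?thesis by (rule few_mono) auto
qed

text \<open>
  Over a limit value \<open>v\<close>, these are the circles \<open>x\<close> on which the passage from \<open>v\<close> to \<open>s\<close> and on to \<open>w\<close> is
  not regular.
\<close>

definition bad_x :: "complex \<Rightarrow> complex set" where
  "bad_x v = {x. x \<noteq> 0 \<and> (p' + 1 / x) * v = 1} \<union> {x. generic x \<and> (\<exists>s. G12 x s v = 0 \<and> Gs12 x s v = 0)} \<union>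
     {x. x \<noteq> 0 \<and> (\<exists>s. G12 x s v = 0 \<and> (d + x + s = 0 \<or> 1 + (d' + 1 / x) * s = 0))} \<union>
     {x. x \<noteq> 0 \<and> (\<exists>s. fold_at x s \<and> G12 x s v = 0)}"

lemma few_bad_x: "v \<noteq> 0 \<Longrightarrow> few 13 (bad_x v)"
  unfolding bad_x_def using few_Un[OF few_Un[OF few_Un[OF few_x_lead few_x_double_s] few_x_isotropic] few_fold_v] by simp

lemma not_bad_x:
  assumes "generic x" "x \<notin> bad_x v" "v \<notin> through_first"
  shows "(p' + 1 / x) * v \<noteq> 1" "\<And>s. G12 x s v = 0 \<Longrightarrow> Gs12 x s v \<noteq> 0"
    "\<And>s. G12 x s v = 0 \<Longrightarrow> 1 + (d' + 1 / x) * s \<noteq> 0"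
    "\<And>s w. G12 x s v = 0 \<Longrightarrow> G13 x s w = 0 \<Longrightarrow> Gv13 x s w \<noteq> 0"
proof -
  have x: "x \<noteq> 0" "(d + x) * (d' + 1 / x) \<noteq> 1" using assms(1) by (auto simp: generic_def)
  show "(p' + 1 / x) * v \<noteq> 1" "\<And>s. G12 x s v = 0 \<Longrightarrow> Gs12 x s v \<noteq> 0"
    "\<And>s. G12 x s v = 0 \<Longrightarrow> 1 + (d' + 1 / x) * s \<noteq> 0"
    using assms(1,2) x unfolding bad_x_def by auto
  fix s w assume s: "G12 x s v = 0" and w: "G13 x s w = 0"
  have n: "d + x + s \<noteq> 0" "\<not> fold_at x s" using assms(2) x s unfolding bad_x_def by auto
  have "x + s \<noteq> 0"
  proof
    assume "x + s = 0"
    hence "s = - x" by (simp add: add_eq_0_iff)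
    thus False using in_through_first[of x v] x(1) s assms(3) by simp
  qed
  thus "Gv13 x s w \<noteq> 0" using double_v(2)[OF x(2) w] n unfolding fold_at_def by auto
qed

lemma few_y_double_v:
  assumes "v \<noteq> 0" "2 * v \<noteq> p"
  shows "few 2 {y. generic y \<and> (\<exists>t. G12 y t v = 0 \<and> Gv12 y t v = 0)}"
proof (rule few_quadratic_subset[where \<alpha> = "2 - v * p'" and \<beta> = "(v * p' - 2) * (2 * v - p)" and \<gamma> = "v * (2 * v - p)"])
  show "2 - v * p' \<noteq> 0 \<or> (v * p' - 2) * (2 * v - p) \<noteq> 0 \<or> v * (2 * v - p) \<noteq> 0" using assms by auto
  fix y assume "y \<in> {y. generic y \<and> (\<exists>t. G12 y t v = 0 \<and> Gv12 y t v = 0)}"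
  then obtain t where y: "generic y" and t: "G12 y t v = 0" "Gv12 y t v = 0" by blast
  have y0: "y \<noteq> 0" "(p + y) * (p' + 1 / y) \<noteq> 1" using y unfolding generic_def by auto
  note dv = double_v[OF y0(2) t]
  have "v * (1 + (p' + 1 / y) * t) = 2 * t" using dv(1,2) assms(1) by auto
  hence "v * (y + (p' * y + 1) * t) = 2 * t * y" using y0 by (simp add: field_simps)
  moreover have "t = 2 * v - p - y" using dv(1) by algebra
  ultimately show "(2 - v * p') * y\<^sup>2 + (v * p' - 2) * (2 * v - p) * y + v * (2 * v - p) = 0" by algebra
qed


lemma not_bad_w:
  assumes "generic y" "w \<notin> bad_w bad_v y"
  shows "(d' + 1 / y) * w \<noteq> 1" "\<And>t. G13 y t w = 0 \<Longrightarrow> Gv13 y t w \<noteq> 0"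
    "\<And>t. G13 y t w = 0 \<Longrightarrow> 1 + (p' + 1 / y) * t \<noteq> 0"
    "\<And>t v. G13 y t w = 0 \<Longrightarrow> G12 y t v = 0 \<Longrightarrow> Gs12 y t v \<noteq> 0 \<and> v \<noteq> 0 \<and> v \<notin> bad_v"
proof -
  show "(d' + 1 / y) * w \<noteq> 1" "\<And>t. G13 y t w = 0 \<Longrightarrow> Gv13 y t w \<noteq> 0"
    "\<And>t. G13 y t w = 0 \<Longrightarrow> 1 + (p' + 1 / y) * t \<noteq> 0"
    using assms unfolding bad_w_def by blast+
  fix t v assume t: "G13 y t w = 0" and v: "G12 y t v = 0"
  have n: "t \<noteq> 0" "p + y + t \<noteq> 0" "Gs12 y t v \<noteq> 0" "v \<notin> bad_v" using assms(2) t v unfolding bad_w_def by blast+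
  have "v \<noteq> 0"
  proof
    assume "v = 0"
    hence "t * (p + y + t) = 0" using v unfolding G_as_quadratic_v by simp
    thus False using n by simp
  qed
  thus "Gs12 y t v \<noteq> 0 \<and> v \<noteq> 0 \<and> v \<notin> bad_v" using n by blast
qed

text \<open>
  Some circle \<open>w\<close> of the third family is tangent to the circle \<open>y\<close> at one of its points \<open>t\<close> on the circle \<open>v\<close>.
  The quadratic equation, taken from \<open>double_s\<close>, is the tangency with \<open>w\<close> eliminated.
\<close>

definition tangent_set :: "complex \<Rightarrow> complex set" where
  "tangent_set v = {y. y \<noteq> 0 \<and> (\<exists>t. G12 y t v = 0 \<and>
     2 * (d' + 1 / y) * t^2 + ((d + y) * (d' + 1 / y) + 3) * t + 2 * (d + y) = 0)}"

text \<open>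
  The last set differs from the others in that \<open>w\<close> is not known beforehand; the tangency is a second
  condition on \<open>y\<close> and the unknown point \<open>t\<close>.
\<close>

definition bad_y :: "complex \<Rightarrow> complex set" where
  "bad_y v = {y. y \<noteq> 0 \<and> (p' + 1 / y) * v = 1} \<union> {y. generic y \<and> (\<exists>t. G12 y t v = 0 \<and> Gv12 y t v = 0)} \<union>
     {y. generic y \<and> (\<exists>t w. G12 y t v = 0 \<and> G13 y t w = 0 \<and> Gs13 y t w = 0)}"

lemma few_bad_y:
  assumes "v \<noteq> 0" "2 * v \<noteq> p" "few D (tangent_set v)"
  shows "few (5 + D) (bad_y v)"
proof -
  have "few (1 + D) {y. generic y \<and> (\<exists>t w. G12 y t v = 0 \<and> G13 y t w = 0 \<and> Gs13 y t w = 0)}"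
  proof (rule few_mono[OF few_Un[OF few_singleton assms(3)]])
    show "{y. generic y \<and> (\<exists>t w. G12 y t v = 0 \<and> G13 y t w = 0 \<and> Gs13 y t w = 0)} \<subseteq> {v - p} \<union> tangent_set v"
    proof
      fix y assume "y \<in> {y. generic y \<and> (\<exists>t w. G12 y t v = 0 \<and> G13 y t w = 0 \<and> Gs13 y t w = 0)}"
      then obtain t w where y: "generic y" and t: "G12 y t v = 0" and w: "G13 y t w = 0" "Gs13 y t w = 0" by blast
      have y0: "y \<noteq> 0" "(d + y) * (d' + 1 / y) \<noteq> 1" using y unfolding generic_def by auto
      show "y \<in> {v - p} \<union> tangent_set v"
      proof (cases "t = 0")
        case True
        hence "v = p + y" using t assms(1) unfolding G_def by simp
        thus ?thesis by simp
      next
        case False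
        thus ?thesis using double_s(3)[OF y0(2) w] t y0(1) unfolding tangent_set_def by auto
      qed
    qed
  qed simp
  from few_Un[OF few_Un[OF few_x_lead[OF assms(1)] few_y_double_v[OF assms(1,2)]] this]
  show ?thesis unfolding bad_y_def by (rule few_mono) auto
qed

lemma not_bad_y:
  assumes "generic y" "y \<notin> bad_y v"
  shows "(p' + 1 / y) * v \<noteq> 1" "\<And>t. G12 y t v = 0 \<Longrightarrow> Gv12 y t v \<noteq> 0"
    "\<And>t w. G12 y t v = 0 \<Longrightarrow> G13 y t w = 0 \<Longrightarrow> Gs13 y t w \<noteq> 0"
  using assms unfolding bad_y_def generic_def by blast+

end

text \<open>
  The point at which a circle of the first family touches one of the third runs along a coupler curve of a
  four-bar linkage.  Such a curve can contain a unit circle, for instance when \<open>p1\<close> and \<open>p3\<close> are at distance two;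
  so a circle \<open>v\<close> of the second family may satisfy the tangency condition identically.  Elimination of \<open>t\<close> leaves a
  polynomial in \<open>y\<close>.  At a fixed value \<open>y0\<close> it vanishes only if the circle \<open>v\<close> passes through one of two points, which
  excludes at most four values of \<open>v\<close>; for all other \<open>v\<close> the polynomial is not zero and has boundedly many roots.
\<close>

lemma few_tangent:
  "\<exists>D. \<forall>p p' d d'. three_points p p' d d' \<longrightarrow>
     (\<exists>bad_v. few 4 bad_v \<and> (\<forall>v. v \<notin> bad_v \<longrightarrow> few D (three_points.tangent_set p p' d d' v)))"
proof -
  obtain D where D: "eliminates 1 6 D"
    using eliminate_tower[of 1 6] ..
  show ?thesis
  proof (intro exI[of _ D] allI impI)
    fix p p' d d' assume tp: "three_points p p' d d'"
    interpret three_points p p' d d' by fact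
    have "few 2 {y. y \<noteq> 0 \<and> (p + y) * (p' + 1 / y) = 1}"
    proof (rule few_quadratic_subset[where \<alpha> = p' and \<beta> = "p * p'" and \<gamma> = p])
      fix y assume "y \<in> {y. y \<noteq> 0 \<and> (p + y) * (p' + 1 / y) = 1}"
      hence "(p + y) * (p' + 1 / y) = 1" "(p' + 1 / y) * y = p' * y + 1" by (auto simp: field_simps)
      thus "p' * y^2 + p * p' * y + p = 0" by algebra
    qed (use nz in simp)
    \<comment> \<open>At \<open>y0\<close> the quadratic in \<open>t\<close> has a nonzero leading coefficient, and the circle avoids \<open>p2\<close>.\<close>
    hence "finite {y. y \<noteq> 0 \<and> (p + y) * (p' + 1 / y) = 1}" unfolding few_def by blast
    hence "finite (insert 0 (insert (- 1 / d') {y. y \<noteq> 0 \<and> (p + y) * (p' + 1 / y) = 1}))" by (intro finite.insertI)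
    from ex_new_if_finite[OF infinite_UNIV_char_0 this]
    obtain y0 where y0: "y0 \<noteq> 0" "(p + y0) * (p' + 1 / y0) \<noteq> 1" and "y0 \<noteq> - 1 / d'" by blast
    have y0': "d' * y0 + 1 \<noteq> 0"
    proof
      assume "d' * y0 + 1 = 0"
      hence "d' * y0 = - 1" unfolding add_eq_0_iff2 .
      moreover have "d' * (- 1 / d') = - 1" using nz by simp
      ultimately have "d' * y0 = d' * (- 1 / d')" by (simp only:)
      thus False using \<open>y0 \<noteq> - 1 / d'\<close> nz unfolding mult_cancel_left by blast
    qed
    define a where "a = (\<lambda>(k::nat) (e::nat \<Rightarrow> complex). 2 * (d' * e 0 + 1))"
    define b where "b = (\<lambda>(k::nat) (e::nat \<Rightarrow> complex). (d + e 0) * (d' * e 0 + 1) + 3 * e 0)"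
    define c where "c = (\<lambda>(k::nat) (e::nat \<Rightarrow> complex). 2 * (d + e 0) * e 0)"
    define bad_v where "bad_v = (\<Union>t\<in>{t. a 1 (\<lambda>_. y0) * t^2 + b 1 (\<lambda>_. y0) * t + c 1 (\<lambda>_. y0) = 0}. {v. G12 y0 t v = 0})"
    have a0: "a 1 (\<lambda>_. y0) \<noteq> 0" unfolding a_def using y0' by (metis mult_eq_0_iff zero_neq_numeral)
    have "few (2 * 2) bad_v" unfolding bad_v_def
      by (intro few_UN few_quadratic few_v y0) (use a0 in blast)
    moreover have "few D (tangent_set v)" if v: "v \<notin> bad_v" for v
    proof -
      define F where "F = (\<lambda>e::nat \<Rightarrow> complex. (p + e 0 + (- v)) * v * e 0 +
        ((p + e 0 + (- v)) * ((p' * e 0 + 1) * v + (- 1) * e 0) * e 1 + ((p' * e 0 + 1) * v + (- 1) * e 0) * (e 1 * e 1)))"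
      have FG: "F e = e 0 * G12 (e 0) (e 1) v" if "e 0 \<noteq> 0" for e
      proof -
        have "e 0 * ((p' + 1 / e 0) * v - 1) = (p' * e 0 + 1) * v - e 0" using that by (simp add: field_simps)
        thus ?thesis unfolding F_def G_def by algebra
      qed
      have v1: "polyfn k 1 (\<lambda>e. e i)" if "i < k" for i k using polyfn_var that by blast
      have c0: "polyfn k 0 (\<lambda>e. z)" for z k by (rule polyfn_const)
      have m1: "polyfn k 1 (\<lambda>e. z * e i)" if "i < k" for i k z
        using polyfn_mult[OF c0[of k z] v1[OF that]] by simp
      have m2: "polyfn (Suc 1) 1 (\<lambda>e. (p' * e 0 + 1) * v)"
        using polyfn_mult[OF polyfn_add[OF m1[of 0 "Suc 1" p'] polyfn_const] c0[of "Suc 1" v]] by simp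
      have l: "polyfn (Suc 1) 1 (\<lambda>e. p + e 0 + (- v))" "polyfn (Suc 1) 1 (\<lambda>e. (p' * e 0 + 1) * v + (- 1) * e 0)"
        "polyfn 1 1 (\<lambda>e. d + e 0)" "polyfn 1 1 (\<lambda>e. d' * e 0 + 1)"
        by (intro polyfn_add polyfn_const v1 m1 m2; simp)+
      have "polyfn (Suc 1) 6 F" unfolding F_def
      proof (intro polyfn_add)
        show "polyfn (Suc 1) 6 (\<lambda>e. (p + e 0 + (- v)) * v * e 0)"
          by (rule polyfn_mono[OF polyfn_mult[OF polyfn_mult[OF l(1) c0] v1]]) auto
        show "polyfn (Suc 1) 6 (\<lambda>e. (p + e 0 + (- v)) * ((p' * e 0 + 1) * v + (- 1) * e 0) * e 1)"
          by (rule polyfn_mono[OF polyfn_mult[OF polyfn_mult[OF l(1) l(2)] v1]]) auto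
        show "polyfn (Suc 1) 6 (\<lambda>e. ((p' * e 0 + 1) * v + (- 1) * e 0) * (e 1 * e 1))"
          by (rule polyfn_mono[OF polyfn_mult[OF l(2) polyfn_mult[OF v1 v1]]]) auto
      qed
      note F = this
      have "\<forall>k\<in>{1..1}. polyfn k 2 (a k) \<and> polyfn k 2 (b k) \<and> polyfn k 2 (c k)"
      proof -
        have "polyfn 1 2 (a 1)" unfolding a_def
          by (rule polyfn_mono[OF polyfn_mult[OF c0 l(4)]]) auto
        moreover have "polyfn 1 2 (b 1)" unfolding b_def
        proof (rule polyfn_add)
          show "polyfn 1 2 (\<lambda>e. (d + e 0) * (d' * e 0 + 1))"
            by (rule polyfn_mono[OF polyfn_mult[OF l(3,4)]]) auto
          show "polyfn 1 2 (\<lambda>e. 3 * e 0)" by (rule polyfn_mono[OF polyfn_mult[OF c0 v1]]) auto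
        qed
        moreover have "polyfn 1 2 (c 1)" unfolding c_def
          by (rule polyfn_mono[OF polyfn_mult[OF polyfn_mult[OF c0 l(3)] v1]]) auto
        ultimately show ?thesis by simp
      qed
      from D[unfolded eliminates_def, THEN spec, THEN spec, THEN spec, THEN spec, THEN mp, THEN mp, OF this F]
      obtain N where N: "polyfn 1 D (N 1)" "N (Suc 1) = F"
        and N34: "\<forall>e. (\<forall>k\<in>{1..1}. a k e * e k^2 + b k e * e k + c k e = 0) \<longrightarrow> F e = 0 \<longrightarrow> N 1 e = 0"
        "\<forall>k\<in>{1..1}. \<forall>e. N k e = 0 \<longrightarrow> a k e \<noteq> 0 \<longrightarrow>
           (\<exists>y. a k e * y^2 + b k e * y + c k e = 0 \<and> N (Suc k) (e(k := y)) = 0)"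
        by (elim exE conjE) blast
      have N3: "N 1 e = 0" if "a 1 e * e 1^2 + b 1 e * e 1 + c 1 e = 0" "F e = 0" for e
        using N34(1)[THEN spec, of e] that unfolding atLeastAtMost_singleton by blast
      have N4: "\<exists>y. a 1 e * y^2 + b 1 e * y + c 1 e = 0 \<and> N (Suc 1) (e(1 := y)) = 0" if "N 1 e = 0" "a 1 e \<noteq> 0" for e
        using N34(2) that unfolding atLeastAtMost_singleton by blast
      have "N 1 (\<lambda>_. y0) \<noteq> 0"
      proof
        assume "N 1 (\<lambda>_. y0) = 0"
        from N4[OF this a0] obtain t where t: "a 1 (\<lambda>_. y0) * t^2 + b 1 (\<lambda>_. y0) * t + c 1 (\<lambda>_. y0) = 0" 
          "F ((\<lambda>_. y0)(1 := t)) = 0" unfolding N(2) by blast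
        hence "G12 y0 t v = 0" using FG[of "(\<lambda>_. y0)(1 := t)"] y0 by simp
        thus False using v t(1) unfolding bad_v_def by blast
      qed
      hence fin: "few D {s. \<exists>e. e 0 = s \<and> N 1 e = 0}" using polyfn_1_roots[OF N(1)] unfolding few_def by blast
      show ?thesis
      proof (rule few_mono[OF fin])
        show "tangent_set v \<subseteq> {s. \<exists>e. e 0 = s \<and> N 1 e = 0}"
        proof
          fix y assume "y \<in> tangent_set v"
          then obtain t where y: "y \<noteq> 0" and t: "G12 y t v = 0" 
            "2 * (d' + 1 / y) * t^2 + ((d + y) * (d' + 1 / y) + 3) * t + 2 * (d + y) = 0"
            unfolding tangent_set_def by blast
          let ?e = "(\<lambda>_. y)(1 := t)"
          have "y * (2 * (d' + 1 / y) * t^2 + ((d + y) * (d' + 1 / y) + 3) * t + 2 * (d + y)) =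
              2 * (d' * y + 1) * t^2 + ((d + y) * (d' * y + 1) + 3 * y) * t + 2 * (d + y) * y"
            using y by (simp add: field_simps)
          hence "a 1 ?e * ?e 1^2 + b 1 ?e * ?e 1 + c 1 ?e = 0" using t(2) by (simp add: a_def b_def c_def)
          moreover have "F ?e = 0" using FG[of ?e] y t(1) by simp
          ultimately have "N 1 ?e = 0" by (rule N3)
          thus "y \<in> {s. \<exists>e. e 0 = s \<and> N 1 e = 0}" by (intro CollectI exI[of _ ?e]) simp
        qed
      qed simp
    qed
    ultimately show "\<exists>bad_v. few 4 bad_v \<and> (\<forall>v. v \<notin> bad_v \<longrightarrow> few D (tangent_set v))" by (intro exI[of _ bad_v]) simp
  qed
qed


section \<open>Two points of the grid lie on few common curves\<close>

text \<open>
  The coefficients of \<open>G\<close> as a quadratic polynomial: in the circle parameter \<open>v\<close> if \<open>\<kappa>\<close> holds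
  (up to sign), and in the point parameter \<open>s\<close> otherwise; \<open>z\<close> is the variable that is already known.
\<close>

definition edgeA :: "bool \<Rightarrow> complex \<Rightarrow> complex \<Rightarrow> complex" where
  "edgeA \<kappa> B z = (if \<kappa> then 1 + B * z else B * z + (- 1))"
definition edgeB :: "bool \<Rightarrow> complex \<Rightarrow> complex \<Rightarrow> complex \<Rightarrow> complex" where
  "edgeB \<kappa> A B z = (if \<kappa> then - ((A + z) * (1 + B * z)) else (A + (- z)) * (B * z + (- 1)))"
definition edgeC :: "bool \<Rightarrow> complex \<Rightarrow> complex \<Rightarrow> complex" where
  "edgeC \<kappa> A z = (if \<kappa> then z * (A + z) else (A + (- z)) * z)"

lemma edge_eq:
  "edgeA True B z * y^2 + edgeB True A B z * y + edgeC True A z = 0 \<longleftrightarrow> G A B z y = 0"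
  "edgeA False B z * y^2 + edgeB False A B z * y + edgeC False A z = 0 \<longleftrightarrow> G A B y z = 0"
  unfolding edgeA_def edgeB_def edgeC_def G_as_quadratic_v[of A B z y] G_as_quadratic_s[of A B y z]
  by (simp_all only: if_True if_False neg_equal_0_iff_equal diff_conv_add_uminus)

lemma polyfn_edge:
  assumes "i < k"
  shows "polyfn k 2 (\<lambda>e. edgeA \<kappa> B (e i))" "polyfn k 2 (\<lambda>e. edgeB \<kappa> A B (e i))" "polyfn k 2 (\<lambda>e. edgeC \<kappa> A (e i))"
proof -
  have v: "polyfn k 1 (\<lambda>e. e i)" by (rule polyfn_var[OF assms])
  have Bz: "polyfn k 1 (\<lambda>e. B * e i)" using polyfn_mult[OF polyfn_const[of k 0 B] v] by simp
  have l: "polyfn k 1 (\<lambda>e. 1 + B * e i)" "polyfn k 1 (\<lambda>e. B * e i + (- 1))" "polyfn k 1 (\<lambda>e. A + e i)" "polyfn k 1 (\<lambda>e. A + (- e i))"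
    by (intro polyfn_add polyfn_const Bz v polyfn_uminus)+
  note m = polyfn_mult[OF l(3,1)] polyfn_mult[OF l(4,2)] polyfn_mult[OF v l(3)] polyfn_mult[OF l(4) v]
  have m': "polyfn k 2 (\<lambda>e. (A + e i) * (1 + B * e i))" "polyfn k 2 (\<lambda>e. (A + (- e i)) * (B * e i + (- 1)))"
    "polyfn k 2 (\<lambda>e. e i * (A + e i))" "polyfn k 2 (\<lambda>e. (A + (- e i)) * e i)"
    using m by (simp_all only: one_add_one)
  show "polyfn k 2 (\<lambda>e. edgeA \<kappa> B (e i))" unfolding edgeA_def
    using polyfn_mono[OF l(1), of 2] polyfn_mono[OF l(2), of 2] by (cases \<kappa>) simp_all
  show "polyfn k 2 (\<lambda>e. edgeB \<kappa> A B (e i))" unfolding edgeB_def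
    using polyfn_uminus[OF m'(1)] m'(2) by (cases \<kappa>) simp_all
  show "polyfn k 2 (\<lambda>e. edgeC \<kappa> A (e i))" unfolding edgeC_def
    using m' by (cases \<kappa>) simp_all
qed

lemma polyfn_G:
  assumes "i < k" "j < k" shows "polyfn k 4 (\<lambda>e. G A B (e i) (e j))"
proof -
  have l: "polyfn k 2 (\<lambda>e. edgeA False B (e j))" "polyfn k 2 (\<lambda>e. edgeB False A B (e j))" "polyfn k 2 (\<lambda>e. edgeC False A (e j))"
    by (rule polyfn_edge[OF assms(2)])+
  have v: "polyfn k 1 (\<lambda>e. e i)" by (rule polyfn_var[OF assms(1)])
  have "polyfn k 4 (\<lambda>e. edgeA False B (e j) * (e i * e i) + (edgeB False A B (e j) * e i + edgeC False A (e j)))"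
    by (intro polyfn_add; rule polyfn_mono[OF polyfn_mult[OF l(1) polyfn_mult[OF v v]]]
          polyfn_mono[OF polyfn_mult[OF l(2) v]] polyfn_mono[OF l(3)]; simp)
  also have "(\<lambda>e. edgeA False B (e j) * (e i * e i) + (edgeB False A B (e j) * e i + edgeC False A (e j))) = (\<lambda>e. G A B (e i) (e j))"
    unfolding edgeA_def edgeB_def edgeC_def G_def by (simp add: fun_eq_iff algebra_simps power2_eq_square)
  finally show ?thesis .
qed

context three_points begin

lemma fold_w_unique:
  assumes "generic x" "x \<notin> bad_start" "G13 x (fold_s x) w = 0"
  shows "w = fold_w x"
proof -
  note s = fold_s[OF assms(1,2)]
  define Z Y where "Z = d + x + fold_s x" and "Y = 1 + (d' + 1 / x) * fold_s x"
  have f: "Z * Y = 4 * fold_s x" using s(1) unfolding fold_at_def Z_def Y_def by simp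
  have "Y * w^2 - Z * Y * w + fold_s x * Z = 0"
    using assms(3) unfolding G_as_quadratic_v Z_def Y_def by (simp add: algebra_simps)
  hence "Y * (2 * w - Z)^2 = 0" using f by algebra
  moreover have "Y \<noteq> 0" using s(2) unfolding Y_def .
  ultimately have "2 * w = Z" by simp
  thus ?thesis using s(5) unfolding Z_def by simp
qed

text \<open>
  All conditions on the second point refer to limit values \<open>v\<close> that are determined by the first point.
\<close>

definition separated :: "complex set \<Rightarrow> complex \<Rightarrow> complex \<Rightarrow> complex \<Rightarrow> complex \<Rightarrow> bool" where
  "separated bad_v x1 y1 x2 y2 \<longleftrightarrow> generic x1 \<and> generic y1 \<and> generic x2 \<and> generic y2 \<and> x1 \<notin> bad_start \<and> fold_w x1 \<notin> bad_w bad_v y1 \<and>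
     (\<forall>v. G12 x1 (fold_s x1) v = 0 \<longrightarrow> x2 \<notin> bad_x v) \<and>
     (\<forall>t v. G13 y1 t (fold_w x1) = 0 \<longrightarrow> G12 y1 t v = 0 \<longrightarrow> y2 \<notin> bad_y v)"

text \<open>
  The values of \<open>s\<close> that extend to a complex solution of the cycle of eight relations.
\<close>

definition common_starts :: "complex \<Rightarrow> complex \<Rightarrow> complex \<Rightarrow> complex \<Rightarrow> complex set" where
  "common_starts x1 y1 x2 y2 = {s. \<exists>w1 t1 v' v s2 w2 t2.
     G13 x1 s w1 = 0 \<and> G13 y1 t1 w1 = 0 \<and> G12 y1 t1 v' = 0 \<and> G12 x1 s v = 0 \<and>
     G12 x2 s2 v = 0 \<and> G13 x2 s2 w2 = 0 \<and> G12 y2 t2 v' = 0 \<and> G13 y2 t2 w2 = 0}"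

end

text \<open>
  The variables \<open>s, w1, t1, v', v, s2, w2, t2\<close> are introduced in this order, each by a quadratic equation over
  an earlier one, and the cycle is closed by the relation between \<open>t2\<close> and \<open>w2\<close>.  The order is chosen so
  that both \<open>v\<close> and \<open>v'\<close> have limits determined by the first point alone: only then is the set of second
  points that violate regularity bounded in terms of the first.
\<close>

lemma few_common_curves:
  "\<exists>D. \<forall>p p' d d' bad_v x1 y1 x2 y2. three_points p p' d d' \<longrightarrow>
     three_points.separated p p' d d' bad_v x1 y1 x2 y2 \<longrightarrow> few D (three_points.common_starts p p' d d' x1 y1 x2 y2)"
proof -
  obtain D where D: "eliminates 7 4 D"
    using eliminate_tower[of 7 4] ..
  show ?thesis
  proof (intro exI[of _ D] allI impI)
    fix p p' d d' bad_v x1 y1 x2 y2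
    assume tp: "three_points p p' d d'"
    interpret three_points p p' d d' by fact
    assume gap: "separated bad_v x1 y1 x2 y2"
    hence g: "generic x1" "generic y1" "generic x2" "generic y2" and x1: "x1 \<notin> bad_start" and y1: "fold_w x1 \<notin> bad_w bad_v y1"
      and x2: "\<forall>v. G12 x1 (fold_s x1) v = 0 \<longrightarrow> x2 \<notin> bad_x v"
      and y2: "\<forall>t v. G13 y1 t (fold_w x1) = 0 \<longrightarrow> G12 y1 t v = 0 \<longrightarrow> y2 \<notin> bad_y v"
      unfolding separated_def by blast+
    let ?S = "common_starts x1 y1 x2 y2"
    note ss = fold_s[OF g(1) x1]
    \<comment> \<open>Entry \<open>k\<close> of each list belongs to the variable \<open>e k\<close>; the entries for \<open>k = 0\<close> are padding.\<close>
    define \<kappa> where "\<kappa> = (!) [True, True, False, True, True, False, True, False]"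
    define A where "A = (!) [0, d + x1, d + y1, p + y1, p + x1, p + x2, d + x2, p + y2]"
    define B where "B = (!) [0, d' + 1 / x1, d' + 1 / y1, p' + 1 / y1, p' + 1 / x1, p' + 1 / x2, d' + 1 / x2, p' + 1 / y2]"
    define src :: "nat \<Rightarrow> nat" where "src = (!) [0, 0, 1, 2, 0, 4, 5, 3]"
    define a where "a k e = edgeA (\<kappa> k) (B k) (e (src k))" for k and e :: "nat \<Rightarrow> complex"
    define b where "b k e = edgeB (\<kappa> k) (A k) (B k) (e (src k))" for k and e :: "nat \<Rightarrow> complex"
    define c where "c k e = edgeC (\<kappa> k) (A k) (e (src k))" for k and e :: "nat \<Rightarrow> complex"
    note tower_data = \<kappa>_def A_def B_def src_def
    have idx: "k = 1 \<or> k = 2 \<or> k = 3 \<or> k = 4 \<or> k = 5 \<or> k = 6 \<or> k = 7" if "k \<in> {1..7}" for k :: nat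
      using that by auto
    have src: "src k < k" if "k \<in> {1..7}" for k
      using idx[OF that] unfolding src_def by auto
    have abc: "polyfn k 2 (a k) \<and> polyfn k 2 (b k) \<and> polyfn k 2 (c k)" if "k \<in> {1..7}" for k
      unfolding a_def[abs_def] b_def[abs_def] c_def[abs_def] using polyfn_edge[OF src[OF that]] by blast
    have root: "a 1 e * e 1^2 + b 1 e * e 1 + c 1 e = 0 \<longleftrightarrow> G13 x1 (e 0) (e 1) = 0"
      "a 2 e * e 2^2 + b 2 e * e 2 + c 2 e = 0 \<longleftrightarrow> G13 y1 (e 2) (e 1) = 0"
      "a 3 e * e 3^2 + b 3 e * e 3 + c 3 e = 0 \<longleftrightarrow> G12 y1 (e 2) (e 3) = 0"
      "a 4 e * e 4^2 + b 4 e * e 4 + c 4 e = 0 \<longleftrightarrow> G12 x1 (e 0) (e 4) = 0"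
      "a 5 e * e 5^2 + b 5 e * e 5 + c 5 e = 0 \<longleftrightarrow> G12 x2 (e 5) (e 4) = 0"
      "a 6 e * e 6^2 + b 6 e * e 6 + c 6 e = 0 \<longleftrightarrow> G13 x2 (e 5) (e 6) = 0"
      "a 7 e * e 7^2 + b 7 e * e 7 + c 7 e = 0 \<longleftrightarrow> G12 y2 (e 7) (e 3) = 0" for e
      unfolding a_def b_def c_def tower_data by (simp_all add: edge_eq)
    define F where "F = (\<lambda>e::nat \<Rightarrow> complex. G13 y2 (e 7) (e 6))"
    have F: "polyfn (Suc 7) 4 F" unfolding F_def by (rule polyfn_G[of 7 "Suc 7" 6]) simp_all
    have "\<forall>k\<in>{1..7}. polyfn k 2 (a k) \<and> polyfn k 2 (b k) \<and> polyfn k 2 (c k)" using abc by blast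
    from D[unfolded eliminates_def, THEN spec, THEN spec, THEN spec, THEN spec, THEN mp, THEN mp, OF this F]
    obtain N where N: "polyfn 1 D (N 1)" "N (Suc 7) = F"
       "\<forall>e. (\<forall>k\<in>{1..7}. a k e * e k^2 + b k e * e k + c k e = 0) \<longrightarrow> F e = 0 \<longrightarrow> N 1 e = 0"
       and Nstep: "\<forall>k\<in>{1..7}. \<forall>e. N k e = 0 \<longrightarrow> a k e \<noteq> 0 \<longrightarrow>
           (\<exists>y. a k e * y^2 + b k e * y + c k e = 0 \<and> N (Suc k) (e(k := y)) = 0)" by (elim exE conjE) blast
    have lead: "a k e \<noteq> 0" if k: "k \<in> {1..7}" and e0: "e 0 = fold_s x1"
      and path: "\<And>i. i \<in> {1..<k} \<Longrightarrow> a i e * e i^2 + b i e * e i + c i e = 0" for k e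
    proof -
      have w: "e 1 = fold_w x1" if "k > 1" using fold_w_unique[OF g(1) x1] root(1)[of e] path[of 1] that e0 by simp
      have t: "G13 y1 (e 2) (fold_w x1) = 0" if "k > 2" using root(2)[of e] path[of 2] that w by simp
      have v': "G12 y1 (e 2) (e 3) = 0" if "k > 3" using root(3)[of e] path[of 3] that by simp
      have v: "G12 x1 (fold_s x1) (e 4) = 0" if "k > 4" using root(4)[of e] path[of 4] that e0 by simp
      have s2: "G12 x2 (e 5) (e 4) = 0" if "k > 5" using root(5)[of e] path[of 5] that by simp
      note nX = not_bad_x[OF g(3), of "e 4"]
      consider "k = 1" | "k = 2" | "k = 3" | "k = 4" | "k = 5" | "k = 6" | "k = 7" using idx[OF k] by blast
      thus ?thesis
      proof cases
        case 1 thus ?thesis using ss(2) e0 unfolding a_def tower_data by (simp add: edgeA_def)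
      next
        case 2 thus ?thesis using not_bad_w(1)[OF g(2) y1] w unfolding a_def tower_data by (simp add: edgeA_def)
      next
        case 3 thus ?thesis using not_bad_w(3)[OF g(2) y1 t] unfolding a_def tower_data by (simp add: edgeA_def)
      next
        case 4 thus ?thesis using ss(6) e0 unfolding a_def tower_data by (simp add: edgeA_def)
      next
        case 5 thus ?thesis using nX(1) x2 v ss(7) unfolding a_def tower_data by (simp add: edgeA_def)
      next
        case 6 thus ?thesis using nX(3) x2 v ss(7) s2 unfolding a_def tower_data by (simp add: edgeA_def)
      next
        case 7 thus ?thesis using not_bad_y(1)[OF g(4), of "e 3"] y2 t v' unfolding a_def tower_data by (simp add: edgeA_def)
      qed
    qed
    show "few D ?S"
    proof (rule ccontr)
      assume nf: "\<not> few D ?S"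
      have "?S \<subseteq> {s. \<exists>e. e 0 = s \<and> N 1 e = 0}"
      proof
        fix s assume "s \<in> ?S"
        then obtain w1 t1 v' v s2 w2 t2 where sol: "G13 x1 s w1 = 0" "G13 y1 t1 w1 = 0" "G12 y1 t1 v' = 0"
          "G12 x1 s v = 0" "G12 x2 s2 v = 0" "G13 x2 s2 w2 = 0" "G12 y2 t2 v' = 0" "G13 y2 t2 w2 = 0" unfolding common_starts_def by blast
        define e where "e = (!) [s, w1, t1, v', v, s2, w2, t2]"
        have e: "e 0 = s" "e 1 = w1" "e 2 = t1" "e 3 = v'" "e 4 = v" "e 5 = s2" "e 6 = w2" "e 7 = t2"
          unfolding e_def by simp_all
        have roots: "a 1 e * e 1^2 + b 1 e * e 1 + c 1 e = 0" "a 2 e * e 2^2 + b 2 e * e 2 + c 2 e = 0"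
          "a 3 e * e 3^2 + b 3 e * e 3 + c 3 e = 0" "a 4 e * e 4^2 + b 4 e * e 4 + c 4 e = 0"
          "a 5 e * e 5^2 + b 5 e * e 5 + c 5 e = 0" "a 6 e * e 6^2 + b 6 e * e 6 + c 6 e = 0"
          "a 7 e * e 7^2 + b 7 e * e 7 + c 7 e = 0"
          unfolding root unfolding e by (rule sol)+
        have "\<forall>k\<in>{1..7}. a k e * e k^2 + b k e * e k + c k e = 0"
        proof
          fix k :: nat assume "k \<in> {1..7}"
          from idx[OF this] show "a k e * e k^2 + b k e * e k + c k e = 0"
            by (elim disjE) (simp_all only: roots)
        qed
        moreover have "F e = 0" unfolding F_def e by (rule sol(8))
        ultimately have "N 1 e = 0" using N(3) by blast
        thus "s \<in> {s. \<exists>e. e 0 = s \<and> N 1 e = 0}" using e(1) by blast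
      qed
      hence "\<not> few D {s. \<exists>e. e 0 = s \<and> N 1 e = 0}" using nf few_mono by blast
      hence N1: "N 1 e = 0" for e using polyfn_1_roots[OF N(1)] unfolding few_def by blast
      \<comment> \<open>\<open>E\<close> is a sequence of solutions and \<open>e\<close> its limit, lying over the fold.\<close>
      obtain E e where E: "e 0 = fold_s x1" "\<forall>n. E n 0 \<noteq> fold_s x1" "\<forall>i\<le>7. (\<lambda>n. E n i) \<longlonglongrightarrow> e i"
        "\<forall>i\<in>{1..7}. a i e * e i^2 + b i e * e i + c i e = 0"
        "\<forall>n. \<forall>i\<in>{1..7}. a i (E n) * E n i^2 + b i (E n) * E n i + c i (E n) = 0" "\<forall>n. N (Suc 7) (E n) = 0"
        using tower_limit[where m = 7 and a = a and b = b and c = c and N = N and \<sigma> = "fold_s x1", OF abc N1 _ lead] Nstep by blast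
      have e: "G13 x1 (e 0) (e 1) = 0" "G13 y1 (e 2) (e 1) = 0" "G12 y1 (e 2) (e 3) = 0"
        "G12 x1 (e 0) (e 4) = 0" "G12 x2 (e 5) (e 4) = 0" "G13 x2 (e 5) (e 6) = 0" "G12 y2 (e 7) (e 3) = 0"
        using E(4) root[of e] by simp_all
      have En: "G13 x1 (E n 0) (E n 1) = 0" "G13 y1 (E n 2) (E n 1) = 0" "G12 y1 (E n 2) (E n 3) = 0"
        "G12 x1 (E n 0) (E n 4) = 0" "G12 x2 (E n 5) (E n 4) = 0" "G13 x2 (E n 5) (E n 6) = 0" "G12 y2 (E n 7) (E n 3) = 0" for n
        using E(5)[THEN spec, of n] root[of "E n"] by simp_all
      have En8: "G13 y2 (E n 7) (E n 6) = 0" for n using E(6) unfolding N(2) F_def by blast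
      have L: "(\<lambda>n. E n i) \<longlonglongrightarrow> e i" if "i \<le> 7" for i using E(3) that by blast
      have "(\<lambda>n. F (E n)) \<longlonglongrightarrow> F e" by (rule polyfn_tendsto[OF F]) (use L in simp)
      hence e8: "G13 y2 (e 7) (e 6) = 0" using En8 LIMSEQ_unique[OF _ tendsto_const] unfolding F_def by simp
      have w: "e 1 = fold_w x1" using fold_w_unique[OF g(1) x1] e(1) E(1) by simp
      have v: "G12 x1 (fold_s x1) (e 4) = 0" using e(4) E(1) by simp
      note nX = not_bad_x[OF g(3) x2[rule_format, OF v]]
      have t: "G13 y1 (e 2) (fold_w x1) = 0" using e(2) w by simp
      note nW = not_bad_w[OF g(2) y1]
      note nY = not_bad_y[OF g(4) y2[rule_format, OF t e(3)]]
      show False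
      proof (rule no_cycle_near_fold[where ?s1.0 = "\<lambda>n. E n 0" and ?w1.0 = "\<lambda>n. E n 1" and ?t1.0 = "\<lambda>n. E n 2" and v' = "\<lambda>n. E n 3"
            and v = "\<lambda>n. E n 4" and ?s2.0 = "\<lambda>n. E n 5" and ?w2.0 = "\<lambda>n. E n 6" and ?t2.0 = "\<lambda>n. E n 7",
            OF En(1) En(2) En(3) En(4) En(5) En(6) En(7) En8 _ _ _ _ _ _ _ _ e(1) e(2) e(3) e(4) e(5) e(6) e(7) e8])
        show "d + x1 + e 0 = 2 * e 1" "Gs13 x1 (e 0) (e 1) \<noteq> 0" unfolding E(1) w by (rule ss(5), rule ss(4))
        show "Gv12 x1 (e 0) (e 4) \<noteq> 0" unfolding E(1) using ss(7)[OF v] by blast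
        show "Gs12 x2 (e 5) (e 4) \<noteq> 0" "Gv13 x2 (e 5) (e 6) \<noteq> 0" using nX ss(7)[OF v] e by blast+
        show "Gs13 y2 (e 7) (e 6) \<noteq> 0" "Gv12 y2 (e 7) (e 3) \<noteq> 0" using nY e(7) e8 by blast+
        show "Gs12 y1 (e 2) (e 3) \<noteq> 0" using nW(4)[OF t e(3)] by blast
        show "Gv13 y1 (e 2) (e 1) \<noteq> 0" unfolding w by (rule nW(2)[OF t])
        show "E n 0 \<noteq> e 0" for n using E(1,2) by simp
      qed (simp_all add: L)
    qed
  qed
qed

section \<open>Incidences in a cell decomposition\<close>

text \<open>
  The blocks consist of \<open>k\<close> consecutive elements of \<open>R\<close>, and \<open>C\<close> collects the least element of each block.
\<close>

lemma few_rank_blocks: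
  fixes R :: "real set"
  assumes "few n R" "k \<ge> 1"
  shows "\<exists>blk :: real \<Rightarrow> nat. \<exists>C. few (n div k + 1) C \<and> (\<forall>j. few k {r\<in>R. blk r = j}) \<and>
     (\<forall>a\<in>R. \<forall>b\<in>R. a < b \<longrightarrow> blk a \<noteq> blk b \<longrightarrow> (\<exists>c\<in>C. a < c \<and> c \<le> b))"
proof -
  have R: "finite R" "card R \<le> n" using assms(1) by (auto simp: few_def)
  define rank where "rank r = card {r'\<in>R. r' < r}" for r
  have mono: "rank a < rank b" if "a \<in> R" "b \<in> R" "a < b" for a b
    unfolding rank_def using that R(1) by (intro psubset_card_mono) auto
  have inj: "inj_on rank R" by (intro linorder_inj_onI') (metis mono less_irrefl)
  have lt: "rank r < card R" if "r \<in> R" for r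
    unfolding rank_def using that R(1) by (intro psubset_card_mono) auto
  have "rank ` R = {..<card R}"
    using lt inj by (intro card_subset_eq) (auto simp: card_image)
  hence surj: "\<exists>r\<in>R. rank r = i" if "i < card R" for i using that by (metis imageE lessThan_iff)
  define C where "C = {c\<in>R. k dvd rank c}"
  have "few (n div k + 1) C"
  proof -
    have "inj_on (\<lambda>c. rank c div k) C"
    proof (rule inj_onI)
      fix x y assume xy: "x \<in> C" "y \<in> C" "rank x div k = rank y div k"
      hence "rank x = rank y" unfolding C_def by (metis (mono_tags, lifting) dvd_div_mult_self mem_Collect_eq)
      thus "x = y" using inj xy unfolding C_def inj_on_def by blast
    qed
    moreover have "(\<lambda>c. rank c div k) ` C \<subseteq> {..<n div k + 1}"
    proof (rule image_subsetI)
      fix c assume "c \<in> C"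
      hence "rank c \<le> n" using lt R(2) unfolding C_def by fastforce
      thus "rank c div k \<in> {..<n div k + 1}" by (simp add: div_le_mono less_Suc_eq_le)
    qed
    ultimately have "card C \<le> card {..<n div k + 1}" by (intro card_inj_on_le) auto
    thus ?thesis unfolding few_def C_def using R(1) by simp
  qed
  moreover have "few k {r\<in>R. rank r div k = j}" for j
  proof -
    have "inj_on rank {r\<in>R. rank r div k = j}" using inj by (rule inj_on_subset) auto
    moreover have "rank ` {r\<in>R. rank r div k = j} \<subseteq> {j * k..<j * k + k}"
    proof (rule image_subsetI)
      fix r assume r: "r \<in> {r\<in>R. rank r div k = j}"
      have "rank r = rank r div k * k + rank r mod k" by simp
      moreover have "rank r mod k < k" using assms(2) by simp
      ultimately have "rank r div k * k \<le> rank r" "rank r < rank r div k * k + k" by linarith+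
      moreover have "rank r div k = j" using r by blast
      ultimately show "rank r \<in> {j * k..<j * k + k}" unfolding atLeastLessThan_iff by (metis (no_types))
    qed
    ultimately have "card {r\<in>R. rank r div k = j} \<le> card {j * k..<j * k + k}" by (intro card_inj_on_le) auto
    thus ?thesis unfolding few_def using R(1) by simp
  qed
  moreover have "\<exists>c\<in>C. a < c \<and> c \<le> b" if ab: "a \<in> R" "b \<in> R" "a < b" "rank a div k \<noteq> rank b div k" for a b
  proof -
    define i where "i = k * (rank b div k)"
    have "i \<le> rank b" unfolding i_def by simp
    have "rank a div k < rank b div k" using mono[OF ab(1-3)] ab(4) by (meson div_le_mono le_neq_implies_less less_imp_le)
    hence "rank a < i" unfolding i_def using assms(2) by (simp add: div_less_iff_less_mult mult.commute)
    obtain c where c: "c \<in> R" "rank c = i" using surj[of i] lt[OF ab(2)] \<open>i \<le> rank b\<close> by auto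
    have "a < c" using mono[of c a] \<open>rank a < i\<close> c ab(1) by (metis linorder_neqE_linordered_idom not_less_iff_gr_or_eq)
    moreover have "c \<le> b" using mono[of b c] \<open>i \<le> rank b\<close> c ab(2) by (metis not_le)
    moreover have "c \<in> C" unfolding C_def using c by (simp add: i_def)
    ultimately show ?thesis by blast
  qed
  ultimately show ?thesis by - (rule exI[of _ "\<lambda>r. rank r div k"], rule exI[of _ C], blast)
qed

text \<open>
  Between two parameters with equally many elements of \<open>H\<close> to the left there is none in between.  So off
  \<open>H\<close> the value of \<open>F\<close> depends only on that number.
\<close>

lemma few_crossings:
  fixes H S :: "real set"
  assumes "few h H" "\<And>\<theta> \<theta>'. \<theta> \<in> S \<Longrightarrow> \<theta>' \<in> S \<Longrightarrow> \<theta> < \<theta>' \<Longrightarrow> {\<theta>..\<theta>'} \<inter> H = {} \<Longrightarrow> F \<theta> = F \<theta>'"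
  shows "few (2 * h + 1) (F ` S)"
proof -
  have H: "finite H" "card H \<le> h" using assms(1) by (auto simp: few_def)
  define N where "N \<theta> = card {x\<in>H. x < \<theta>}" for \<theta>
  define g where "g m = F (SOME \<theta>. \<theta> \<in> S - H \<and> N \<theta> = m)" for m
  have same: "F \<theta> = F \<theta>'" if "\<theta> \<in> S - H" "\<theta>' \<in> S - H" "\<theta> < \<theta>'" "N \<theta> = N \<theta>'" for \<theta> \<theta>'
  proof (rule assms(2))
    have sub: "{x\<in>H. x < \<theta>} \<subseteq> {x\<in>H. x < \<theta>'}" using that(3) by auto
    hence eq: "{x\<in>H. x < \<theta>} = {x\<in>H. x < \<theta>'}" using that(4) H(1) unfolding N_def by (intro card_subset_eq) auto
    show "{\<theta>..\<theta>'} \<inter> H = {}"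
    proof (rule ccontr)
      assume "{\<theta>..\<theta>'} \<inter> H \<noteq> {}"
      then obtain x where x: "x \<in> H" "\<theta> \<le> x" "x \<le> \<theta>'" by auto
      hence "x < \<theta>'" using that(2) by (metis DiffE order_le_less)
      hence "x \<in> {x\<in>H. x < \<theta>}" using x(1) unfolding eq by blast
      thus False using x(2) by simp
    qed
  qed (use that in auto)
  have "F \<theta> = g (N \<theta>)" if "\<theta> \<in> S - H" for \<theta>
  proof -
    define \<theta>0 where "\<theta>0 = (SOME \<theta>'. \<theta>' \<in> S - H \<and> N \<theta>' = N \<theta>)"
    have "\<exists>\<theta>'. \<theta>' \<in> S - H \<and> N \<theta>' = N \<theta>" using that by blast
    hence "\<theta>0 \<in> S - H \<and> N \<theta>0 = N \<theta>" unfolding \<theta>0_def by (rule someI_ex)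
    hence t: "\<theta>0 \<in> S - H" "N \<theta>0 = N \<theta>" by blast+
    have "F \<theta> = F \<theta>0"
    proof (rule linorder_cases[of \<theta> \<theta>0])
      assume "\<theta> < \<theta>0" thus ?thesis by (rule same[OF that t(1) _ t(2)[symmetric]])
    next
      assume "\<theta>0 < \<theta>" thus ?thesis by (rule same[OF t(1) that _ t(2), symmetric])
    qed (rule arg_cong[of _ _ F])
    thus ?thesis unfolding g_def \<theta>0_def .
  qed
  moreover have "N \<theta> \<le> h" for \<theta>
  proof -
    have "N \<theta> \<le> card H" unfolding N_def using H(1) by (intro card_mono) auto
    thus ?thesis using H(2) by simp
  qed
  ultimately have "F ` (S - H) \<subseteq> g ` {..h}" by auto
  hence 1: "few (h + 1) (F ` (S - H))"
    by (intro few_mono[OF few_image[of "h + 1" "{..h}" g]]) (auto simp: few_def)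
  have 2: "few h (F ` (S \<inter> H))" by (rule few_image[OF few_mono[OF assms(1)]]) auto
  show ?thesis by (rule few_mono[OF few_Un[OF 1 2]]) auto
qed

text \<open>
  If \<open>k\<close> points of a cell lie on a curve, then either \<open>k \<le> K\<close> or there are at least \<open>k * (k - K) \<ge> k\<close> ordered pairs
  of them that are not bad.  The first case contributes \<open>K\<close> per visited cell; the pairs are counted through
  \<open>common\<close>, each at most \<open>D\<close> times.
\<close>

lemma incidences_in_cells:
  fixes inc :: "'p \<Rightarrow> 'c \<Rightarrow> bool" and cell :: "'p \<Rightarrow> 'q"
  assumes P: "finite P" and \<Gamma>: "finite \<Gamma>"
    and visit: "\<And>\<gamma>. \<gamma> \<in> \<Gamma> \<Longrightarrow> few L (cell ` {x\<in>P. inc x \<gamma>})"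
    and bad: "\<And>x \<gamma>. x \<in> P \<Longrightarrow> \<gamma> \<in> \<Gamma> \<Longrightarrow> inc x \<gamma> \<Longrightarrow> few K {y\<in>P. inc y \<gamma> \<and> bad x y}"
    and common: "\<And>x y. x \<in> P \<Longrightarrow> y \<in> P \<Longrightarrow> \<not> bad x y \<Longrightarrow> few D {\<gamma>\<in>\<Gamma>. inc x \<gamma> \<and> inc y \<gamma>}"
    and cells: "\<And>c. few M {x\<in>P. cell x = c}"
  shows "card {(x, \<gamma>). x \<in> P \<and> \<gamma> \<in> \<Gamma> \<and> inc x \<gamma>} \<le> card \<Gamma> * (L * K) + card P * M * D"
proof -
  define pts where "pts \<gamma> c = {x\<in>P. inc x \<gamma> \<and> cell x = c}" for \<gamma> c
  define prs where "prs \<gamma> c = {(x, y). x \<in> pts \<gamma> c \<and> y \<in> pts \<gamma> c \<and> \<not> bad x y}" for \<gamma> c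
  define prs' where "prs' \<gamma> = {(x, y). x \<in> P \<and> y \<in> P \<and> inc x \<gamma> \<and> inc y \<gamma> \<and> cell x = cell y \<and> \<not> bad x y}" for \<gamma>
  have fin: "finite (pts \<gamma> c)" for \<gamma> c unfolding pts_def using P by simp
  have finp: "finite (prs \<gamma> c)" for \<gamma> c
    by (rule finite_subset[of _ "pts \<gamma> c \<times> pts \<gamma> c"]) (auto simp: prs_def fin)
  have finp': "finite (prs' \<gamma>)" for \<gamma>
    by (rule finite_subset[of _ "P \<times> P"]) (auto simp: prs'_def P)
  have one: "card (pts \<gamma> c) \<le> K + card (prs \<gamma> c)" if "\<gamma> \<in> \<Gamma>" for \<gamma> c
  proof (cases "card (pts \<gamma> c) \<le> K")
    case False
    have "card (pts \<gamma> c) - K \<le> card {y\<in>pts \<gamma> c. \<not> bad x y}" if x: "x \<in> pts \<gamma> c" for x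
    proof -
      have "few K {y\<in>pts \<gamma> c. bad x y}"
        by (rule few_mono[OF bad[of x \<gamma>]]) (use x \<open>\<gamma> \<in> \<Gamma>\<close> in \<open>auto simp: pts_def\<close>)
      hence "card {y\<in>pts \<gamma> c. bad x y} \<le> K" by (simp add: few_def)
      moreover have "card (pts \<gamma> c) \<le> card {y\<in>pts \<gamma> c. bad x y} + card {y\<in>pts \<gamma> c. \<not> bad x y}"
      proof -
        have "pts \<gamma> c = {y\<in>pts \<gamma> c. bad x y} \<union> {y\<in>pts \<gamma> c. \<not> bad x y}" by auto
        thus ?thesis using card_Un_le by metis
      qed
      ultimately show ?thesis by simp
    qed
    hence ge1: "1 \<le> card {y\<in>pts \<gamma> c. \<not> bad x y}" if "x \<in> pts \<gamma> c" for x
      using False that by (metis diff_is_0_eq less_one not_le le_0_eq)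
    have "card (pts \<gamma> c) = (\<Sum>x\<in>pts \<gamma> c. 1)" by simp
    also have "\<dots> \<le> (\<Sum>x\<in>pts \<gamma> c. card {y\<in>pts \<gamma> c. \<not> bad x y})"
      by (intro sum_mono ge1)
    also have "\<dots> = card (SIGMA x:pts \<gamma> c. {y\<in>pts \<gamma> c. \<not> bad x y})" using fin by simp
    also have "(SIGMA x:pts \<gamma> c. {y\<in>pts \<gamma> c. \<not> bad x y}) = prs \<gamma> c" unfolding prs_def by auto
    finally show ?thesis by simp
  qed simp
  have two: "card {x\<in>P. inc x \<gamma>} \<le> L * K + card (prs' \<gamma>)" if \<gamma>: "\<gamma> \<in> \<Gamma>" for \<gamma>
  proof -
    let ?C = "cell ` {x\<in>P. inc x \<gamma>}"
    have fC: "finite ?C" "card ?C \<le> L" using visit[OF \<gamma>] by (auto simp: few_def)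
    have "card {x\<in>P. inc x \<gamma>} \<le> card (\<Union>c\<in>?C. pts \<gamma> c)" using fC fin by (intro card_mono finite_UN_I) (auto simp: pts_def)
    also have "\<dots> \<le> (\<Sum>c\<in>?C. card (pts \<gamma> c))" using fC by (intro card_UN_le)
    also have "\<dots> \<le> (\<Sum>c\<in>?C. K + card (prs \<gamma> c))" by (intro sum_mono one \<gamma>)
    also have "\<dots> = card ?C * K + (\<Sum>c\<in>?C. card (prs \<gamma> c))" by (simp add: sum.distrib)
    also have "(\<Sum>c\<in>?C. card (prs \<gamma> c)) = card (\<Union>c\<in>?C. prs \<gamma> c)"
      using fC finp by (intro card_UN_disjoint[symmetric]) (auto simp: prs_def pts_def)
    also have "\<dots> \<le> card (prs' \<gamma>)" using finp' by (intro card_mono) (auto simp: prs_def pts_def prs'_def)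
    finally show ?thesis using fC(2) by (meson add_mono le_refl mult_le_mono order_trans)
  qed
  have "{(x, \<gamma>). x \<in> P \<and> \<gamma> \<in> \<Gamma> \<and> inc x \<gamma>} = prod.swap ` (SIGMA \<gamma>:\<Gamma>. {x\<in>P. inc x \<gamma>})" by force
  hence "card {(x, \<gamma>). x \<in> P \<and> \<gamma> \<in> \<Gamma> \<and> inc x \<gamma>} = card (SIGMA \<gamma>:\<Gamma>. {x\<in>P. inc x \<gamma>})"
    by (simp only: card_image[OF inj_swap])
  also have "\<dots> = (\<Sum>\<gamma>\<in>\<Gamma>. card {x\<in>P. inc x \<gamma>})" using P \<Gamma> by simp
  also have "\<dots> \<le> (\<Sum>\<gamma>\<in>\<Gamma>. L * K + card (prs' \<gamma>))" by (intro sum_mono two)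
  also have "\<dots> = card \<Gamma> * (L * K) + (\<Sum>\<gamma>\<in>\<Gamma>. card (prs' \<gamma>))" by (simp add: sum.distrib)
  also have "(\<Sum>\<gamma>\<in>\<Gamma>. card (prs' \<gamma>)) = card (SIGMA \<gamma>:\<Gamma>. prs' \<gamma>)" using \<Gamma> finp' by simp
  also have "\<dots> \<le> card P * M * D"
  proof -
    let ?Q = "SIGMA x:P. {y\<in>P. cell y = cell x}"
    have Q: "few (card P * M) ?Q"
    proof -
      have "card ?Q = (\<Sum>x\<in>P. card {y\<in>P. cell y = cell x})" using P by simp
      also have "\<dots> \<le> (\<Sum>x\<in>P. M)" using cells by (intro sum_mono) (simp add: few_def)
      finally show ?thesis using P by (auto simp: few_def)
    qed
    let ?f = "\<lambda>(x, y). if bad x y then {} else (\<lambda>\<gamma>. (\<gamma>, x, y)) ` {\<gamma>\<in>\<Gamma>. inc x \<gamma> \<and> inc y \<gamma>}"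
    have "few (card P * M * D) (SIGMA \<gamma>:\<Gamma>. prs' \<gamma>)"
    proof (rule few_UN_subset[OF Q])
      fix i assume "i \<in> ?Q"
      thus "few D (?f i)" using common by (auto simp: few_empty intro!: few_image)
    next
      show "(SIGMA \<gamma>:\<Gamma>. prs' \<gamma>) \<subseteq> (\<Union>i\<in>?Q. ?f i)"
      proof
        fix z assume "z \<in> (SIGMA \<gamma>:\<Gamma>. prs' \<gamma>)"
        then obtain \<gamma> x y where z: "z = (\<gamma>, x, y)" and g: "\<gamma> \<in> \<Gamma>" and xy: "(x, y) \<in> prs' \<gamma>" by auto
        have "(x, y) \<in> ?Q" "z \<in> ?f (x, y)" using g xy unfolding prs'_def z by auto
        thus "z \<in> (\<Union>i\<in>?Q. ?f i)" by blast
      qed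
    qed
    thus ?thesis by (simp add: few_def)
  qed
  finally show ?thesis by simp
qed

section \<open>Real branches of the curves and the cells they visit\<close>

lemma inverse_unit: "cmod x = 1 \<Longrightarrow> 1 / x = cnj x"
  by (metis complex_norm_square divide_eq_eq mult.commute norm_zero of_real_1 power_one zero_neq_one)

lemma few_unit_circle:
  assumes "\<alpha> \<noteq> 0 \<or> \<rho> \<noteq> 1"
  shows "few 2 {\<tau>. cmod \<tau> = 1 \<and> cmod (\<alpha> + \<tau>) = \<rho>}"
proof (cases "\<alpha> = 0")
  case True
  hence "{\<tau>. cmod \<tau> = 1 \<and> cmod (\<alpha> + \<tau>) = \<rho>} = {}" using assms by auto
  thus ?thesis by (simp only: few_empty)
next
  case False
  show ?thesis
  proof (rule few_quadratic_subset[where \<alpha> = "cnj \<alpha>" and \<beta> = "\<alpha> * cnj \<alpha> + 1 - of_real (\<rho>^2)" and \<gamma> = \<alpha>])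
    fix \<tau> assume "\<tau> \<in> {\<tau>. cmod \<tau> = 1 \<and> cmod (\<alpha> + \<tau>) = \<rho>}"
    hence t: "\<tau> * cnj \<tau> = 1" "(\<alpha> + \<tau>) * cnj (\<alpha> + \<tau>) = of_real (\<rho>^2)"
      using complex_norm_square[of \<tau>] complex_norm_square[of "\<alpha> + \<tau>"] by simp_all
    have "cnj (\<alpha> + \<tau>) = cnj \<alpha> + cnj \<tau>" by simp
    thus "cnj \<alpha> * \<tau>\<^sup>2 + (\<alpha> * cnj \<alpha> + 1 - of_real (\<rho>^2)) * \<tau> + \<alpha> = 0" using t by algebra
  qed (use False in simp)
qed

lemma few_unit_circle':
  assumes "\<alpha> \<noteq> 0 \<or> \<rho> \<noteq> 1"
  shows "few 2 {\<tau>. cmod \<tau> = 1 \<and> cmod (\<alpha> - \<tau>) = \<rho>}"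
proof -
  have "cmod (\<alpha> - \<tau>) = cmod (- \<alpha> + \<tau>)" for \<tau> by (metis minus_diff_eq norm_minus_cancel uminus_add_conv_diff add.commute)
  thus ?thesis using few_unit_circle[of "- \<alpha>" \<rho>] assms by simp
qed

lemma few_unit_with_Re: "few 2 {x. cmod x = 1 \<and> Re x = c}"
proof (rule few_quadratic_subset[where \<alpha> = 1 and \<beta> = "of_real (- 2 * c)" and \<gamma> = 1])
  fix x assume "x \<in> {x. cmod x = 1 \<and> Re x = c}"
  hence "x * cnj x = 1" "x + cnj x = of_real (2 * c)"
    using complex_norm_square[of x] complex_add_cnj[of x] by simp_all
  moreover have "complex_of_real (- 2 * c) = - of_real (2 * c)" by simp
  ultimately show "1 * x\<^sup>2 + of_real (- 2 * c) * x + 1 = 0" by algebra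
qed simp

text \<open>
  For \<open>0 < cmod E \<le> 2\<close> and \<open>\<sigma> = \<plusminus>1\<close>, the two ways of writing \<open>E\<close> as a sum of two unit numbers.  The formula
  is continuous in \<open>E \<noteq> 0\<close>, which is all that is needed of the branches.
\<close>

definition unit_summand :: "complex \<Rightarrow> complex \<Rightarrow> complex" where
  "unit_summand E \<sigma> = E * (1 / 2 + \<sigma> * \<i> * of_real (sqrt (1 / (cmod E)^2 - 1 / 4)))"

lemma unit_summand_exists:
  assumes "cmod a = 1" "cmod (E - a) = 1" "E \<noteq> 0"
  shows "cmod E \<le> 2" "\<exists>\<sigma>\<in>{1, -1}. a = unit_summand E \<sigma>"
proof -
  show "cmod E \<le> 2" using norm_triangle_ineq[of a "E - a"] assms by simp
  define r where "r = a / E"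
  have a: "a = E * r" unfolding r_def using assms by simp
  have r1: "(cmod r)^2 = 1 / (cmod E)^2" unfolding r_def using assms by (simp add: norm_divide power_divide)
  have "E - a = E * (1 - r)" by (subst a) (simp add: algebra_simps)
  hence "cmod E * cmod (1 - r) = 1" using assms(2) norm_mult by metis
  hence "cmod (1 - r) = 1 / cmod E" using assms(3) by (simp add: field_simps)
  hence r2: "(cmod (1 - r))^2 = 1 / (cmod E)^2" by (simp add: power_divide)
  have "(cmod (1 - r))^2 = 1 - 2 * Re r + (cmod r)^2" unfolding cmod_power2 by (simp add: power2_eq_square algebra_simps)
  hence re: "Re r = 1 / 2" using r1 r2 by simp
  hence "(Im r)^2 = 1 / (cmod E)^2 - 1 / 4" using r1 unfolding cmod_power2[of r] re by (simp add: power_divide)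
  hence "sqrt (1 / (cmod E)^2 - 1 / 4) = \<bar>Im r\<bar>" by (metis real_sqrt_abs)
  hence im: "Im r = sqrt (1 / (cmod E)^2 - 1 / 4) \<or> Im r = - sqrt (1 / (cmod E)^2 - 1 / 4)" by linarith
  have "r = of_real (Re r) + \<i> * of_real (Im r)" by (rule complex_eq)
  hence "r = 1 / 2 + 1 * \<i> * of_real (sqrt (1 / (cmod E)^2 - 1 / 4)) \<or> r = 1 / 2 + (-1) * \<i> * of_real (sqrt (1 / (cmod E)^2 - 1 / 4))"
    using im re by (auto simp: complex_eq_iff)
  thus "\<exists>\<sigma>\<in>{1, -1}. a = unit_summand E \<sigma>" unfolding unit_summand_def a by blast
qed

lemma unit_summand_unit:
  assumes "E \<noteq> 0" "cmod E \<le> 2" "\<sigma> \<in> {1, -1}"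
  shows "cmod (unit_summand E \<sigma>) = 1" "cmod (E - unit_summand E \<sigma>) = 1"
proof -
  let ?R = "sqrt (1 / (cmod E)^2 - 1 / 4)"
  have "(cmod E)^2 \<le> 2^2" using assms(2) by (intro power_mono) auto
  hence R: "?R^2 = 1 / (cmod E)^2 - 1 / 4" using assms(1) by (simp add: field_simps)
  have "(cmod (1 / 2 + \<sigma> * \<i> * of_real x))^2 = 1 / 4 + x^2" "(cmod (1 / 2 - \<sigma> * \<i> * of_real x))^2 = 1 / 4 + x^2" for x
    using assms(3) by (auto simp: cmod_power2 power_divide)
  from this[of ?R] have n: "(cmod (1 / 2 + \<sigma> * \<i> * of_real ?R))^2 = 1 / (cmod E)^2"
    "(cmod (1 / 2 - \<sigma> * \<i> * of_real ?R))^2 = 1 / (cmod E)^2"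
    unfolding R by simp_all
  have "E - unit_summand E \<sigma> = E * (1 / 2 - \<sigma> * \<i> * of_real ?R)" unfolding unit_summand_def by (simp add: algebra_simps)
  hence "(cmod (unit_summand E \<sigma>))^2 = 1" "(cmod (E - unit_summand E \<sigma>))^2 = 1"
    using n assms(1) unfolding unit_summand_def by (simp_all only: norm_mult power_mult_distrib) simp_all
  thus "cmod (unit_summand E \<sigma>) = 1" "cmod (E - unit_summand E \<sigma>) = 1" by (simp_all add: power2_eq_1_iff) (smt (verit) norm_ge_zero)+
qed

lemma continuous_on_unit_summand:
  assumes "continuous_on S f" "\<And>x. x \<in> S \<Longrightarrow> f x \<noteq> 0"
  shows "continuous_on S (\<lambda>x. unit_summand (f x) \<sigma>)"
  unfolding unit_summand_def using assms by (intro continuous_intros) auto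

lemma few_angles:
  assumes "few k A" shows "few k {\<theta>. 0 \<le> \<theta> \<and> \<theta> < 2 * pi \<and> cis \<theta> \<in> A}"
proof (rule few_mono[OF few_image[OF assms, of Arg2pi]])
  show "{\<theta>. 0 \<le> \<theta> \<and> \<theta> < 2 * pi \<and> cis \<theta> \<in> A} \<subseteq> Arg2pi ` A"
  proof
    fix \<theta> assume t: "\<theta> \<in> {\<theta>. 0 \<le> \<theta> \<and> \<theta> < 2 * pi \<and> cis \<theta> \<in> A}"
    hence "Arg2pi (cis \<theta>) = \<theta>" by (intro Arg2pi_unique[of 1]) (auto simp: cis_conv_exp)
    thus "\<theta> \<in> Arg2pi ` A" using t by force
  qed
qed simp

lemma continuous_stays_below:
  fixes f :: "real \<Rightarrow> real"
  assumes "continuous_on {a..b} f" "f a < c" "\<And>t. t \<in> {a..b} \<Longrightarrow> f t \<noteq> c" "t \<in> {a..b}"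
  shows "f t < c"
proof (rule ccontr)
  assume "\<not> f t < c"
  moreover have "continuous_on {a..t} f" using assms by (intro continuous_on_subset[OF assms(1)]) auto
  ultimately have "\<exists>x. a \<le> x \<and> x \<le> t \<and> f x = c" using assms(2,4) by (intro IVT') auto
  thus False using assms(3,4) by force
qed

text \<open>
  Along a curve, \<open>w\<close> runs over the unit circle.  It determines the point of intersection with the circle \<open>v\<close> up
  to one sign, and the point determines \<open>x\<close> up to a second sign.  Here \<open>gap\<close> is the vector between the centres of
  the circles \<open>v\<close> and \<open>w\<close>, \<open>branch_z\<close> the vector from \<open>p1\<close> to the point, and \<open>branch_x\<close> the parameter \<open>x\<close>.
\<close>

context
  fixes p d :: complex
begin

definition gap :: "complex \<Rightarrow> complex \<Rightarrow> complex" where "gap v w = w - v - (d - p)"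
definition branch_z :: "complex \<Rightarrow> complex \<Rightarrow> complex \<Rightarrow> complex" where "branch_z v \<sigma> w = v - p + unit_summand (gap v w) \<sigma>"
definition real_branch :: "complex \<Rightarrow> complex \<Rightarrow> complex \<Rightarrow> bool" where
  "real_branch v \<sigma> w \<longleftrightarrow> cmod (gap v w) \<le> 2 \<and> cmod (branch_z v \<sigma> w) \<le> 2"
definition branch_x :: "complex \<Rightarrow> complex \<Rightarrow> complex \<Rightarrow> complex \<Rightarrow> complex" where
  "branch_x v \<sigma> \<sigma>' w = unit_summand (branch_z v \<sigma> w) \<sigma>'"
text \<open>
  Where a branch can begin or end, or where the real part of \<open>x\<close> meets one of the dividing values \<open>C\<close>.
\<close>

definition critical :: "real set \<Rightarrow> complex \<Rightarrow> complex \<Rightarrow> complex \<Rightarrow> complex set" where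
  "critical C v \<sigma> \<sigma>' = {w. cmod w = 1 \<and> (cmod (gap v w) = 2 \<or> cmod (gap v w) \<le> 2 \<and> cmod (branch_z v \<sigma> w) = 2 \<or>
     real_branch v \<sigma> w \<and> Re (branch_x v \<sigma> \<sigma>' w) \<in> C)}"

definition goodv :: "complex \<Rightarrow> bool" where
  "goodv v \<longleftrightarrow> cmod v = 1 \<and> cmod (v - p) \<noteq> 1 \<and> cmod (v + (d - p)) \<noteq> 1"

lemma gap_nz: "goodv v \<Longrightarrow> cmod w = 1 \<Longrightarrow> gap v w \<noteq> 0"
proof
  assume v: "goodv v" "cmod w = 1" and "gap v w = 0"
  hence "w = v + (d - p)" unfolding gap_def by (simp add: algebra_simps)
  thus False using v unfolding goodv_def by simp
qed

lemma branch_z_nz: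
  assumes "goodv v" "cmod w = 1" "cmod (gap v w) \<le> 2" "\<sigma> \<in> {1, -1}"
  shows "branch_z v \<sigma> w \<noteq> 0"
proof
  assume "branch_z v \<sigma> w = 0"
  hence "v - p = - unit_summand (gap v w) \<sigma>" unfolding branch_z_def by (simp add: add_eq_0_iff2)
  hence "cmod (v - p) = 1" using unit_summand_unit(1)[OF gap_nz[OF assms(1,2)] assms(3,4)] by simp
  thus False using assms(1) unfolding goodv_def by simp
qed

lemma few_w_of_tau:
  assumes "goodv v" "cmod \<tau> = 1"
  shows "few 2 {w. cmod w = 1 \<and> cmod (gap v w - \<tau>) = 1}"
proof -
  have "v + (d - p) + \<tau> \<noteq> 0"
  proof
    assume "v + (d - p) + \<tau> = 0"
    hence "v + (d - p) = - \<tau>" by (simp add: add_eq_0_iff2)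
    thus False using assms unfolding goodv_def by simp
  qed
  hence "few 2 {w. cmod w = 1 \<and> cmod (- (v + (d - p) + \<tau>) + w) = 1}"
    by (intro few_unit_circle) (simp only: neg_equal_0_iff_equal simp_thms)
  moreover have "- (v + (d - p) + \<tau>) + w = gap v w - \<tau>" for w unfolding gap_def by simp
  ultimately show ?thesis by (simp only:)
qed

lemma few_critical:
  assumes v: "goodv v" and s: "\<sigma> \<in> {1, -1}" "\<sigma>' \<in> {1, -1}" and C: "few m C"
  shows "few (6 + 8 * m) (critical C v \<sigma> \<sigma>')"
proof -
  let ?T = "\<lambda>w. unit_summand (gap v w) \<sigma>"
  have tau: "cmod (?T w) = 1" "cmod (gap v w - ?T w) = 1" if "cmod w = 1" "cmod (gap v w) \<le> 2" for w
    using unit_summand_unit[OF gap_nz[OF v that(1)] that(2) s(1)] by auto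
  have 1: "few 2 {w. cmod w = 1 \<and> cmod (gap v w) = 2}"
  proof -
    have "gap v w = - (v + (d - p)) + w" for w unfolding gap_def by simp
    thus ?thesis using few_unit_circle[of "- (v + (d - p))" 2] by simp
  qed
  have 2: "few (2 * 2) {w. cmod w = 1 \<and> cmod (gap v w) \<le> 2 \<and> cmod (branch_z v \<sigma> w) = 2}"
  proof (rule few_UN_subset[where S = "\<lambda>\<tau>. {w. cmod w = 1 \<and> cmod (gap v w - \<tau>) = 1}"])
    show "few 2 {\<tau>. cmod \<tau> = 1 \<and> cmod (v - p + \<tau>) = 2}" by (rule few_unit_circle) simp
    show "few 2 {w. cmod w = 1 \<and> cmod (gap v w - \<tau>) = 1}" if "\<tau> \<in> {\<tau>. cmod \<tau> = 1 \<and> cmod (v - p + \<tau>) = 2}" for \<tau>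
      using few_w_of_tau[OF v] that by simp
    show "{w. cmod w = 1 \<and> cmod (gap v w) \<le> 2 \<and> cmod (branch_z v \<sigma> w) = 2} \<subseteq>
       (\<Union>\<tau>\<in>{\<tau>. cmod \<tau> = 1 \<and> cmod (v - p + \<tau>) = 2}. {w. cmod w = 1 \<and> cmod (gap v w - \<tau>) = 1})"
      using tau unfolding branch_z_def by blast
  qed
  have 3: "few (m * (2 * (2 * 2))) {w. cmod w = 1 \<and> real_branch v \<sigma> w \<and> Re (branch_x v \<sigma> \<sigma>' w) \<in> C}"
  proof (rule few_UN_subset[OF C, where S = "\<lambda>c. \<Union>x\<in>{x. cmod x = 1 \<and> Re x = c}.
        \<Union>\<tau>\<in>{\<tau>. cmod \<tau> = 1 \<and> cmod (v - p - x + \<tau>) = 1}. {w. cmod w = 1 \<and> cmod (gap v w - \<tau>) = 1}"])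
    fix c
    show "few (2 * (2 * 2)) (\<Union>x\<in>{x. cmod x = 1 \<and> Re x = c}.
        \<Union>\<tau>\<in>{\<tau>. cmod \<tau> = 1 \<and> cmod (v - p - x + \<tau>) = 1}. {w. cmod w = 1 \<and> cmod (gap v w - \<tau>) = 1})"
    proof (intro few_UN[OF few_unit_with_Re] few_UN)
      fix x assume "x \<in> {x. cmod x = 1 \<and> Re x = c}"
      hence "v - p - x \<noteq> 0" using v unfolding goodv_def by auto
      thus "few 2 {\<tau>. cmod \<tau> = 1 \<and> cmod (v - p - x + \<tau>) = 1}" by (intro few_unit_circle) simp
    qed (use few_w_of_tau[OF v] in simp)
  next
    show "{w. cmod w = 1 \<and> real_branch v \<sigma> w \<and> Re (branch_x v \<sigma> \<sigma>' w) \<in> C} \<subseteq> (\<Union>c\<in>C. \<Union>x\<in>{x. cmod x = 1 \<and> Re x = c}.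
        \<Union>\<tau>\<in>{\<tau>. cmod \<tau> = 1 \<and> cmod (v - p - x + \<tau>) = 1}. {w. cmod w = 1 \<and> cmod (gap v w - \<tau>) = 1})"
    proof
      fix w assume "w \<in> {w. cmod w = 1 \<and> real_branch v \<sigma> w \<and> Re (branch_x v \<sigma> \<sigma>' w) \<in> C}"
      hence w: "cmod w = 1" "cmod (gap v w) \<le> 2" "cmod (branch_z v \<sigma> w) \<le> 2" "Re (branch_x v \<sigma> \<sigma>' w) \<in> C"
        unfolding real_branch_def by auto
      have x: "cmod (branch_x v \<sigma> \<sigma>' w) = 1" "cmod (branch_z v \<sigma> w - branch_x v \<sigma> \<sigma>' w) = 1"
        using unit_summand_unit[OF branch_z_nz[OF v w(1,2) s(1)] w(3) s(2)] unfolding branch_x_def by auto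
      have zx: "branch_z v \<sigma> w - branch_x v \<sigma> \<sigma>' w = v - p - branch_x v \<sigma> \<sigma>' w + ?T w" unfolding branch_z_def by simp
      have "?T w \<in> {\<tau>. cmod \<tau> = 1 \<and> cmod (v - p - branch_x v \<sigma> \<sigma>' w + \<tau>) = 1}"
        using x(2) tau(1)[OF w(1,2)] unfolding zx by blast
      thus "w \<in> (\<Union>c\<in>C. \<Union>x\<in>{x. cmod x = 1 \<and> Re x = c}.
        \<Union>\<tau>\<in>{\<tau>. cmod \<tau> = 1 \<and> cmod (v - p - x + \<tau>) = 1}. {w. cmod w = 1 \<and> cmod (gap v w - \<tau>) = 1})"
        using x(1) w(1,4) tau(2)[OF w(1,2)] by blast
    qed
  qed
  show ?thesis unfolding critical_def by (rule few_mono[OF few_Un[OF few_Un[OF 1 2] 3]]) auto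
qed

text \<open>
  By the intermediate value theorem the branch exists on the whole interval and its real part does not
  cross a dividing value.
\<close>

lemma same_block:
  assumes v: "goodv v" and s: "\<sigma> \<in> {1, -1}" "\<sigma>' \<in> {1, -1}"
    and th: "\<theta> < \<theta>'" "real_branch v \<sigma> (cis \<theta>)" "\<And>t. t \<in> {\<theta>..\<theta>'} \<Longrightarrow> cis t \<notin> critical C v \<sigma> \<sigma>'"
    and R: "Re (branch_x v \<sigma> \<sigma>' (cis \<theta>)) \<in> R" "Re (branch_x v \<sigma> \<sigma>' (cis \<theta>')) \<in> R"
    and blk: "\<And>a b. a \<in> R \<Longrightarrow> b \<in> R \<Longrightarrow> a < b \<Longrightarrow> blk a \<noteq> blk b \<Longrightarrow> \<exists>c\<in>C. a < c \<and> c \<le> b"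
  shows "blk (Re (branch_x v \<sigma> \<sigma>' (cis \<theta>))) = blk (Re (branch_x v \<sigma> \<sigma>' (cis \<theta>')))"
proof -
  let ?I = "{\<theta>..\<theta>'}"
  have c1: "continuous_on ?I (\<lambda>t. gap v (cis t))" unfolding gap_def by (intro continuous_intros)
  have c2: "continuous_on ?I (\<lambda>t. branch_z v \<sigma> (cis t))" unfolding branch_z_def
    by (intro continuous_intros continuous_on_unit_summand c1) (use gap_nz[OF v] in simp)
  have s2: "cmod (gap v (cis t)) < 2" if "t \<in> ?I" for t
  proof (rule continuous_stays_below[of \<theta> \<theta>' "\<lambda>t. cmod (gap v (cis t))", OF _ _ _ that])
    show "continuous_on ?I (\<lambda>t. cmod (gap v (cis t)))" by (intro continuous_intros c1)
    show ne: "cmod (gap v (cis t)) \<noteq> 2" if "t \<in> ?I" for t using th(3)[OF that] unfolding critical_def by auto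
    show "cmod (gap v (cis \<theta>)) < 2" using ne[of \<theta>] th(1,2) unfolding real_branch_def by fastforce
  qed
  have z2: "cmod (branch_z v \<sigma> (cis t)) < 2" if "t \<in> ?I" for t
  proof (rule continuous_stays_below[of \<theta> \<theta>' "\<lambda>t. cmod (branch_z v \<sigma> (cis t))", OF _ _ _ that])
    show "continuous_on ?I (\<lambda>t. cmod (branch_z v \<sigma> (cis t)))" by (intro continuous_intros c2)
    show ne: "cmod (branch_z v \<sigma> (cis t)) \<noteq> 2" if "t \<in> ?I" for t using th(3)[OF that] s2[OF that] unfolding critical_def by auto
    show "cmod (branch_z v \<sigma> (cis \<theta>)) < 2" using ne[of \<theta>] th(1,2) unfolding real_branch_def by fastforce
  qed
  have z0: "branch_z v \<sigma> (cis t) \<noteq> 0" if "t \<in> ?I" for t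
    using branch_z_nz[OF v _ _ s(1), of "cis t"] s2[OF that] by simp
  define f where "f t = Re (branch_x v \<sigma> \<sigma>' (cis t))" for t
  have cf: "continuous_on ?I f" unfolding f_def branch_x_def
    by (intro continuous_intros continuous_on_unit_summand c2) (use z0 in auto)
  have fC: "f t \<notin> C" if "t \<in> ?I" for t
    using th(3)[OF that] s2[OF that] z2[OF that] unfolding critical_def real_branch_def f_def by auto
  have "blk (f \<theta>) = blk (f \<theta>')"
  proof (rule ccontr)
    assume ne: "blk (f \<theta>) \<noteq> blk (f \<theta>')"
    hence "f \<theta> < f \<theta>' \<or> f \<theta>' < f \<theta>" by (metis linorder_neqE_linordered_idom)
    then obtain c where c: "c \<in> C" "f \<theta> < c \<and> c \<le> f \<theta>' \<or> f \<theta>' < c \<and> c \<le> f \<theta>"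
      using blk[OF R] blk[OF R(2,1)] ne unfolding f_def by metis
    have "\<exists>t. \<theta> \<le> t \<and> t \<le> \<theta>' \<and> f t = c"
      using c(2) IVT'[OF _ _ _ cf, of c] IVT2'[OF _ _ _ cf, of c] th(1) by (meson less_imp_le)
    thus False using fC c(1) by auto
  qed
  thus ?thesis unfolding f_def .
qed

text \<open>
  Sixteen sign choices cover the curve, and each gives continuous arcs away from its critical parameters.
\<close>

lemma few_cells_of_curve:
  assumes v: "goodv v" "goodv v'" and U: "\<And>x. x \<in> U \<Longrightarrow> cmod x = 1" and C: "few m C"
    and blk: "\<And>a b. a \<in> Re ` U \<Longrightarrow> b \<in> Re ` U \<Longrightarrow> a < b \<Longrightarrow> blk a \<noteq> blk b \<Longrightarrow> \<exists>c\<in>C. a < c \<and> c \<le> b"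
  shows "few (16 * (2 * (12 + 16 * m) + 1)) ((\<lambda>(x, y). (blk (Re x), blk (Re y))) ` {(x, y). x \<in> U \<and> y \<in> U \<and>
     (\<exists>w s t. cmod w = 1 \<and> cmod s = 1 \<and> cmod t = 1 \<and> cmod (p + x + s - v) = 1 \<and> cmod (d + x + s - w) = 1 \<and>
        cmod (p + y + t - v') = 1 \<and> cmod (d + y + t - w) = 1)})"
    (is "few _ (?cell ` ?P)")
proof -
  let ?pm = "{1, -1 :: complex}"
  let ?X = "\<lambda>(a, b, a', b') \<theta>. (branch_x v a b (cis \<theta>), branch_x v' a' b' (cis \<theta>))"
  let ?S = "\<lambda>(a, b, a', b'). {\<theta>. 0 \<le> \<theta> \<and> \<theta> < 2 * pi \<and> real_branch v a (cis \<theta>) \<and> real_branch v' a' (cis \<theta>) \<and>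
     branch_x v a b (cis \<theta>) \<in> U \<and> branch_x v' a' b' (cis \<theta>) \<in> U}"
  have branch: "\<exists>a\<in>?pm. \<exists>b\<in>?pm. real_branch v a w \<and> x = branch_x v a b w"
    if v: "goodv v" and w: "cmod w = 1" and x: "cmod x = 1" and s: "cmod s = 1" "cmod (p + x + s - v) = 1" "cmod (d + x + s - w) = 1" for v w x s
  proof -
    have "cmod (gap v w - (p + x + s - v)) = 1"
    proof -
      have "gap v w - (p + x + s - v) = - (d + x + s - w)" unfolding gap_def by simp
      thus ?thesis using s(3) by (metis norm_minus_cancel)
    qed
    from unit_summand_exists[OF s(2) this gap_nz[OF v w]] obtain a where a: "a \<in> ?pm" "p + x + s - v = unit_summand (gap v w) a"
      and sl: "cmod (gap v w) \<le> 2" by blast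
    have z: "branch_z v a w = x + s" unfolding branch_z_def a(2)[symmetric] by simp
    hence "cmod (branch_z v a w - x) = 1" using s(1) by simp
    from unit_summand_exists[OF x this branch_z_nz[OF v w sl a(1)]] obtain b where "b \<in> ?pm" "x = branch_x v a b w" "cmod (branch_z v a w) \<le> 2"
      unfolding branch_x_def by blast
    thus ?thesis using a(1) sl unfolding real_branch_def by blast
  qed
  have pm: "few 2 ?pm" by (simp add: few_def)
  have "few (2 * (2 * (2 * 2))) (?pm \<times> ?pm \<times> ?pm \<times> ?pm)" by (simp add: few_def card_cartesian_product)
  hence pm4: "few 16 (?pm \<times> ?pm \<times> ?pm \<times> ?pm)" by simp
  show ?thesis
  proof (rule few_UN_subset[OF pm4, where S = "\<lambda>i. (\<lambda>\<theta>. ?cell (?X i \<theta>)) ` ?S i"])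
    fix i assume i: "i \<in> ?pm \<times> ?pm \<times> ?pm \<times> ?pm"
    obtain a b a' b' where i': "i = (a, b, a', b')" by (cases i)
    have pm: "a \<in> ?pm" "b \<in> ?pm" "a' \<in> ?pm" "b' \<in> ?pm" using i unfolding i' by auto
    let ?H = "{\<theta>. 0 \<le> \<theta> \<and> \<theta> < 2 * pi \<and> cis \<theta> \<in> critical C v a b \<union> critical C v' a' b'}"
    have H: "few (12 + 16 * m) ?H"
      by (rule few_mono[OF few_angles[OF few_Un[OF few_critical[OF v(1) pm(1,2) C] few_critical[OF v(2) pm(3,4) C]]]]) auto
    show "few (2 * (12 + 16 * m) + 1) ((\<lambda>\<theta>. ?cell (?X i \<theta>)) ` ?S i)"
    proof (rule few_crossings[OF H])
      fix \<theta> \<theta>' assume t: "\<theta> \<in> ?S i" "\<theta>' \<in> ?S i" "\<theta> < \<theta>'" "{\<theta>..\<theta>'} \<inter> ?H = {}"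
      have nc: "cis t \<notin> critical C v a b \<and> cis t \<notin> critical C v' a' b'" if "t \<in> {\<theta>..\<theta>'}" for t
        using t that unfolding i' by fastforce
      have U1: "Re (branch_x v a b (cis \<theta>)) \<in> Re ` U" "Re (branch_x v a b (cis \<theta>')) \<in> Re ` U"
        and U2: "Re (branch_x v' a' b' (cis \<theta>)) \<in> Re ` U" "Re (branch_x v' a' b' (cis \<theta>')) \<in> Re ` U"
        and val: "real_branch v a (cis \<theta>)" "real_branch v' a' (cis \<theta>)" using t(1,2) unfolding i' by auto
      have "blk (Re (branch_x v a b (cis \<theta>))) = blk (Re (branch_x v a b (cis \<theta>')))"
        by (rule same_block[OF v(1) pm(1,2) t(3) val(1) _ U1 blk]) (use nc in auto)
      moreover have "blk (Re (branch_x v' a' b' (cis \<theta>))) = blk (Re (branch_x v' a' b' (cis \<theta>')))"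
        by (rule same_block[OF v(2) pm(3,4) t(3) val(2) _ U2 blk]) (use nc in auto)
      ultimately show "?cell (?X i \<theta>) = ?cell (?X i \<theta>')" unfolding i' by simp
    qed
  next
    show "?cell ` ?P \<subseteq> (\<Union>i\<in>?pm \<times> ?pm \<times> ?pm \<times> ?pm. (\<lambda>\<theta>. ?cell (?X i \<theta>)) ` ?S i)"
    proof (rule image_subsetI)
      fix P assume "P \<in> ?P"
      then obtain x y w s t where P: "P = (x, y)" and xy: "x \<in> U" "y \<in> U" and w: "cmod w = 1" and st: "cmod s = 1" "cmod t = 1"
        "cmod (p + x + s - v) = 1" "cmod (d + x + s - w) = 1" "cmod (p + y + t - v') = 1" "cmod (d + y + t - w) = 1" by blast
      obtain a b where ab: "a \<in> ?pm" "b \<in> ?pm" "real_branch v a w" "x = branch_x v a b w"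
        using branch[OF v(1) w U[OF xy(1)] st(1,3,4)] by blast
      obtain a' b' where ab': "a' \<in> ?pm" "b' \<in> ?pm" "real_branch v' a' w" "y = branch_x v' a' b' w"
        using branch[OF v(2) w U[OF xy(2)] st(2,5,6)] by blast
      define \<theta> where "\<theta> = Arg2pi w"
      have cis: "cis \<theta> = w" using Arg2pi_eq[of w] w unfolding \<theta>_def by (simp add: cis_conv_exp)
      have th: "0 \<le> \<theta>" "\<theta> < 2 * pi" unfolding \<theta>_def by (rule Arg2pi_ge_0, rule Arg2pi_lt_2pi)
      have "branch_x v a b (cis \<theta>) \<in> U" "branch_x v' a' b' (cis \<theta>) \<in> U"
        by (simp_all only: cis ab(4)[symmetric] ab'(4)[symmetric] xy)
      hence "\<theta> \<in> ?S (a, b, a', b')" using th ab(3) ab'(3) by (simp add: cis)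
      moreover have "?cell P = ?cell (?X (a, b, a', b') \<theta>)" unfolding P prod.case cis ab(4)[symmetric] ab'(4)[symmetric] ..
      moreover have "(a, b, a', b') \<in> ?pm \<times> ?pm \<times> ?pm \<times> ?pm" using ab(1,2) ab'(1,2) by blast
      ultimately show "?cell P \<in> (\<Union>i\<in>?pm \<times> ?pm \<times> ?pm \<times> ?pm. (\<lambda>\<theta>. ?cell (?X i \<theta>)) ` ?S i)" by blast
    qed
  qed
qed

end

section \<open>The incidence bound\<close>

context
  fixes p d :: complex
begin

text \<open>
  \<open>goodu\<close>, \<open>goodv\<close> and \<open>goodw\<close> exclude the circles of the three families that contain another base point.
  \<open>linked W x y v v'\<close> is the incidence of the point \<open>(x, y)\<close> with the curve \<open>(v, v')\<close>.
\<close>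

definition goodu :: "complex \<Rightarrow> bool" where
  "goodu x \<longleftrightarrow> cmod x = 1 \<and> cmod (p + x) \<noteq> 1 \<and> cmod (d + x) \<noteq> 1"
definition goodw :: "complex \<Rightarrow> bool" where
  "goodw w \<longleftrightarrow> cmod w = 1 \<and> cmod (w - d) \<noteq> 1 \<and> cmod (w - (d - p)) \<noteq> 1"
definition touch :: "complex \<Rightarrow> complex \<Rightarrow> complex \<Rightarrow> complex \<Rightarrow> bool" where
  "touch x s v w \<longleftrightarrow> cmod s = 1 \<and> cmod (p + x + s - v) = 1 \<and> cmod (d + x + s - w) = 1"
definition linked :: "complex set \<Rightarrow> complex \<Rightarrow> complex \<Rightarrow> complex \<Rightarrow> complex \<Rightarrow> bool" where
  "linked W x y v v' \<longleftrightarrow> (\<exists>w\<in>W. \<exists>s t. touch x s v w \<and> touch y t v' w)"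

lemma linked_sym: "linked W x y v v' \<longleftrightarrow> linked W y x v' v"
  unfolding linked_def by blast

lemma few_s_real:
  assumes "cmod x = 1" "goodv p d v"
  shows "few 2 {s. cmod s = 1 \<and> cmod (p + x + s - v) = 1}"
proof -
  have "p + x - v \<noteq> 0" using assms unfolding goodv_def by (metis add_diff_cancel_left' eq_iff_diff_eq_0)
  hence "few 2 {s. cmod s = 1 \<and> cmod ((p + x - v) + s) = 1}" by (intro few_unit_circle) simp
  moreover have "(p + x - v) + s = p + x + s - v" for s by simp
  ultimately show ?thesis by (simp only:)
qed

lemma few_t_real:
  assumes "cmod y = 1" "goodw w"
  shows "few 2 {t. cmod t = 1 \<and> cmod (d + y + t - w) = 1}"
proof -
  have "d + y - w \<noteq> 0" using assms unfolding goodw_def by (metis add_diff_cancel_left' eq_iff_diff_eq_0)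
  hence "few 2 {t. cmod t = 1 \<and> cmod ((d + y - w) + t) = 1}" by (intro few_unit_circle) simp
  moreover have "(d + y - w) + t = d + y + t - w" for t by simp
  ultimately show ?thesis by (simp only:)
qed

lemma few_v_real:
  assumes "goodu x" "cmod s = 1"
  shows "few 2 {v. cmod v = 1 \<and> cmod (p + x + s - v) = 1}" "few 2 {w. cmod w = 1 \<and> cmod (d + x + s - w) = 1}"
proof -
  have "p + x + s \<noteq> 0" "d + x + s \<noteq> 0" using assms unfolding goodu_def by (auto simp: add_eq_0_iff2)
  thus "few 2 {v. cmod v = 1 \<and> cmod (p + x + s - v) = 1}" "few 2 {w. cmod w = 1 \<and> cmod (d + x + s - w) = 1}"
    by (auto intro: few_unit_circle')
qed

lemma few_y_real:
  assumes "goodv p d v'" "cmod w = 1"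
  shows "few 4 {y. cmod y = 1 \<and> (\<exists>t. touch y t v' w)}"
proof -
  have "few (2 * 2) {y. cmod y = 1 \<and> (\<exists>t. touch y t v' w)}"
  proof (rule few_UN_subset[where I = "{\<tau>. cmod \<tau> = 1 \<and> cmod (v' + (d - p) - w + \<tau>) = 1}" and
        S = "\<lambda>\<tau>. {y. cmod y = 1 \<and> cmod (v' - p + \<tau> - y) = 1}"])
    have "v' + (d - p) - w \<noteq> 0" using assms unfolding goodv_def by auto
    thus "few 2 {\<tau>. cmod \<tau> = 1 \<and> cmod (v' + (d - p) - w + \<tau>) = 1}" by (intro few_unit_circle) simp
    fix \<tau> assume "\<tau> \<in> {\<tau>. cmod \<tau> = 1 \<and> cmod (v' + (d - p) - w + \<tau>) = 1}"
    hence "v' - p + \<tau> \<noteq> 0" using assms(1) unfolding goodv_def by (auto simp: add_eq_0_iff2)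
    thus "few 2 {y. cmod y = 1 \<and> cmod (v' - p + \<tau> - y) = 1}" by (intro few_unit_circle') simp
  next
    show "{y. cmod y = 1 \<and> (\<exists>t. touch y t v' w)} \<subseteq>
      (\<Union>\<tau>\<in>{\<tau>. cmod \<tau> = 1 \<and> cmod (v' + (d - p) - w + \<tau>) = 1}. {y. cmod y = 1 \<and> cmod (v' - p + \<tau> - y) = 1})"
    proof
      fix y assume "y \<in> {y. cmod y = 1 \<and> (\<exists>t. touch y t v' w)}"
      then obtain t where y: "cmod y = 1" and t: "cmod t = 1" "cmod (p + y + t - v') = 1" "cmod (d + y + t - w) = 1"
        unfolding touch_def by blast
      define \<tau> where "\<tau> = p + y + t - v'"
      have e: "v' + (d - p) - w + \<tau> = d + y + t - w" "v' - p + \<tau> - y = t" unfolding \<tau>_def by simp_all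
      have "cmod (v' + (d - p) - w + \<tau>) = 1" "cmod (v' - p + \<tau> - y) = 1" "cmod \<tau> = 1"
        unfolding e using t by (simp_all add: \<tau>_def)
      thus "y \<in> (\<Union>\<tau>\<in>{\<tau>. cmod \<tau> = 1 \<and> cmod (v' + (d - p) - w + \<tau>) = 1}. {y. cmod y = 1 \<and> cmod (v' - p + \<tau> - y) = 1})"
        using y by blast
    qed
  qed
  thus ?thesis by simp
qed

lemma few_y_linked:
  assumes W: "\<And>w. w \<in> W \<Longrightarrow> cmod w = 1" and x: "goodu x" and v: "goodv p d v" "goodv p d v'"
  shows "few 16 {y. cmod y = 1 \<and> linked W x y v v'}"
proof -
  have x1: "cmod x = 1" using x unfolding goodu_def by blast
  have "few (2 * (2 * 4)) (\<Union>s\<in>{s. cmod s = 1 \<and> cmod (p + x + s - v) = 1}.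
     \<Union>w\<in>{w. cmod w = 1 \<and> cmod (d + x + s - w) = 1}. {y. cmod y = 1 \<and> (\<exists>t. touch y t v' w)})"
    using few_s_real[OF x1 v(1)] few_v_real(2)[OF x] few_y_real[OF v(2)] by (intro few_UN) auto
  thus ?thesis
  proof (rule few_mono)
    show "{y. cmod y = 1 \<and> linked W x y v v'} \<subseteq> (\<Union>s\<in>{s. cmod s = 1 \<and> cmod (p + x + s - v) = 1}.
     \<Union>w\<in>{w. cmod w = 1 \<and> cmod (d + x + s - w) = 1}. {y. cmod y = 1 \<and> (\<exists>t. touch y t v' w)})"
      using W unfolding linked_def touch_def[of x] by blast
  qed simp
qed

text \<open>
  Each further parameter is determined by the previous one up to two choices, in the order \<open>s, v, w, t, v'\<close>.
\<close>

lemma few_curves_through: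
  assumes W: "\<And>w. w \<in> W \<Longrightarrow> goodw w" and V: "\<And>v. v \<in> V \<Longrightarrow> cmod v = 1" and x: "goodu x" and y: "goodu y" and S: "few k S"
  shows "few (k * 16) {(v, v'). v \<in> V \<and> v' \<in> V \<and> (\<exists>w\<in>W. \<exists>s t. s \<in> S \<and> touch x s v w \<and> touch y t v' w)}"
proof -
  have y1: "cmod y = 1" using y unfolding goodu_def by blast
  let ?f = "\<lambda>s. \<Union>v\<in>{v. cmod v = 1 \<and> cmod (p + x + s - v) = 1}. \<Union>w\<in>{w. goodw w \<and> cmod (d + x + s - w) = 1}.
      \<Union>t\<in>{t. cmod t = 1 \<and> cmod (d + y + t - w) = 1}. \<Union>v'\<in>{v'. cmod v' = 1 \<and> cmod (p + y + t - v') = 1}. {(v, v')}"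
  have "few (k * (2 * (2 * (2 * (2 * 1))))) {(v, v'). v \<in> V \<and> v' \<in> V \<and> (\<exists>w\<in>W. \<exists>s t. s \<in> S \<and> touch x s v w \<and> touch y t v' w)}"
  proof (rule few_UN_subset[where I = "S \<inter> {s. cmod s = 1}" and S = ?f])
    show "few k (S \<inter> {s. cmod s = 1})" by (rule few_mono[OF S]) auto
    fix s assume "s \<in> S \<inter> {s. cmod s = 1}"
    hence s: "cmod s = 1" by blast
    have w: "few 2 {w. goodw w \<and> cmod (d + x + s - w) = 1}"
      by (rule few_mono[OF few_v_real(2)[OF x s]]) (auto simp: goodw_def)
    show "few (2 * (2 * (2 * (2 * 1)))) (?f s)"
    proof (intro few_UN few_singleton few_v_real(1)[OF x s] w)
      fix w assume "w \<in> {w. goodw w \<and> cmod (d + x + s - w) = 1}"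
      thus "few 2 {t. cmod t = 1 \<and> cmod (d + y + t - w) = 1}" using few_t_real[OF y1] by blast
    next
      fix w t assume "t \<in> {t. cmod t = 1 \<and> cmod (d + y + t - w) = 1}"
      thus "few 2 {v'. cmod v' = 1 \<and> cmod (p + y + t - v') = 1}" using few_v_real(1)[OF y] by blast
    qed
  next
    show "{(v, v'). v \<in> V \<and> v' \<in> V \<and> (\<exists>w\<in>W. \<exists>s t. s \<in> S \<and> touch x s v w \<and> touch y t v' w)} \<subseteq> (\<Union>s\<in>S \<inter> {s. cmod s = 1}. ?f s)"
    proof
      fix z assume "z \<in> {(v, v'). v \<in> V \<and> v' \<in> V \<and> (\<exists>w\<in>W. \<exists>s t. s \<in> S \<and> touch x s v w \<and> touch y t v' w)}"
      then obtain v v' w s t where z: "z = (v, v')" and vw: "v \<in> V" "v' \<in> V" "w \<in> W" "s \<in> S" and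
        t: "touch x s v w" "touch y t v' w" by blast
      show "z \<in> (\<Union>s\<in>S \<inter> {s. cmod s = 1}. ?f s)" 
        using t W[OF vw(3)] V[OF vw(1)] V[OF vw(2)] vw(4) unfolding z touch_def by blast
    qed
  qed
  thus ?thesis by simp
qed

lemma few_curves_linked:
  assumes W: "\<And>w. w \<in> W \<Longrightarrow> goodw w" and V: "\<And>v. v \<in> V \<Longrightarrow> goodv p d v" and x: "goodu x" and y: "goodu y" and nV: "few n V"
  shows "few (n * 2 * 16) {(v, v'). v \<in> V \<and> v' \<in> V \<and> linked W x y v v'}"
proof -
  have x1: "cmod x = 1" using x unfolding goodu_def by blast
  have S: "few (n * 2) (\<Union>v\<in>V. {s. cmod s = 1 \<and> cmod (p + x + s - v) = 1})"
    by (rule few_UN[OF nV few_s_real[OF x1 V]])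
  have V1: "cmod v = 1" if "v \<in> V" for v using V[OF that] unfolding goodv_def by blast
  show ?thesis
  proof (rule few_mono[OF few_curves_through[OF W V1 x y S]])
    show "{(v, v'). v \<in> V \<and> v' \<in> V \<and> linked W x y v v'} \<subseteq> {(v, v'). v \<in> V \<and> v' \<in> V \<and>
       (\<exists>w\<in>W. \<exists>s t. s \<in> (\<Union>v\<in>V. {s. cmod s = 1 \<and> cmod (p + x + s - v) = 1}) \<and> touch x s v w \<and> touch y t v' w)}"
      unfolding linked_def touch_def by blast
  qed auto
qed

lemma touch_G:
  assumes "cmod x = 1" "cmod s = 1" "cmod v = 1" "cmod (c + x + s - v) = 1"
  shows "G (c + x) (cnj c + 1 / x) s v = 0"
proof -
  have u: "1 / x = cnj x" "1 / v = cnj v" using assms inverse_unit by blast+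
  have v: "v \<noteq> 0" using assms(3) by auto
  define z where "z = s + (c + x) - v"
  have ss: "s * cnj s = 1" using complex_norm_square[of s] assms(2) by simp
  have zz: "z * cnj z = 1" using complex_norm_square[of z] assms(4) by (simp add: z_def add_ac)
  have cz: "cnj z = cnj s + (cnj c + cnj x) - cnj v" unfolding z_def by simp
  have "1 + (cnj c + 1 / x - 1 / v) * s = s * cnj z" unfolding u cz using ss by algebra
  hence "(s + (c + x) - v) * (1 + (cnj c + 1 / x - 1 / v) * s) - s = 0"
    unfolding z_def[symmetric] using zz by algebra
  thus ?thesis unfolding G_eq_circle[OF v] by simp
qed

lemma goodu_generic:
  assumes "goodu x" "three_points p (cnj p) d (cnj d)"
  shows "three_points.generic p (cnj p) d (cnj d) x"
proof -
  interpret three_points p "cnj p" d "cnj d" by fact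
  have x: "cmod x = 1" "x \<noteq> 0" using assms(1) unfolding goodu_def by auto
  have "(c + x) * (cnj c + 1 / x) = of_real ((cmod (c + x))^2)" for c
    using complex_norm_square[of "c + x"] inverse_unit[OF x(1)] by simp
  moreover have "(cmod (c + x))^2 \<noteq> 1" if "cmod (c + x) \<noteq> 1" for c
    using that by (simp add: power2_eq_1_iff) (smt (verit) norm_ge_zero)
  ultimately show ?thesis using assms(1) x unfolding generic_def goodu_def
    by (metis of_real_eq_1_iff)
qed

end

definition admissible :: "nat \<Rightarrow> complex \<Rightarrow> complex \<Rightarrow> complex set \<Rightarrow> complex set \<Rightarrow> complex set \<Rightarrow> bool" where
  "admissible n p d U V W \<longleftrightarrow> p \<noteq> 0 \<and> d \<noteq> 0 \<and> p \<noteq> d \<and> few n U \<and> few n V \<and>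
     (\<forall>x\<in>U. goodu p d x) \<and> (\<forall>v\<in>V. goodv p d v) \<and> (\<forall>w\<in>W. goodw p d w)"

definition incidences ::
  "complex \<Rightarrow> complex \<Rightarrow> complex set \<Rightarrow> complex set \<Rightarrow> complex set \<Rightarrow> ((complex \<times> complex) \<times> (complex \<times> complex)) set" where
  "incidences p d U V W = {((x, y), (v, v')). x \<in> U \<and> y \<in> U \<and> v \<in> V \<and> v' \<in> V \<and> linked p d W x y v v'}"

text \<open>
  Points \<open>(x, y)\<close> at which the argument for \<open>few_common_curves\<close> cannot start number \<open>O(n)\<close> and account for \<open>O(n^2)\<close>
  incidences.  For the other points the hypotheses of \<open>incidences_in_cells\<close> hold; a second point is bad if
  one of its coordinates lies in a bounded set determined by the first point, and on a given curve one
  coordinate determines the other up to boundedly many choices.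
\<close>

lemma incidence_count:
  "\<exists>K D. \<forall>p d U V W n k. admissible n p d U V W \<longrightarrow> k \<ge> 1 \<longrightarrow>
     card (incidences p d U V W) \<le>
       n * n * (16 * (2 * (12 + 16 * (n div k + 1)) + 1) * K) + n * n * (k * 2 * (k * 2)) * D + n * 222 * (n * 2 * 16)"
proof -
  obtain D1 where D1: "\<forall>p p' d d'. three_points p p' d d' \<longrightarrow>
     (\<exists>bad_v. few 4 bad_v \<and> (\<forall>v. v \<notin> bad_v \<longrightarrow> few D1 (three_points.tangent_set p p' d d' v)))"
    using few_tangent ..
  obtain D2 where D2: "\<forall>p p' d d' bad_v x1 y1 x2 y2. three_points p p' d d' \<longrightarrow>
     three_points.separated p p' d d' bad_v x1 y1 x2 y2 \<longrightarrow> few D2 (three_points.common_starts p p' d d' x1 y1 x2 y2)"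
    using few_common_curves ..
  define K where "K = (2 * 13) * 16 + (2 * (2 * (5 + D1))) * 16"
  show ?thesis
  proof (rule exI[of _ K], rule exI[of _ "D2 * 16"], intro allI impI)
    fix p d U V W and n k :: nat
    assume adm: "admissible n p d U V W" and k: "k \<ge> 1"
    have pd: "p \<noteq> 0" "d \<noteq> 0" "p \<noteq> d" and nU: "few n U" and nV: "few n V" 
      and U0: "\<forall>x\<in>U. goodu p d x" and V0: "\<forall>v\<in>V. goodv p d v" and W0: "\<forall>w\<in>W. goodw p d w"
      using adm unfolding admissible_def by blast+
    have tp: "three_points p (cnj p) d (cnj d)" by unfold_locales (use pd in auto)
    interpret three_points p "cnj p" d "cnj d" by fact
    have U: "goodu p d x" "cmod x = 1" "generic x" if "x \<in> U" for x
      using U0 that goodu_generic[OF _ tp] by (auto simp: goodu_def)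
    have V: "goodv p d v" "cmod v = 1" if "v \<in> V" for v using V0 that by (auto simp: goodv_def)
    have W: "goodw p d w" "cmod w = 1" if "w \<in> W" for w using W0 that by (auto simp: goodw_def)
    obtain E where E: "few 4 E" "\<And>v. v \<notin> E \<Longrightarrow> few D1 (tangent_set v)" using D1 tp by blast
    \<comment> \<open>If \<open>2 * v = p\<close>, the envelope point \<open>p2 + 2 * v\<close> of \<open>v\<close> is \<open>p1\<close>, through which every circle \<open>y\<close> passes.\<close>
    define bad_v where "bad_v = insert (p / 2) E"
    have bad_v: "few 5 bad_v" using few_Un[OF few_singleton[of "p / 2"] E(1)] unfolding bad_v_def by simp
    define exc where "exc x y \<longleftrightarrow> x \<in> bad_start \<or> fold_w x \<in> bad_w bad_v y" for x y
    define P where "P = {(x, y). x \<in> U \<and> y \<in> U \<and> \<not> exc x y}"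
    define X where "X = {(x, y). x \<in> U \<and> y \<in> U \<and> exc x y}"
    define inc where "inc = (\<lambda>(x, y) (v, v'). linked p d W x y v v')"
    define bad where "bad = (\<lambda>(x1, y1) (x2, y2). (\<exists>v. G12 x1 (fold_s x1) v = 0 \<and> x2 \<in> bad_x v) \<or>
       (\<exists>t v. G13 y1 t (fold_w x1) = 0 \<and> G12 y1 t v = 0 \<and> y2 \<in> bad_y v))"
    have fU: "finite U" "card U \<le> n" and fV: "finite V" "card V \<le> n" using nU nV by (auto simp: few_def)
    have "few n (Re ` U)" by (rule few_image[OF nU])
    from few_rank_blocks[OF this k] obtain blk C where C: "few (n div k + 1) C" and
      blk: "\<forall>j. few k {r\<in>Re ` U. blk r = j}" 
      "\<forall>a\<in>Re ` U. \<forall>b\<in>Re ` U. a < b \<longrightarrow> (blk a :: nat) \<noteq> blk b \<longrightarrow> (\<exists>c\<in>C. a < c \<and> c \<le> b)" by blast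
    define cell where "cell = (\<lambda>(x, y). (blk (Re x), blk (Re y)))"
    let ?L = "16 * (2 * (12 + 16 * (n div k + 1)) + 1)"
    have X: "few (n * 222) X"
    proof (rule few_UN_subset[OF nU, where S = "\<lambda>y. (\<lambda>x. (x, y)) ` ({x. generic x \<and> x \<notin> bad_start \<and> fold_w x \<in> bad_w bad_v y} \<union> bad_start)"])
      fix y assume "y \<in> U"
      from few_Un[OF few_bad_pairs[OF U(3)[OF this] bad_v] few_bad_start]
      show "few 222 ((\<lambda>x. (x, y)) ` ({x. generic x \<and> x \<notin> bad_start \<and> fold_w x \<in> bad_w bad_v y} \<union> bad_start))" by (intro few_image) simp
    next
      show "X \<subseteq> (\<Union>y\<in>U. (\<lambda>x. (x, y)) ` ({x. generic x \<and> x \<notin> bad_start \<and> fold_w x \<in> bad_w bad_v y} \<union> bad_start))"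
        unfolding X_def exc_def using U(3) by blast
    qed
    have IX: "few (n * 222 * (n * 2 * 16)) {(z, \<gamma>). z \<in> X \<and> \<gamma> \<in> V \<times> V \<and> inc z \<gamma>}"
    proof (rule few_UN_subset[OF X, where S = "\<lambda>z. Pair z ` {(v, v'). v \<in> V \<and> v' \<in> V \<and> linked p d W (fst z) (snd z) v v'}"])
      fix z assume "z \<in> X"
      hence "goodu p d (fst z)" "goodu p d (snd z)" using U unfolding X_def by auto
      thus "few (n * 2 * 16) (Pair z ` {(v, v'). v \<in> V \<and> v' \<in> V \<and> linked p d W (fst z) (snd z) v v'})"
        by (intro few_image few_curves_linked W V nV)
    qed (auto simp: inc_def)
    have IP: "card {(z, \<gamma>). z \<in> P \<and> \<gamma> \<in> V \<times> V \<and> inc z \<gamma>} \<le> card (V \<times> V) * (?L * K) + card P * (k * 2 * (k * 2)) * (D2 * 16)"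
    proof (rule incidences_in_cells[where bad = bad and cell = cell])
      show "finite P" by (rule finite_subset[of _ "U \<times> U"]) (auto simp: P_def fU)
      show "finite (V \<times> V)" using fV by simp
    next
      fix \<gamma> assume "\<gamma> \<in> V \<times> V"
      then obtain v v' where g: "\<gamma> = (v, v')" "v \<in> V" "v' \<in> V" by auto
      have "few ?L (cell ` {(x, y). x \<in> U \<and> y \<in> U \<and>
         (\<exists>w s t. cmod w = 1 \<and> cmod s = 1 \<and> cmod t = 1 \<and> cmod (p + x + s - v) = 1 \<and> cmod (d + x + s - w) = 1 \<and>
        cmod (p + y + t - v') = 1 \<and> cmod (d + y + t - w) = 1)})"
        unfolding cell_def by (rule few_cells_of_curve[OF V(1)[OF g(2)] V(1)[OF g(3)] U(2) C]) (use blk(2) in blast)+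
      thus "few ?L (cell ` {z \<in> P. inc z \<gamma>})"
      proof (rule few_mono[OF _ image_mono])
        show "{z \<in> P. inc z \<gamma>} \<subseteq> {(x, y). x \<in> U \<and> y \<in> U \<and>
         (\<exists>w s t. cmod w = 1 \<and> cmod s = 1 \<and> cmod t = 1 \<and> cmod (p + x + s - v) = 1 \<and> cmod (d + x + s - w) = 1 \<and>
        cmod (p + y + t - v') = 1 \<and> cmod (d + y + t - w) = 1)}"
          unfolding P_def inc_def g linked_def touch_def using W(2) by blast
      qed simp
    next
      fix z \<gamma> assume z: "z \<in> P" and "\<gamma> \<in> V \<times> V"
      then obtain v0 v0' x1 y1 where g: "\<gamma> = (v0, v0')" "v0 \<in> V" "v0' \<in> V" and z': "z = (x1, y1)" "x1 \<in> U" "y1 \<in> U" 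
        and nE: "x1 \<notin> bad_start" "fold_w x1 \<notin> bad_w bad_v y1" unfolding P_def exc_def by auto
      let ?B1 = "\<Union>v\<in>{v. G12 x1 (fold_s x1) v = 0}. bad_x v"
      let ?B2 = "\<Union>t\<in>{t. G13 y1 t (fold_w x1) = 0}. \<Union>v\<in>{v. G12 y1 t v = 0}. bad_y v"
      have g1: "generic x1" "generic y1" using U z' by auto
      have ne1: "(p + x1) * (cnj p + 1 / x1) \<noteq> 1" "(p + y1) * (cnj p + 1 / y1) \<noteq> 1" "(d + y1) * (cnj d + 1 / y1) \<noteq> 1"
        using g1 unfolding generic_def by auto
      have B1: "few (2 * 13) ?B1"
        by (intro few_UN few_v ne1 few_bad_x) (use fold_s(7)[OF g1(1) nE(1)] in blast)
      have B2: "few (2 * (2 * (5 + D1))) ?B2"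
      proof (intro few_UN few_v few_s ne1)
        fix t v assume "t \<in> {t. G13 y1 t (fold_w x1) = 0}" "v \<in> {v. G12 y1 t v = 0}"
        hence "v \<noteq> 0" "v \<notin> bad_v" using not_bad_w(4)[OF g1(2) nE(2)] by blast+
        moreover hence "2 * v \<noteq> p" "v \<notin> E" unfolding bad_v_def by auto
        ultimately show "few (5 + D1) (bad_y v)" using E(2) by (intro few_bad_y)
      qed
      have 1: "few (2 * 13 * 16) {z2 \<in> P. inc z2 \<gamma> \<and> fst z2 \<in> ?B1}"
      proof (rule few_UN_subset[where I = "?B1 \<inter> U" and S = "\<lambda>x. Pair x ` {y. cmod y = 1 \<and> linked p d W x y v0 v0'}"])
        show "few (2 * 13) (?B1 \<inter> U)" by (rule few_mono[OF B1]) auto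
        fix x assume "x \<in> ?B1 \<inter> U"
        hence "x \<in> U" by blast
        thus "few 16 (Pair x ` {y. cmod y = 1 \<and> linked p d W x y v0 v0'})"
          by (intro few_image few_y_linked W(2) U(1) V(1) g)
      next
        show "{z2 \<in> P. inc z2 \<gamma> \<and> fst z2 \<in> ?B1} \<subseteq> (\<Union>x\<in>?B1 \<inter> U. Pair x ` {y. cmod y = 1 \<and> linked p d W x y v0 v0'})"
        proof
          fix z2 assume a: "z2 \<in> {z2 \<in> P. inc z2 \<gamma> \<and> fst z2 \<in> ?B1}"
          obtain x y where xy: "z2 = (x, y)" by (cases z2)
          have "x \<in> U" "y \<in> U" "linked p d W x y v0 v0'" "x \<in> ?B1" using a unfolding xy P_def inc_def g by auto
          thus "z2 \<in> (\<Union>x\<in>?B1 \<inter> U. Pair x ` {y. cmod y = 1 \<and> linked p d W x y v0 v0'})" unfolding xy using U(2) by blast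
        qed
      qed
      have 2: "few (2 * (2 * (5 + D1)) * 16) {z2 \<in> P. inc z2 \<gamma> \<and> snd z2 \<in> ?B2}"
      proof (rule few_UN_subset[where I = "?B2 \<inter> U" and S = "\<lambda>y. (\<lambda>x. (x, y)) ` {x. cmod x = 1 \<and> linked p d W y x v0' v0}"])
        show "few (2 * (2 * (5 + D1))) (?B2 \<inter> U)" by (rule few_mono[OF B2]) auto
        fix y assume "y \<in> ?B2 \<inter> U"
        hence "y \<in> U" by blast
        thus "few 16 ((\<lambda>x. (x, y)) ` {x. cmod x = 1 \<and> linked p d W y x v0' v0})"
          by (intro few_image few_y_linked W(2) U(1) V(1) g)
      next
        show "{z2 \<in> P. inc z2 \<gamma> \<and> snd z2 \<in> ?B2} \<subseteq> (\<Union>y\<in>?B2 \<inter> U. (\<lambda>x. (x, y)) ` {x. cmod x = 1 \<and> linked p d W y x v0' v0})"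
        proof
          fix z2 assume a: "z2 \<in> {z2 \<in> P. inc z2 \<gamma> \<and> snd z2 \<in> ?B2}"
          obtain x y where xy: "z2 = (x, y)" by (cases z2)
          have "x \<in> U" "y \<in> U" "linked p d W x y v0 v0'" "y \<in> ?B2" using a unfolding xy P_def inc_def g by auto
          thus "z2 \<in> (\<Union>y\<in>?B2 \<inter> U. (\<lambda>x. (x, y)) ` {x. cmod x = 1 \<and> linked p d W y x v0' v0})"
            unfolding xy linked_sym[of p d W x y] using U(2) by blast
        qed
      qed
      show "few K {z2 \<in> P. inc z2 \<gamma> \<and> bad z z2}" unfolding K_def
        by (rule few_mono[OF few_Un[OF 1 2]]) (auto simp: bad_def z')
    next
      fix z1 z2 assume "z1 \<in> P" "z2 \<in> P" and nb: "\<not> bad z1 z2"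
      then obtain x1 y1 x2 y2 where z: "z1 = (x1, y1)" "z2 = (x2, y2)" and mem: "x1 \<in> U" "y1 \<in> U" "x2 \<in> U" "y2 \<in> U"
        and nE: "x1 \<notin> bad_start" "fold_w x1 \<notin> bad_w bad_v y1" unfolding P_def exc_def by auto
      have "separated bad_v x1 y1 x2 y2" using nb nE U(3) mem unfolding bad_def z separated_def by simp
      hence S: "few D2 (common_starts x1 y1 x2 y2)" using D2 tp by blast
      let ?S = "common_starts x1 y1 x2 y2"
      show "few (D2 * 16) {\<gamma> \<in> V \<times> V. inc z1 \<gamma> \<and> inc z2 \<gamma>}"
      proof (rule few_mono[OF few_curves_through[OF W(1) V(2) U(1)[OF mem(1)] U(1)[OF mem(2)] S]])
        show "{\<gamma> \<in> V \<times> V. inc z1 \<gamma> \<and> inc z2 \<gamma>} \<subseteq> {(v, v'). v \<in> V \<and> v' \<in> V \<and>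
           (\<exists>w\<in>W. \<exists>s t. s \<in> ?S \<and> touch p d x1 s v w \<and> touch p d y1 t v' w)}"
        proof
          fix \<gamma> assume g: "\<gamma> \<in> {\<gamma> \<in> V \<times> V. inc z1 \<gamma> \<and> inc z2 \<gamma>}"
          obtain v v' where vv: "\<gamma> = (v, v')" by (cases \<gamma>)
          have vV: "v \<in> V" "v' \<in> V" "linked p d W x1 y1 v v'" "linked p d W x2 y2 v v'" using g unfolding vv inc_def z by auto
          then obtain w1 s1 t1 w2 s2 t2 where w: "w1 \<in> W" "w2 \<in> W" and t: "touch p d x1 s1 v w1" "touch p d y1 t1 v' w1"
             "touch p d x2 s2 v w2" "touch p d y2 t2 v' w2" unfolding linked_def by blast
          have G: "G12 x s v = 0" "G13 x s w = 0" if "touch p d x s v w" "x \<in> U" "v \<in> V" "w \<in> W" for x s v w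
            using touch_G[of x s v p] touch_G[of x s w d] that U(2) V(2) W(2) unfolding touch_def by blast+
          have "s1 \<in> ?S" using G[OF t(1) mem(1) vV(1) w(1)] G[OF t(2) mem(2) vV(2) w(1)] G[OF t(3) mem(3) vV(1) w(2)]
            G[OF t(4) mem(4) vV(2) w(2)] unfolding common_starts_def by blast
          thus "\<gamma> \<in> {(v, v'). v \<in> V \<and> v' \<in> V \<and> (\<exists>w\<in>W. \<exists>s t. s \<in> ?S \<and> touch p d x1 s v w \<and> touch p d y1 t v' w)}"
            unfolding vv using vV(1,2) w(1) t(1,2) by blast
        qed
      qed auto
    next
      fix c :: "nat \<times> nat"
      obtain i j where c: "c = (i, j)" by (cases c)
      have "few (k * 2) {x \<in> U. blk (Re x) = i}" for i
        by (rule few_UN_subset[OF blk(1)[rule_format, of i], where S = "\<lambda>r. {x. cmod x = 1 \<and> Re x = r}"])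
           (use few_unit_with_Re U(2) in auto)
      hence "few (k * 2 * (k * 2)) (\<Union>x\<in>{x \<in> U. blk (Re x) = i}. Pair x ` {y \<in> U. blk (Re y) = j})"
        by (intro few_UN few_image)
      thus "few (k * 2 * (k * 2)) {z \<in> P. cell z = c}"
        by (rule few_mono) (auto simp: P_def cell_def c)
    qed
    have cV: "card (V \<times> V) \<le> n * n" using fV by (simp add: card_cartesian_product mult_le_mono)
    have cP: "card P \<le> n * n"
    proof -
      have "card P \<le> card (U \<times> U)" using fU by (intro card_mono) (auto simp: P_def)
      thus ?thesis using fU by (simp add: card_cartesian_product) (meson le_trans mult_le_mono)
    qed
    let ?I = "incidences p d U V W"
    have "?I = {(z, \<gamma>). z \<in> P \<and> \<gamma> \<in> V \<times> V \<and> inc z \<gamma>} \<union> {(z, \<gamma>). z \<in> X \<and> \<gamma> \<in> V \<times> V \<and> inc z \<gamma>}"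
      unfolding P_def X_def inc_def incidences_def by blast
    hence "card ?I \<le> card {(z, \<gamma>). z \<in> P \<and> \<gamma> \<in> V \<times> V \<and> inc z \<gamma>} + card {(z, \<gamma>). z \<in> X \<and> \<gamma> \<in> V \<times> V \<and> inc z \<gamma>}"
      by (simp only: card_Un_le)
    also have "\<dots> \<le> (card (V \<times> V) * (?L * K) + card P * (k * 2 * (k * 2)) * (D2 * 16)) + n * 222 * (n * 2 * 16)"
      using IP IX unfolding few_def by (intro add_mono) auto
    also have "\<dots> \<le> (n * n * (?L * K) + n * n * (k * 2 * (k * 2)) * (D2 * 16)) + n * 222 * (n * 2 * 16)"
      using cV cP by (intro add_mono mult_le_mono) auto
    finally show "card ?I \<le> n * n * (?L * K) + n * n * (k * 2 * (k * 2)) * (D2 * 16) + n * 222 * (n * 2 * 16)" .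
  qed
qed

lemma incidence_bound:
  "\<exists>B::real. B > 0 \<and> (\<forall>p d U V W n. admissible n p d U V W \<longrightarrow> n \<ge> 1 \<longrightarrow>
     real (card (incidences p d U V W)) \<le> B * real n powr (8 / 3))"
proof -
  obtain K D where KD: "\<forall>p d U V W n k. admissible n p d U V W \<longrightarrow> k \<ge> 1 \<longrightarrow>
     card (incidences p d U V W) \<le>
       n * n * (16 * (2 * (12 + 16 * (n div k + 1)) + 1) * K) + n * n * (k * 2 * (k * 2)) * D + n * 222 * (n * 2 * 16)"
    using incidence_count by blast
  \<comment> \<open>The bound of \<open>incidence_count\<close> with \<open>n div k + 1 \<le> 2 * n^(2/3)\<close> and \<open>k \<le> 2 * n^(1/3)\<close>.\<close>
  define B where "B = 1424 * real K + 16 * real D + 7104"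
  show ?thesis
  proof (intro exI[of _ B] conjI allI impI)
    show "B > 0" unfolding B_def by (simp add: add_nonneg_pos)
    fix p d U V W and n :: nat
    assume a: "admissible n p d U V W" and n: "n \<ge> 1"
    \<comment> \<open>All powers of \<open>n\<close> become integral powers of \<open>c\<close>.\<close>
    define c where "c = real n powr (1 / 3)"
    have c1: "c \<ge> 1" unfolding c_def using n by (intro ge_one_powr_ge_zero) auto
    have c3: "c ^ 3 = real n" unfolding c_def using n by (simp add: powr_power)
    have c8: "real n powr (8 / 3) = c ^ 8" unfolding c_def using n by (simp add: powr_power)
    \<comment> \<open>Blocks of size \<open>n^(1/3)\<close> balance the two main terms of \<open>incidence_count\<close>.\<close>
    define k where "k = nat \<lceil>c\<rceil>"
    have k: "c \<le> real k" "real k \<le> 2 * c" "k \<ge> 1" unfolding k_def using c1 by linarith+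
    define m where "m = n div k + 1"
    have m: "real m \<le> 2 * c^2"
    proof -
      have "real (n div k) \<le> real n / real k" by (rule of_nat_div_le_of_nat)
      also have "\<dots> \<le> real n / c" using k(1) c1 by (intro divide_left_mono) auto
      also have "\<dots> = c^2" unfolding c3[symmetric] using c1 by (simp add: power3_eq_cube power2_eq_square)
      finally have "real (n div k) \<le> c^2" .
      moreover have "1 \<le> c^2" using c1 by (simp add: one_le_power)
      ultimately show ?thesis unfolding m_def by simp
    qed
    let ?I = "card (incidences p d U V W)"
    have "?I \<le> n * n * (16 * (2 * (12 + 16 * m) + 1) * K) + n * n * (k * 2 * (k * 2)) * D + n * 222 * (n * 2 * 16)"
      using KD[rule_format, OF a k(3)] unfolding m_def .
    hence "real ?I \<le> real (n * n * (16 * (2 * (12 + 16 * m) + 1) * K) + n * n * (k * 2 * (k * 2)) * D + n * 222 * (n * 2 * 16))"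
      by (simp only: of_nat_le_iff)
    also have "\<dots> = c^6 * ((400 + 512 * real m) * real K) + c^6 * (4 * real k ^ 2) * real D + 7104 * c^6"
      unfolding of_nat_add of_nat_mult c3[symmetric] by (simp add: algebra_simps power2_eq_square flip: power_add)
    also have "\<dots> \<le> c^6 * ((1424 * c^2) * real K) + c^6 * (16 * c^2) * real D + 7104 * (c^6 * c^2)"
    proof (intro add_mono mult_left_mono mult_right_mono)
      have "1 \<le> c^2" using c1 by (simp add: one_le_power)
      thus "400 + 512 * real m \<le> 1424 * c^2" using m by simp
      have "real k ^ 2 \<le> (2 * c)^2" using k by (intro power_mono) auto
      thus "4 * real k ^ 2 \<le> 16 * c^2" by (simp add: power_mult_distrib)
      show "c^6 \<le> c^6 * c^2" using mult_left_mono[OF \<open>1 \<le> c^2\<close>, of "c^6"] c1 by simp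
    qed (use c1 in auto)
    also have "\<dots> = B * c^8" unfolding B_def by (simp add: algebra_simps flip: power_add)
    finally show "real ?I \<le> B * real n powr (8 / 3)" unfolding c8 .
  qed
qed

section \<open>From incidences to triple points\<close>

definition common_points :: "complex set \<Rightarrow> complex set \<Rightarrow> complex set \<Rightarrow> complex set" where
  "common_points K1 K2 K3 = {q. (\<exists>c\<in>K1. dist q c = 1) \<and> (\<exists>c\<in>K2. dist q c = 1) \<and> (\<exists>c\<in>K3. dist q c = 1)}"

lemma few_two_circles:
  assumes "a \<noteq> b" shows "few 2 {q :: complex. dist q a = 1 \<and> dist q b = 1}"
proof (rule few_mono[OF few_image[of 2 "{\<tau>. cmod \<tau> = 1 \<and> cmod ((a - b) + \<tau>) = 1}" "\<lambda>\<tau>. a + \<tau>"]])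
  show "few 2 {\<tau>. cmod \<tau> = 1 \<and> cmod ((a - b) + \<tau>) = 1}" using assms by (intro few_unit_circle) simp
  show "{q. dist q a = 1 \<and> dist q b = 1} \<subseteq> (\<lambda>\<tau>. a + \<tau>) ` {\<tau>. cmod \<tau> = 1 \<and> cmod ((a - b) + \<tau>) = 1}"
  proof
    fix q assume "q \<in> {q. dist q a = 1 \<and> dist q b = 1}"
    hence "q = a + (q - a)" "cmod (q - a) = 1" "cmod ((a - b) + (q - a)) = 1" by (auto simp: dist_norm)
    thus "q \<in> (\<lambda>\<tau>. a + \<tau>) ` {\<tau>. cmod \<tau> = 1 \<and> cmod ((a - b) + \<tau>) = 1}" by blast
  qed
qed simp

definition centres_through :: "nat \<Rightarrow> complex \<Rightarrow> complex \<Rightarrow> complex \<Rightarrow> complex set \<Rightarrow> complex set \<Rightarrow> complex set \<Rightarrow> bool" where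
  "centres_through n P1 P2 P3 K1 K2 K3 \<longleftrightarrow> P1 \<noteq> P2 \<and> P1 \<noteq> P3 \<and> P2 \<noteq> P3 \<and> n \<ge> 1 \<and> few n K1 \<and> few n K2 \<and> few n K3 \<and>
     (\<forall>a\<in>K1. dist a P1 = 1) \<and> (\<forall>b\<in>K2. dist b P2 = 1) \<and> (\<forall>c\<in>K3. dist c P3 = 1)"

text \<open>
  Cauchy-Schwarz over the third family, followed by \<open>incidence_bound\<close>.
\<close>

lemma few_common_points_generic:
  "\<exists>A::real. A > 0 \<and> (\<forall>P1 P2 P3 K1 K2 K3 n. centres_through n P1 P2 P3 K1 K2 K3 \<longrightarrow>
     (\<forall>a\<in>K1. dist a P2 \<noteq> 1 \<and> dist a P3 \<noteq> 1) \<longrightarrow>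
     (\<forall>b\<in>K2. dist b P1 \<noteq> 1 \<and> dist b P3 \<noteq> 1) \<longrightarrow> (\<forall>c\<in>K3. dist c P1 \<noteq> 1 \<and> dist c P2 \<noteq> 1) \<longrightarrow>
     finite (common_points K1 K2 K3) \<and> real (card (common_points K1 K2 K3)) \<le> A * real n powr (11 / 6))"
proof -
  obtain B where B: "B > 0" "\<forall>p d U V W n. admissible n p d U V W \<longrightarrow> n \<ge> 1 \<longrightarrow>
     real (card (incidences p d U V W)) \<le> B * real n powr (8 / 3)"
    using incidence_bound by blast
  show ?thesis
  proof (intro exI[of _ "sqrt (4 * B)"] conjI allI impI)
    show "sqrt (4 * B) > 0" using B(1) by simp
    fix P1 P2 P3 :: complex and K1 K2 K3 and n :: nat
    assume ct: "centres_through n P1 P2 P3 K1 K2 K3"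
      and generic: "\<forall>a\<in>K1. dist a P2 \<noteq> 1 \<and> dist a P3 \<noteq> 1" "\<forall>b\<in>K2. dist b P1 \<noteq> 1 \<and> dist b P3 \<noteq> 1"
        "\<forall>c\<in>K3. dist c P1 \<noteq> 1 \<and> dist c P2 \<noteq> 1"
    have P: "P1 \<noteq> P2" "P1 \<noteq> P3" "P2 \<noteq> P3" and n: "n \<ge> 1" and nK: "few n K1" "few n K2" "few n K3"
      and k1: "\<forall>a\<in>K1. dist a P1 = 1 \<and> dist a P2 \<noteq> 1 \<and> dist a P3 \<noteq> 1"
      and k2: "\<forall>b\<in>K2. dist b P2 = 1 \<and> dist b P1 \<noteq> 1 \<and> dist b P3 \<noteq> 1"
      and k3: "\<forall>c\<in>K3. dist c P3 = 1 \<and> dist c P1 \<noteq> 1 \<and> dist c P2 \<noteq> 1"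
      using ct generic unfolding centres_through_def by simp_all
    define p d where "p = P1 - P2" and "d = P1 - P3"
    define U V W where "U = (\<lambda>a. a - P1) ` K1" and "V = (\<lambda>b. b - P2) ` K2" and "W = (\<lambda>c. c - P3) ` K3"
    have pd: "p \<noteq> 0" "d \<noteq> 0" "p \<noteq> d" using P unfolding p_def d_def by auto
    have nUV: "few n U" "few n V" unfolding U_def V_def by (intro few_image nK)+
    have gU: "\<forall>x\<in>U. goodu p d x" unfolding U_def goodu_def p_def d_def using k1 by (auto simp: dist_norm)
    have gV: "\<forall>v\<in>V. goodv p d v" unfolding V_def goodv_def p_def d_def using k2 by (auto simp: dist_norm)
    have gW: "\<forall>w\<in>W. goodw p d w" unfolding W_def goodw_def p_def d_def using k3 by (auto simp: dist_norm)
    let ?Q = "common_points K1 K2 K3"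
    let ?J = "incidences p d U V W"
    have "admissible n p d U V W" unfolding admissible_def using pd nUV gU gV gW by blast
    hence J: "real (card ?J) \<le> B * real n powr (8 / 3)" using B(2) n by blast
    have "\<forall>q. \<exists>z. q \<in> ?Q \<longrightarrow> (\<exists>a b c. z = (a, b, c) \<and> a \<in> K1 \<and> b \<in> K2 \<and> c \<in> K3 \<and> dist q a = 1 \<and> dist q b = 1 \<and> dist q c = 1)"
      unfolding common_points_def by blast
    from choice[OF this] obtain f where f: "\<And>q. q \<in> ?Q \<Longrightarrow> \<exists>a b c. f q = (a, b, c) \<and> a \<in> K1 \<and> b \<in> K2 \<and> c \<in> K3 \<and>
      dist q a = 1 \<and> dist q b = 1 \<and> dist q c = 1" by blast
    define fa fb fc where "fa q = fst (f q)" and "fb q = fst (snd (f q))" and "fc q = snd (snd (f q))" for q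
    have F: "fa q \<in> K1" "fb q \<in> K2" "fc q \<in> K3" "dist q (fa q) = 1" "dist q (fb q) = 1" "dist q (fc q) = 1" if "q \<in> ?Q" for q
      using f[OF that] unfolding fa_def fb_def fc_def by auto
    have ab: "a \<noteq> b" if "a \<in> K1" "b \<in> K2" for a b using k1 k2 that by auto
    have fQ: "few (n * (n * 2)) ?Q"
    proof (rule few_UN_subset[OF nK(1), where S = "\<lambda>a. \<Union>b\<in>K2. {q. dist q a = 1 \<and> dist q b = 1}"])
      show "few (n * 2) (\<Union>b\<in>K2. {q. dist q a = 1 \<and> dist q b = 1})" if "a \<in> K1" for a
        using ab that by (intro few_UN[OF nK(2)] few_two_circles)
    qed (auto simp: common_points_def)
    hence finQ: "finite ?Q" by (simp add: few_def)
    have finK: "finite K3" "card K3 \<le> n" using nK(3) by (auto simp: few_def)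
    have link: "((fa q - P1, fa q' - P1), (fb q - P2, fb q' - P2)) \<in> ?J" if q: "q \<in> ?Q" "q' \<in> ?Q" "fc q = fc q'" for q q'
    proof -
      have t: "touch p d (fa q - P1) (q - fa q) (fb q - P2) (fc q - P3)" if "q \<in> ?Q" for q
        unfolding touch_def p_def d_def using F[OF that] by (simp add: dist_norm)
      have "touch p d (fa q' - P1) (q' - fa q') (fb q' - P2) (fc q - P3)" using t[OF q(2)] q(3) by simp
      hence "linked p d W (fa q - P1) (fa q' - P1) (fb q - P2) (fb q' - P2)"
        unfolding linked_def W_def using t[OF q(1)] F(3)[OF q(1)] by blast
      thus ?thesis unfolding incidences_def U_def V_def using F[OF q(1)] F[OF q(2)] by blast
    qed
    let ?R = "SIGMA q:?Q. {q'\<in>?Q. fc q' = fc q}"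
    have "finite ?J"
      by (rule finite_subset[of _ "(U \<times> U) \<times> (V \<times> V)"]) (use nUV in \<open>auto simp: few_def incidences_def\<close>)
    hence fewJ: "few (card ?J) ?J" by (simp add: few_def)
    let ?S = "\<lambda>z. \<Union>q\<in>{q. dist q (fst (fst z) + P1) = 1 \<and> dist q (fst (snd z) + P2) = 1}.
        Pair q ` {q'. dist q' (snd (fst z) + P1) = 1 \<and> dist q' (snd (snd z) + P2) = 1}"
    have R: "few (card ?J * (2 * 2)) ?R"
    proof (rule few_UN_subset[OF fewJ, where S = ?S])
      fix z assume "z \<in> ?J"
      hence m: "fst (fst z) \<in> U" "snd (fst z) \<in> U" "fst (snd z) \<in> V" "snd (snd z) \<in> V"
        unfolding incidences_def by auto
      have "fst (fst z) + P1 \<noteq> fst (snd z) + P2" "snd (fst z) + P1 \<noteq> snd (snd z) + P2"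
        using m ab unfolding U_def V_def by auto
      thus "few (2 * 2) (?S z)" by (intro few_UN few_image few_two_circles)
    next
      show "?R \<subseteq> (\<Union>z\<in>?J. ?S z)"
      proof
        fix z assume "z \<in> ?R"
        then obtain q q' where z: "z = (q, q')" and q: "q \<in> ?Q" "q' \<in> ?Q" "fc q' = fc q" by blast
        show "z \<in> (\<Union>z\<in>?J. ?S z)"
          by (rule UN_I[OF link[OF q(1,2) q(3)[symmetric]]]) (use F[OF q(1)] F[OF q(2)] z in auto)
      qed
    qed
    define Mc where "Mc c = card {q\<in>?Q. fc q = c}" for c
    have M: "card ?Q = (\<Sum>c\<in>K3. Mc c)"
    proof -
      have "?Q = (\<Union>c\<in>K3. {q\<in>?Q. fc q = c})" using F(3) by blast
      hence "card ?Q = card (\<Union>c\<in>K3. {q\<in>?Q. fc q = c})" by simp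
      also have "\<dots> = (\<Sum>c\<in>K3. Mc c)" unfolding Mc_def using finK finQ by (intro card_UN_disjoint) auto
      finally show ?thesis .
    qed
    have M2: "(\<Sum>c\<in>K3. (Mc c)^2) = card ?R"
    proof -
      have "(\<Sum>c\<in>K3. (Mc c)^2) = (\<Sum>c\<in>K3. card ({q\<in>?Q. fc q = c} \<times> {q\<in>?Q. fc q = c}))"
        unfolding Mc_def by (simp add: card_cartesian_product power2_eq_square)
      also have "\<dots> = card (\<Union>c\<in>K3. {q\<in>?Q. fc q = c} \<times> {q\<in>?Q. fc q = c})"
        using finK finQ by (intro card_UN_disjoint[symmetric]) auto
      also have "(\<Union>c\<in>K3. {q\<in>?Q. fc q = c} \<times> {q\<in>?Q. fc q = c}) = ?R" using F(3) by auto
      finally show ?thesis .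
    qed
    have "real (card ?Q)^2 = (\<Sum>c\<in>K3. real (Mc c))^2" unfolding M by simp
    also have "\<dots> \<le> (\<Sum>c\<in>K3. (real (Mc c))^2) * real (card K3)"
      using sum_squared_le_sum_of_squares[of "\<lambda>c. real (Mc c)" K3] finK by (simp add: mult.commute)
    also have "(\<Sum>c\<in>K3. (real (Mc c))^2) = real (card ?R)" unfolding M2[symmetric] by simp
    also have "real (card ?R) * real (card K3) \<le> (4 * B * real n powr (8 / 3)) * real n"
    proof (intro mult_mono)
      have "real (card ?R) \<le> real (card ?J * (2 * 2))" using R unfolding few_def by (simp only: of_nat_le_iff)
      thus "real (card ?R) \<le> 4 * B * real n powr (8 / 3)" using J by simp
    qed (use finK B in auto)
    also have "\<dots> = 4 * B * (real n powr (11 / 6))^2"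
    proof -
      have "real n powr (8 / 3) * real n = real n powr (11 / 3)" using n powr_add[of "real n" "8 / 3" 1] by simp
      moreover have "(real n powr (11 / 6))^2 = real n powr (11 / 3)"
        using powr_add[of "real n" "11 / 6" "11 / 6"] by (simp add: power2_eq_square)
      ultimately show ?thesis by simp
    qed
    finally have "real (card ?Q)^2 \<le> (sqrt (4 * B) * real n powr (11 / 6))^2"
      using B(1) by (simp add: power_mult_distrib)
    hence "real (card ?Q) \<le> sqrt (4 * B) * real n powr (11 / 6)"
      using B(1) by (intro power2_le_imp_le[of "real (card ?Q)"]) auto
    thus "finite ?Q" "real (card ?Q) \<le> sqrt (4 * B) * real n powr (11 / 6)" using finQ by blast+
  qed
qed

text \<open>
  The circle with centre \<open>c\<close> is absent from at least one of the families; every point in question lies on a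
  circle of that family.
\<close>

lemma few_common_points_on_circle:
  assumes "few n K1" "few n K2" "few n K3" "K1 \<inter> K2 \<inter> K3 = {}"
  shows "few (n * 2) {q\<in>common_points K1 K2 K3. dist q c = 1}"
proof -
  have "few (n * 2) {q\<in>common_points K1 K2 K3. dist q c = 1}"
    if K: "K = K1 \<or> K = K2 \<or> K = K3" and "c \<notin> K" for K
  proof (rule few_UN_subset[where I = K and S = "\<lambda>b. {q. dist q c = 1 \<and> dist q b = 1}"])
    show "few n K" using K assms by blast
    show "few 2 {q. dist q c = 1 \<and> dist q b = 1}" if "b \<in> K" for b
      using that \<open>c \<notin> K\<close> by (intro few_two_circles) auto
    show "{q \<in> common_points K1 K2 K3. dist q c = 1} \<subseteq> (\<Union>b\<in>K. {q. dist q c = 1 \<and> dist q b = 1})"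
      using K unfolding common_points_def by blast
  qed
  thus ?thesis using assms(4) by blast
qed

lemma few_common_points:
  "\<exists>A::real. A > 0 \<and> (\<forall>P1 P2 P3 K1 K2 K3 n. centres_through n P1 P2 P3 K1 K2 K3 \<longrightarrow> K1 \<inter> K2 \<inter> K3 = {} \<longrightarrow>
     finite (common_points K1 K2 K3) \<and> real (card (common_points K1 K2 K3)) \<le> A * real n powr (11 / 6))"
proof -
  obtain A where A: "A > 0" "\<forall>P1 P2 P3 K1 K2 K3 n. centres_through n P1 P2 P3 K1 K2 K3 \<longrightarrow>
     (\<forall>a\<in>K1. dist a P2 \<noteq> 1 \<and> dist a P3 \<noteq> 1) \<longrightarrow>
     (\<forall>b\<in>K2. dist b P1 \<noteq> 1 \<and> dist b P3 \<noteq> 1) \<longrightarrow> (\<forall>c\<in>K3. dist c P1 \<noteq> 1 \<and> dist c P2 \<noteq> 1) \<longrightarrow>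
     finite (common_points K1 K2 K3) \<and> real (card (common_points K1 K2 K3)) \<le> A * real n powr (11 / 6)"
    using few_common_points_generic by blast
  show ?thesis
  proof (rule exI[of _ "A + 12"], intro conjI allI impI)
    show "A + 12 > 0" using A(1) by simp
    fix P1 P2 P3 :: complex and K1 K2 K3 and n :: nat
    assume ct: "centres_through n P1 P2 P3 K1 K2 K3" and disj: "K1 \<inter> K2 \<inter> K3 = {}"
    have P: "P1 \<noteq> P2" "P1 \<noteq> P3" "P2 \<noteq> P3" and n: "n \<ge> 1" and nK: "few n K1" "few n K2" "few n K3"
      and k: "\<forall>a\<in>K1. dist a P1 = 1" "\<forall>b\<in>K2. dist b P2 = 1" "\<forall>c\<in>K3. dist c P3 = 1"
      using ct unfolding centres_through_def by blast+
    \<comment> \<open>Centres of circles that contain two of the base points.\<close>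
    define S where "S = {c. dist c P1 = 1 \<and> dist c P2 = 1} \<union> {c. dist c P1 = 1 \<and> dist c P3 = 1} \<union> {c. dist c P2 = 1 \<and> dist c P3 = 1}"
    have S: "few 6 S" unfolding S_def
      using few_Un[OF few_Un[OF few_two_circles[OF P(1)] few_two_circles[OF P(2)]] few_two_circles[OF P(3)]] by simp
    let ?Q = "common_points K1 K2 K3" and ?Q' = "common_points (K1 - S) (K2 - S) (K3 - S)"
    have Q': "finite ?Q'" "real (card ?Q') \<le> A * real n powr (11 / 6)"
    proof -
      have "few n (K1 - S)" "few n (K2 - S)" "few n (K3 - S)" using nK by (auto intro: few_mono)
      hence "centres_through n P1 P2 P3 (K1 - S) (K2 - S) (K3 - S)"
        using P n k unfolding centres_through_def by blast
      moreover have "\<forall>a\<in>K1 - S. dist a P2 \<noteq> 1 \<and> dist a P3 \<noteq> 1" "\<forall>b\<in>K2 - S. dist b P1 \<noteq> 1 \<and> dist b P3 \<noteq> 1"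
        "\<forall>c\<in>K3 - S. dist c P1 \<noteq> 1 \<and> dist c P2 \<noteq> 1" using k unfolding S_def by blast+
      ultimately have "finite ?Q' \<and> real (card ?Q') \<le> A * real n powr (11 / 6)" using A(2) by blast
      thus "finite ?Q'" "real (card ?Q') \<le> A * real n powr (11 / 6)" by blast+
    qed
    let ?E = "\<Union>c\<in>S. {q\<in>?Q. dist q c = 1}"
    have E: "few (6 * (n * 2)) ?E" by (rule few_UN[OF S few_common_points_on_circle[OF nK disj]])
    have sub: "?Q \<subseteq> ?Q' \<union> ?E"
    proof
      fix q assume q: "q \<in> ?Q"
      then obtain a b c where abc: "a \<in> K1" "b \<in> K2" "c \<in> K3" "dist q a = 1" "dist q b = 1" "dist q c = 1"
        unfolding common_points_def by blast
      show "q \<in> ?Q' \<union> ?E"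
      proof (cases "a \<in> S \<or> b \<in> S \<or> c \<in> S")
        case True thus ?thesis using q abc by blast
      next
        case False thus ?thesis using abc unfolding common_points_def by blast
      qed
    qed
    have fin: "finite (?Q' \<union> ?E)" using Q'(1) E by (simp add: few_def)
    thus "finite ?Q" using sub by (rule finite_subset[rotated])
    have "card ?Q \<le> card ?Q' + card ?E" using card_mono[OF fin sub] card_Un_le by (rule le_trans)
    hence "real (card ?Q) \<le> real (card ?Q') + real (card ?E)" by linarith
    also have "real (card ?E) \<le> 12 * real n" using E unfolding few_def by linarith
    also have "real n \<le> real n powr (11 / 6)" using n powr_mono[of 1 "11/6" "real n"] by simp
    finally show "real (card ?Q) \<le> (A + 12) * real n powr (11 / 6)" using Q'(2) by (simp add: ring_distribs)
  qed
qed

definition to_complex :: "real ^ 2 \<Rightarrow> complex" where "to_complex z = Complex (z $ 1) (z $ 2)"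
definition of_complex :: "complex \<Rightarrow> real ^ 2" where "of_complex z = vector [Re z, Im z]"

lemma to_complex_inverse: "to_complex (of_complex z) = z" "of_complex (to_complex x) = x"
  unfolding to_complex_def of_complex_def by (auto simp: vec_eq_iff forall_2)

lemma dist_to_complex: "dist (to_complex x) (to_complex y) = dist x y"
  unfolding to_complex_def by (simp add: dist_norm cmod_def norm_vec_def L2_set_def sum_2)

lemma unit_sphere_inj:
  fixes a b :: "'a :: euclidean_space"
  assumes "sphere a 1 = sphere b 1" shows "a = b"
proof (rule ccontr)
  assume "a \<noteq> b"
  define u where "u = (a - b) /\<^sub>R norm (a - b)"
  have u: "norm u = 1" "a - b = norm (a - b) *\<^sub>R u" unfolding u_def using \<open>a \<noteq> b\<close> by simp_all
  have "a + u \<in> sphere a 1" using u(1) by (simp add: dist_norm)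
  hence "norm (a - b + u) = 1" unfolding assms by (simp add: dist_norm norm_minus_commute algebra_simps)
  also have "a - b + u = (norm (a - b) + 1) *\<^sub>R u" by (subst u(2)) (simp add: scaleR_add_left)
  finally have "norm (a - b) + 1 = 1" using u(1) by simp
  thus False using \<open>a \<noteq> b\<close> by simp
qed

theorem theorem1:
  shows "\<exists>A::real. A > 0 \<and>
    (\<forall>(n::nat) (p1::real ^ 2) (p2::real ^ 2) (p3::real ^ 2) \<C>1 \<C>2 \<C>3.
       n \<ge> 1 \<longrightarrow> p1 \<noteq> p2 \<longrightarrow> p1 \<noteq> p3 \<longrightarrow> p2 \<noteq> p3 \<longrightarrow>
       unit_circles_through p1 n \<C>1 \<longrightarrow>
       unit_circles_through p2 n \<C>2 \<longrightarrow>
       unit_circles_through p3 n \<C>3 \<longrightarrow>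
       \<C>1 \<inter> \<C>2 \<inter> \<C>3 = {} \<longrightarrow>
       finite (triple_points \<C>1 \<C>2 \<C>3) \<and>
       real (card (triple_points \<C>1 \<C>2 \<C>3)) \<le> A * real n powr (11 / 6))"
proof -
  obtain A where A: "A > 0" "\<forall>P1 P2 P3 K1 K2 K3 n. centres_through n P1 P2 P3 K1 K2 K3 \<longrightarrow> K1 \<inter> K2 \<inter> K3 = {} \<longrightarrow>
     finite (common_points K1 K2 K3) \<and> real (card (common_points K1 K2 K3)) \<le> A * real n powr (11 / 6)"
    using few_common_points by blast
  show ?thesis
  proof (rule exI[of _ A], intro conjI allI impI)
    show "A > 0" by (rule A(1))
    fix n :: nat and p1 p2 p3 :: "real ^ 2" and \<C>1 \<C>2 \<C>3 :: "(real ^ 2) set set"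
    assume n: "n \<ge> 1" and p: "p1 \<noteq> p2" "p1 \<noteq> p3" "p2 \<noteq> p3"
      and C: "unit_circles_through p1 n \<C>1" "unit_circles_through p2 n \<C>2" "unit_circles_through p3 n \<C>3"
      and disj: "\<C>1 \<inter> \<C>2 \<inter> \<C>3 = {}"
    define K where "K \<C> = {c. sphere (of_complex c) 1 \<in> \<C>}" for \<C>
    have K: "few n (K \<C>)" "\<forall>a\<in>K \<C>. dist a (to_complex q) = 1" if "unit_circles_through q n \<C>" for q \<C>
    proof -
      have fin: "finite \<C>" "card \<C> = n" using that n card.infinite unfolding unit_circles_through_def by force+
      have inj: "inj_on (\<lambda>c. sphere (of_complex c) 1) (K \<C>)"
      proof (rule inj_onI)
        fix a b assume "sphere (of_complex a) 1 = sphere (of_complex b) 1"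
        hence "of_complex a = of_complex b" by (rule unit_sphere_inj)
        thus "a = b" by (metis to_complex_inverse(1))
      qed
      have im: "(\<lambda>c. sphere (of_complex c) 1) ` K \<C> \<subseteq> \<C>" unfolding K_def by blast
      show "few n (K \<C>)" unfolding few_def
        using card_inj_on_le[OF inj im fin(1)] inj_on_finite[OF inj im fin(1)] fin(2) by simp
      show "\<forall>a\<in>K \<C>. dist a (to_complex q) = 1"
      proof
        fix a assume "a \<in> K \<C>"
        hence "q \<in> sphere (of_complex a) 1" using that unfolding unit_circles_through_def K_def by blast
        hence "dist (to_complex (of_complex a)) (to_complex q) = 1" unfolding dist_to_complex by simp
        thus "dist a (to_complex q) = 1" unfolding to_complex_inverse .
      qed
    qed
    have tp: "q \<in> triple_points \<C>1 \<C>2 \<C>3 \<longleftrightarrow> to_complex q \<in> common_points (K \<C>1) (K \<C>2) (K \<C>3)" for q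
    proof -
      have "(\<exists>\<gamma>\<in>\<C>. q \<in> \<gamma>) \<longleftrightarrow> (\<exists>c\<in>K \<C>. dist (to_complex q) c = 1)"
        if fam: "unit_circles_through r n \<C>" for r \<C>
      proof -
        have "(\<exists>\<gamma>\<in>\<C>. q \<in> \<gamma>) \<longleftrightarrow> (\<exists>c. sphere c 1 \<in> \<C> \<and> dist c q = 1)"
        proof
          assume "\<exists>\<gamma>\<in>\<C>. q \<in> \<gamma>"
          then obtain \<gamma> where g: "\<gamma> \<in> \<C>" "q \<in> \<gamma>" by blast
          then obtain c where "\<gamma> = sphere c 1" using fam unfolding unit_circles_through_def unit_circle_def by blast
          thus "\<exists>c. sphere c 1 \<in> \<C> \<and> dist c q = 1" using g by (intro exI[of _ c]) simp
        next
          assume "\<exists>c. sphere c 1 \<in> \<C> \<and> dist c q = 1"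
          then obtain c where "sphere c 1 \<in> \<C>" "q \<in> sphere c 1" by auto
          thus "\<exists>\<gamma>\<in>\<C>. q \<in> \<gamma>" by blast
        qed
        also have "\<dots> \<longleftrightarrow> (\<exists>c. sphere (of_complex c) 1 \<in> \<C> \<and> dist (of_complex c) q = 1)"
          by (metis to_complex_inverse(2))
        also have "\<dots> \<longleftrightarrow> (\<exists>c\<in>K \<C>. dist (to_complex q) c = 1)"
          unfolding K_def by (metis dist_commute dist_to_complex mem_Collect_eq to_complex_inverse(1))
        finally show ?thesis .
      qed
      thus ?thesis using C unfolding triple_points_def common_points_def by simp
    qed
    let ?Q = "common_points (K \<C>1) (K \<C>2) (K \<C>3)"
    have "finite ?Q \<and> real (card ?Q) \<le> A * real n powr (11 / 6)"
    proof -
      have inj: "to_complex a \<noteq> to_complex b" if "a \<noteq> b" for a b using that by (metis to_complex_inverse(2))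
      have "K \<C>1 \<inter> K \<C>2 \<inter> K \<C>3 = {}" using disj unfolding K_def by blast
      moreover have "centres_through n (to_complex p1) (to_complex p2) (to_complex p3) (K \<C>1) (K \<C>2) (K \<C>3)"
        unfolding centres_through_def using inj p n K[OF C(1)] K[OF C(2)] K[OF C(3)] by blast
      ultimately show ?thesis using A(2) by blast
    qed
    moreover have "triple_points \<C>1 \<C>2 \<C>3 = of_complex ` ?Q"
    proof
      show "triple_points \<C>1 \<C>2 \<C>3 \<subseteq> of_complex ` ?Q" using tp to_complex_inverse(2) by (metis image_eqI subsetI)
      show "of_complex ` ?Q \<subseteq> triple_points \<C>1 \<C>2 \<C>3" using tp to_complex_inverse(1) by auto
    qed
    ultimately show "finite (triple_points \<C>1 \<C>2 \<C>3)" "real (card (triple_points \<C>1 \<C>2 \<C>3)) \<le> A * real n powr (11 / 6)"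
      using card_image_le[of ?Q of_complex] by auto
  qed
qed

end
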